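(* Let $\nu,\lambda\in\mathfrak M^{\mathrm{inv}}_{\bar m}(\mathfrak C,M)$ with $\nu$ Borel-definable over $M$, and let $\mu\in\mathfrak M^{\mathrm{inv}}_{\bar y}(\mathfrak C,M)$ be definable over $M$. Then $(\mu*\nu)*\lambda=\mu*(\nu*\lambda)$.
   Context: $T$ is an arbitrary complete theory, $\mathfrak C$ a monster model, $\mathfrak C'\succ\mathfrak C$ a bigger monster model, $M\preceq\mathfrak C$ small with enumeration $\bar m$, $\bar x,\bar y$ tuples of variables corresponding to $\bar m$. $\mathfrak M_{\bar m}(\mathfrak C)$ = global Keisler measures in $\bar y$ concentrating on $\mathrm{tp}(\bar m/\emptyset)$; "inv" = $M$-invariant. For $M$-invariant $\mu$ and formula $\varphi(\bar y;\bar z)$, $F^\varphi_\mu(q)=\mu(\varphi(\bar y;\bar b))$, $\bar b\models q\in S_{\bar z}(M)$; $\mu$ is Borel-definable [definable] over $M$ if all $F^\varphi_\mu$ are Borel [continuous]. Morley product with a measure $\lambda_0$ over $M$: $(\mu_{\bar y}\otimes\lambda_{0,\bar x})(\varphi(\bar x;\bar y))=\int_{S_{\bar x}(M)}F^{\varphi}_{\mu}d\lambda_0$. $h_{\bar b}:S_{\bar m}(\mathfrak C)\to S_{\bar x}(M)$, $\mathrm{tp}(\sigma(\bar m)/\mathfrak C)\mapsto\mathrm{tp}(\sigma^{-1}(\bar b)/M)$ ($\sigma\in\mathrm{Aut}(\mathfrak C')$, $\bar b\in\mathfrak C^{\bar x}$). Convolution: for Borel-definable $M$-invariant $\mu$ and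 $\nu\in\mathfrak M_{\bar m}(\mathfrak C)$, $(\mu*\nu)(\varphi(\bar b;\bar y)):=(\mu_{\bar y}\otimes((h_{\bar b})_*\nu)_{\bar x})(\varphi(\bar x;\bar y))$. (When $\mu$ is $M$-definable and $\nu$ is Borel-definable over $M$, $\mu*\nu$ is Borel-definable over $M$, so both sides are defined.) *)

theory Defs
  imports "HOL-Probability.Probability"
begin

unbundle cardinal_syntax

text \<open>
  Languages and structures (one-sorted). A language is a set of function symbols and a set of
  relation symbols, each paired with its arity; either set may be empty.
\<close>

record ('f, 'r) language =
  funs :: "('f \<times> nat) set"
  rels :: "('r \<times> nat) set"

record ('f, 'r, 'a) struct =
  univ :: "'a set"
  fint :: "'f \<Rightarrow> 'a list \<Rightarrow> 'a"
  rint :: "'r \<Rightarrow> 'a list \<Rightarrow> bool"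

definition structure_on :: "('f, 'r) language \<Rightarrow> ('f, 'r, 'a) struct \<Rightarrow> bool" where
  "structure_on L S \<longleftrightarrow> univ S \<noteq> {} \<and>
     (\<forall>(f, n) \<in> funs L. \<forall>as. set as \<subseteq> univ S \<and> length as = n \<longrightarrow> fint S f as \<in> univ S)"

text \<open>
  Formulas with parameters: \<open>Par a\<close> is a constant naming the element \<open>a\<close>. \<open>Fml L A V\<close> is the set of
  \<open>L(A)\<close>-formulas whose free variables lie in \<open>V\<close>.
\<close>

datatype ('f, 'v, trm_params: 'a) trm =
  Var 'v | Par 'a | Fun 'f "('f, 'v, 'a) trm list"

datatype ('f, 'r, 'v, params: 'a) fml =
    Eq "('f, 'v, 'a) trm" "('f, 'v, 'a) trm"
  | Rel 'r "('f, 'v, 'a) trm list"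
  | Neg "('f, 'r, 'v, 'a) fml"
  | And "('f, 'r, 'v, 'a) fml" "('f, 'r, 'v, 'a) fml"
  | Exists 'v "('f, 'r, 'v, 'a) fml"

fun wf_trm :: "('f, 'r) language \<Rightarrow> ('f, 'v, 'a) trm \<Rightarrow> bool" where
  "wf_trm L (Var v) = True"
| "wf_trm L (Par a) = True"
| "wf_trm L (Fun f ts) = ((f, length ts) \<in> funs L \<and> (\<forall>t \<in> set ts. wf_trm L t))"

fun wf_fml :: "('f, 'r) language \<Rightarrow> ('f, 'r, 'v, 'a) fml \<Rightarrow> bool" where
  "wf_fml L (Eq t u) = (wf_trm L t \<and> wf_trm L u)"
| "wf_fml L (Rel r ts) = ((r, length ts) \<in> rels L \<and> (\<forall>t \<in> set ts. wf_trm L t))"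
| "wf_fml L (Neg \<phi>) = wf_fml L \<phi>"
| "wf_fml L (And \<phi> \<psi>) = (wf_fml L \<phi> \<and> wf_fml L \<psi>)"
| "wf_fml L (Exists v \<phi>) = wf_fml L \<phi>"

fun fv_trm :: "('f, 'v, 'a) trm \<Rightarrow> 'v set" where
  "fv_trm (Var v) = {v}"
| "fv_trm (Par a) = {}"
| "fv_trm (Fun f ts) = (\<Union>t \<in> set ts. fv_trm t)"

fun fv :: "('f, 'r, 'v, 'a) fml \<Rightarrow> 'v set" where
  "fv (Eq t u) = fv_trm t \<union> fv_trm u"
| "fv (Rel r ts) = (\<Union>t \<in> set ts. fv_trm t)"
| "fv (Neg \<phi>) = fv \<phi>"
| "fv (And \<phi> \<psi>) = fv \<phi> \<union> fv \<psi>"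
| "fv (Exists v \<phi>) = fv \<phi> - {v}"

definition Fml :: "('f, 'r) language \<Rightarrow> 'a set \<Rightarrow> 'v set \<Rightarrow> ('f, 'r, 'v, 'a) fml set" where
  "Fml L A V = {\<phi>. wf_fml L \<phi> \<and> params \<phi> \<subseteq> A \<and> fv \<phi> \<subseteq> V}"

fun eval :: "('f, 'r, 'a) struct \<Rightarrow> ('v \<Rightarrow> 'a) \<Rightarrow> ('f, 'v, 'a) trm \<Rightarrow> 'a" where
  "eval S s (Var v) = s v"
| "eval S s (Par a) = a"
| "eval S s (Fun f ts) = fint S f (map (eval S s) ts)"

fun sat :: "('f, 'r, 'a) struct \<Rightarrow> ('v \<Rightarrow> 'a) \<Rightarrow> ('f, 'r, 'v, 'a) fml \<Rightarrow> bool" where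
  "sat S s (Eq t u) = (eval S s t = eval S s u)"
| "sat S s (Rel r ts) = rint S r (map (eval S s) ts)"
| "sat S s (Neg \<phi>) = (\<not> sat S s \<phi>)"
| "sat S s (And \<phi> \<psi>) = (sat S s \<phi> \<and> sat S s \<psi>)"
| "sat S s (Exists v \<phi>) = (\<exists>a \<in> univ S. sat S (s(v := a)) \<phi>)"

text \<open>\<open>inst V b \<phi>\<close> substitutes the parameter \<open>b v\<close> for each free variable \<open>v \<in> V\<close>.\<close>

fun inst_trm :: "'v set \<Rightarrow> ('v \<Rightarrow> 'a) \<Rightarrow> ('f, 'v, 'a) trm \<Rightarrow> ('f, 'v, 'a) trm" where
  "inst_trm V b (Var v) = (if v \<in> V then Par (b v) else Var v)"
| "inst_trm V b (Par a) = Par a"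
| "inst_trm V b (Fun f ts) = Fun f (map (inst_trm V b) ts)"

fun inst :: "'v set \<Rightarrow> ('v \<Rightarrow> 'a) \<Rightarrow> ('f, 'r, 'v, 'a) fml \<Rightarrow> ('f, 'r, 'v, 'a) fml" where
  "inst V b (Eq t u) = Eq (inst_trm V b t) (inst_trm V b u)"
| "inst V b (Rel r ts) = Rel r (map (inst_trm V b) ts)"
| "inst V b (Neg \<phi>) = Neg (inst V b \<phi>)"
| "inst V b (And \<phi> \<psi>) = And (inst V b \<phi>) (inst V b \<psi>)"
| "inst V b (Exists v \<phi>) = Exists v (inst (V - {v}) b \<phi>)"

text \<open>
  \<open>types L S A V\<close> is the space \<open>S\<^sub>V(A)\<close> of complete types over \<open>A \<subseteq> univ S\<close> in the variables \<open>V\<close>,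
  relative to the theory of \<open>S\<close> with its elements named; \<open>tp L S A V s\<close> is the type
  over \<open>A\<close> of the tuple \<open>(s v)\<^sub>v\<close>, \<open>v \<in> V\<close>.
\<close>

definition types :: "('f, 'r) language \<Rightarrow> ('f, 'r, 'a) struct \<Rightarrow> 'a set \<Rightarrow> 'v set
    \<Rightarrow> ('f, 'r, 'v, 'a) fml set set" where
  "types L S A V = {p. p \<subseteq> Fml L A V \<and>
     (\<forall>\<phi> \<in> Fml L A V. \<phi> \<in> p \<or> Neg \<phi> \<in> p) \<and>
     (\<forall>F. finite F \<and> F \<subseteq> p \<longrightarrow> (\<exists>s. range s \<subseteq> univ S \<and> (\<forall>\<phi> \<in> F. sat S s \<phi>)))}"

definition tp :: "('f, 'r) language \<Rightarrow> ('f, 'r, 'a) struct \<Rightarrow> 'a set \<Rightarrow> 'v set \<Rightarrow> ('v \<Rightarrow> 'a)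
    \<Rightarrow> ('f, 'r, 'v, 'a) fml set" where
  "tp L S A V s = {\<phi> \<in> Fml L A V. sat S s \<phi>}"

definition clopen :: "('f, 'r) language \<Rightarrow> ('f, 'r, 'a) struct \<Rightarrow> 'a set \<Rightarrow> 'v set
    \<Rightarrow> ('f, 'r, 'v, 'a) fml \<Rightarrow> ('f, 'r, 'v, 'a) fml set set" where
  "clopen L S A V \<phi> = {p \<in> types L S A V. \<phi> \<in> p}"

definition type_top :: "('f, 'r) language \<Rightarrow> ('f, 'r, 'a) struct \<Rightarrow> 'a set \<Rightarrow> 'v set
    \<Rightarrow> ('f, 'r, 'v, 'a) fml set topology" where
  "type_top L S A V = topology_generated_by (clopen L S A V ` Fml L A V)"

definition type_borel :: "('f, 'r) language \<Rightarrow> ('f, 'r, 'a) struct \<Rightarrow> 'a set \<Rightarrow> 'v set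
    \<Rightarrow> ('f, 'r, 'v, 'a) fml set measure" where
  "type_borel L S A V = sigma (types L S A V) {U. openin (type_top L S A V) U}"

text \<open>
  Theories, elementary substructures, automorphisms and monster models. These use formulas in the
  standard countable supply \<open>nat\<close> of variables. A complete theory is taken to be closed under
  consequence, i.e. it contains exactly one of each sentence and its negation.
\<close>

definition complete_theory ::
    "('f, 'r) language \<Rightarrow> ('f, 'r, nat, 'a) fml set \<Rightarrow> bool" where
  "complete_theory L T \<longleftrightarrow> T \<subseteq> Fml L {} {} \<and> (\<forall>\<sigma> \<in> Fml L {} {}. \<sigma> \<in> T \<longleftrightarrow> Neg \<sigma> \<notin> T)"

definition model_of ::
    "('f, 'r) language \<Rightarrow> ('f, 'r, 'a) struct \<Rightarrow> ('f, 'r, nat, 'a) fml set \<Rightarrow> bool" where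
  "model_of L S T \<longleftrightarrow> structure_on L S \<and> (\<forall>\<sigma> \<in> T. \<forall>s. range s \<subseteq> univ S \<longrightarrow> sat S s \<sigma>)"

definition elem_sub :: "('f, 'r) language \<Rightarrow> ('f, 'r, 'a) struct \<Rightarrow> ('f, 'r, 'a) struct \<Rightarrow> bool" where
  "elem_sub L M S \<longleftrightarrow> structure_on L M \<and> structure_on L S \<and> univ M \<subseteq> univ S \<and>
     (\<forall>(f, n) \<in> funs L. \<forall>as. set as \<subseteq> univ M \<and> length as = n \<longrightarrow> fint M f as = fint S f as) \<and>
     (\<forall>(r, n) \<in> rels L. \<forall>as. set as \<subseteq> univ M \<and> length as = n \<longrightarrow> rint M r as = rint S r as) \<and>
     (\<forall>\<phi> \<in> Fml L {} (UNIV :: nat set). \<forall>s. range s \<subseteq> univ M \<longrightarrow> sat M s \<phi> = sat S s \<phi>)"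

definition aut :: "('f, 'r) language \<Rightarrow> ('f, 'r, 'a) struct \<Rightarrow> ('a \<Rightarrow> 'a) set" where
  "aut L S = {\<sigma>. bij_betw \<sigma> (univ S) (univ S) \<and>
     (\<forall>(f, n) \<in> funs L. \<forall>as. set as \<subseteq> univ S \<and> length as = n
        \<longrightarrow> \<sigma> (fint S f as) = fint S f (map \<sigma> as)) \<and>
     (\<forall>(r, n) \<in> rels L. \<forall>as. set as \<subseteq> univ S \<and> length as = n
        \<longrightarrow> rint S r (map \<sigma> as) = rint S r as)}"

definition saturated ::
    "('f, 'r) language \<Rightarrow> 'k rel \<Rightarrow> ('f, 'r, 'a) struct \<Rightarrow> bool" where
  "saturated L \<kappa> S \<longleftrightarrow> (\<forall>A V p. A \<subseteq> univ S \<and> |A| <o \<kappa> \<and> finite V \<and>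
     p \<in> types L S A (V :: nat set) \<longrightarrow> (\<exists>s. range s \<subseteq> univ S \<and> tp L S A V s = p))"

definition elementary_map ::
    "('f, 'r) language \<Rightarrow> ('f, 'r, 'a) struct \<Rightarrow> 'a set \<Rightarrow> ('a \<Rightarrow> 'a) \<Rightarrow> bool" where
  "elementary_map L S A g \<longleftrightarrow> A \<subseteq> univ S \<and> g ` A \<subseteq> univ S \<and>
     (\<forall>\<phi> \<in> Fml L {} (UNIV :: nat set). \<forall>s. range s \<subseteq> A \<longrightarrow> sat S (g \<circ> s) \<phi> = sat S s \<phi>)"

definition strongly_homogeneous ::
    "('f, 'r) language \<Rightarrow> 'k rel \<Rightarrow> ('f, 'r, 'a) struct \<Rightarrow> bool" where
  "strongly_homogeneous L \<kappa> S \<longleftrightarrow> (\<forall>A g. |A| <o \<kappa> \<and> elementary_map L S A g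
     \<longrightarrow> (\<exists>\<sigma> \<in> aut L S. \<forall>a \<in> A. \<sigma> a = g a))"

text \<open>
  Monster models: \<open>\<kappa>\<close>-saturated and strongly \<open>\<kappa>\<close>-homogeneous for some cardinal \<open>\<kappa> > |L| + \<aleph>\<^sub>0\<close>.
  With respect to such a monster, ``small'' means ``of cardinality \<open>< \<kappa>\<close>''.
\<close>

definition monster ::
    "('f, 'r) language \<Rightarrow> 'k rel \<Rightarrow> ('f, 'r, 'a) struct \<Rightarrow> bool" where
  "monster L \<kappa> S \<longleftrightarrow> structure_on L S \<and> Card_order \<kappa> \<and> natLeq <o \<kappa> \<and>
     |funs L| <o \<kappa> \<and> |rels L| <o \<kappa> \<and> saturated L \<kappa> S \<and> strongly_homogeneous L \<kappa> S"

text \<open>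
  Variables. \<open>Xv\<close> and \<open>Yv\<close> are the tuples \<open>x\<close>, \<open>y\<close> corresponding to \<open>m\<close> (indexed by \<open>'i\<close>); the \<open>Zv n\<close>
  are further variables. A tuple \<open>z\<close> disjoint from \<open>y\<close> is given by a set of variables
  \<open>V \<subseteq> - Ys\<close>; this includes both the finite tuples and \<open>z = x\<close>.
\<close>

datatype 'i var = Xv 'i | Yv 'i | Zv nat

abbreviation Xs :: "'i var set" where "Xs \<equiv> range Xv"
abbreviation Ys :: "'i var set" where "Ys \<equiv> range Yv"

text \<open>
  \<open>asg a\<close> assigns the tuple \<open>a\<close> to \<open>x\<close> and to \<open>y\<close>; it is only ever used together with \<open>Xs\<close> or \<open>Ys\<close>.
\<close>

fun asg :: "('i \<Rightarrow> 'a) \<Rightarrow> 'i var \<Rightarrow> 'a" where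
  "asg a (Xv i) = a i"
| "asg a (Yv i) = a i"
| "asg a (Zv n) = undefined"

text \<open>
  Keisler measures over \<open>A\<close> in the variables \<open>V\<close>, identified as usual with the regular Borel probability
  measures on \<open>S\<^sub>V(A)\<close>; the measure of a formula is that of its clopen set.
\<close>

definition keisler :: "('f, 'r) language \<Rightarrow> ('f, 'r, 'a) struct \<Rightarrow> 'a set \<Rightarrow> 'v set
    \<Rightarrow> ('f, 'r, 'v, 'a) fml set measure \<Rightarrow> bool" where
  "keisler L S A V \<mu> \<longleftrightarrow> sets \<mu> = sets (type_borel L S A V) \<and> prob_space \<mu> \<and>
     (\<forall>B \<in> sets \<mu>.
        emeasure \<mu> B = (INF U \<in> {U. openin (type_top L S A V) U \<and> B \<subseteq> U}. emeasure \<mu> U) \<and>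
        emeasure \<mu> B = (SUP K \<in> {K. compactin (type_top L S A V) K \<and> K \<subseteq> B}. emeasure \<mu> K))"

abbreviation global_keisler :: "('f, 'r) language \<Rightarrow> ('f, 'r, 'a) struct
    \<Rightarrow> ('f, 'r, 'i var, 'a) fml set measure \<Rightarrow> bool" where
  "global_keisler L C \<mu> \<equiv> keisler L C (univ C) Ys \<mu>"

definition mval :: "('f, 'r) language \<Rightarrow> ('f, 'r, 'a) struct
    \<Rightarrow> ('f, 'r, 'i var, 'a) fml set measure \<Rightarrow> ('f, 'r, 'i var, 'a) fml \<Rightarrow> real" where
  "mval L C \<mu> \<psi> = measure \<mu> (clopen L C (univ C) Ys \<psi>)"

definition types_m :: "('f, 'r) language \<Rightarrow> ('f, 'r, 'a) struct \<Rightarrow> ('i \<Rightarrow> 'a)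
    \<Rightarrow> ('f, 'r, 'i var, 'a) fml set set" where
  "types_m L C m = {p \<in> types L C (univ C) Ys. tp L C {} Ys (asg m) \<subseteq> p}"

definition keisler_m :: "('f, 'r) language \<Rightarrow> ('f, 'r, 'a) struct \<Rightarrow> ('i \<Rightarrow> 'a)
    \<Rightarrow> ('f, 'r, 'i var, 'a) fml set measure \<Rightarrow> bool" where
  "keisler_m L C m \<mu> \<longleftrightarrow> global_keisler L C \<mu> \<and> measure \<mu> (types_m L C m) = 1"

definition invariant :: "('f, 'r) language \<Rightarrow> ('f, 'r, 'a) struct \<Rightarrow> 'a set
    \<Rightarrow> ('f, 'r, 'i var, 'a) fml set measure \<Rightarrow> bool" where
  "invariant L C A \<mu> \<longleftrightarrow>
     (\<forall>V \<subseteq> - Ys. \<forall>\<phi> \<in> Fml L {} (Ys \<union> V). \<forall>b b'. range b \<subseteq> univ C \<and> range b' \<subseteq> univ C \<and>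
        tp L C A V b = tp L C A V b' \<longrightarrow> mval L C \<mu> (inst V b \<phi>) = mval L C \<mu> (inst V b' \<phi>))"

text \<open>
  \<open>Fmap L C A V \<mu> \<phi>\<close> is the function \<open>q \<mapsto> \<mu>(\<phi>(y; b))\<close>, \<open>b \<Turnstile> q\<close>, on \<open>S\<^sub>V(A)\<close>. For \<open>A\<close>-invariant \<open>\<mu>\<close> it
  does not depend on the chosen realization \<open>b\<close>.
\<close>

definition Fmap :: "('f, 'r) language \<Rightarrow> ('f, 'r, 'a) struct \<Rightarrow> 'a set \<Rightarrow> 'i var set
    \<Rightarrow> ('f, 'r, 'i var, 'a) fml set measure \<Rightarrow> ('f, 'r, 'i var, 'a) fml
    \<Rightarrow> ('f, 'r, 'i var, 'a) fml set \<Rightarrow> real" where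
  "Fmap L C A V \<mu> \<phi> q =
     mval L C \<mu> (inst V (SOME b. range b \<subseteq> univ C \<and> tp L C A V b = q) \<phi>)"

definition borel_definable :: "('f, 'r) language \<Rightarrow> ('f, 'r, 'a) struct \<Rightarrow> 'a set
    \<Rightarrow> ('f, 'r, 'i var, 'a) fml set measure \<Rightarrow> bool" where
  "borel_definable L C A \<mu> \<longleftrightarrow> invariant L C A \<mu> \<and>
     (\<forall>V \<subseteq> - Ys. \<forall>\<phi> \<in> Fml L {} (Ys \<union> V). Fmap L C A V \<mu> \<phi> \<in> borel_measurable (type_borel L C A V))"

definition definable :: "('f, 'r) language \<Rightarrow> ('f, 'r, 'a) struct \<Rightarrow> 'a set
    \<Rightarrow> ('f, 'r, 'i var, 'a) fml set measure \<Rightarrow> bool" where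
  "definable L C A \<mu> \<longleftrightarrow> invariant L C A \<mu> \<and>
     (\<forall>V \<subseteq> - Ys. \<forall>\<phi> \<in> Fml L {} (Ys \<union> V).
        continuous_map (type_top L C A V) euclideanreal (Fmap L C A V \<mu> \<phi>))"

text \<open>The value \<open>(\<mu>\<^sub>y \<otimes> \<eta>\<^sub>x)(\<phi>(x; y))\<close> of the Morley product, \<open>\<eta>\<close> being a measure on \<open>S\<^sub>x(M)\<close>.\<close>

definition morley :: "('f, 'r) language \<Rightarrow> ('f, 'r, 'a) struct \<Rightarrow> ('f, 'r, 'a) struct
    \<Rightarrow> ('f, 'r, 'i var, 'a) fml set measure \<Rightarrow> ('f, 'r, 'i var, 'a) fml set measure
    \<Rightarrow> ('f, 'r, 'i var, 'a) fml \<Rightarrow> real" where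
  "morley L C M \<mu> \<eta> \<phi> = (\<integral>q. Fmap L C (univ M) Xs \<mu> \<phi> q \<partial>\<eta>)"

text \<open>
  \<open>h\<close> is the map \<open>tp(\<sigma>(m)/C) \<mapsto> tp(\<sigma>\<^sup>-\<^sup>1(b)/M)\<close>, \<open>\<sigma> \<in> Aut(C')\<close>, from \<open>S\<^sub>m(C)\<close> to \<open>S\<^sub>x(M)\<close>. The definite
  description is well defined since \<open>tp(\<sigma>\<^sup>-\<^sup>1(b)/M)\<close> depends only on \<open>tp(\<sigma>(m)/C)\<close>.
\<close>

definition h :: "('f, 'r) language \<Rightarrow> ('f, 'r, 'a) struct \<Rightarrow> ('f, 'r, 'a) struct
    \<Rightarrow> ('f, 'r, 'a) struct \<Rightarrow> ('i \<Rightarrow> 'a) \<Rightarrow> ('i \<Rightarrow> 'a)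
    \<Rightarrow> ('f, 'r, 'i var, 'a) fml set \<Rightarrow> ('f, 'r, 'i var, 'a) fml set" where
  "h L C C' M m b p = (THE q. \<exists>\<sigma> \<in> aut L C'.
     p = tp L C' (univ C) Ys (asg (\<sigma> \<circ> m)) \<and>
     q = tp L C' (univ M) Xs (asg (inv_into (univ C') \<sigma> \<circ> b)))"

definition push_h :: "('f, 'r) language \<Rightarrow> ('f, 'r, 'a) struct \<Rightarrow> ('f, 'r, 'a) struct
    \<Rightarrow> ('f, 'r, 'a) struct \<Rightarrow> ('i \<Rightarrow> 'a) \<Rightarrow> ('i \<Rightarrow> 'a)
    \<Rightarrow> ('f, 'r, 'i var, 'a) fml set measure \<Rightarrow> ('f, 'r, 'i var, 'a) fml set measure" where
  "push_h L C C' M m b \<nu> =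
     distr (restrict_space \<nu> (types_m L C m)) (type_borel L C (univ M) Xs) (h L C C' M m b)"

text \<open>
  The convolution \<open>\<mu> * \<nu>\<close>: the global Keisler measure with
  \<open>(\<mu> * \<nu>)(\<phi>(b; y)) = (\<mu>\<^sub>y \<otimes> ((h\<^sub>b)\<^sub>* \<nu>)\<^sub>x)(\<phi>(x; y))\<close> for all \<open>L\<close>-formulas \<open>\<phi>(x; y)\<close> and all tuples \<open>b\<close>
  in \<open>C\<close>. Every \<open>L(C)\<close>-formula in \<open>y\<close> is of the form \<open>\<phi>(b; y)\<close> up to equivalence, so there is
  at most one such measure.
\<close>

definition conv :: "('f, 'r) language \<Rightarrow> ('f, 'r, 'a) struct \<Rightarrow> ('f, 'r, 'a) struct
    \<Rightarrow> ('f, 'r, 'a) struct \<Rightarrow> ('i \<Rightarrow> 'a) \<Rightarrow> ('f, 'r, 'i var, 'a) fml set measure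
    \<Rightarrow> ('f, 'r, 'i var, 'a) fml set measure \<Rightarrow> ('f, 'r, 'i var, 'a) fml set measure" where
  "conv L C C' M m \<mu> \<nu> = (THE \<rho>. global_keisler L C \<rho> \<and>
     (\<forall>\<phi> \<in> Fml L {} (Xs \<union> Ys). \<forall>b. range b \<subseteq> univ C \<longrightarrow>
        mval L C \<rho> (inst Xs (asg b) \<phi>) = morley L C M \<mu> (push_h L C C' M m b \<nu>) \<phi>))"

end

(*
  A type p = tp(\<sigma>(m)/\<CC>) acts on formulas by conjugating their parameters with the inverse of \<sigma>, and by
  invariance of \<mu> this gives a measure \<psi> \<mapsto> \<mu>(conjugate of \<psi>). The convolution \<mu> * \<nu> is the \<nu>-average of
  these measures. It is a finitely additive function on formulas, so it extends uniquely to a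
  regular Borel measure on the type space.

  For associativity, (h_b)_*(\<nu> * \<eta>) and the (h_b)_*\<eta>-average of the measures (h_c)_*\<nu>, for c realizing
  a type q over M, agree on clopen sets. Since \<mu> is definable, q \<mapsto> \<mu>(\<phi>(c; y)) is continuous, hence a
  uniform limit of linear combinations of indicators of clopen sets, so both sides integrate it to
  the same value. Hence the defining conditions of (\<mu> * \<nu>) * \<eta> and of \<mu> * (\<nu> * \<eta>) coincide.
*)

theory Submission
  imports Defs
begin

section \<open>Formulas\<close>

text \<open>The first obstacle is that conjugating by the inverse of \<sigma> moves parameters of
  \<CC> into \<CC>', where \<mu> has no values. Saturation of \<CC> supplies a tuple in \<CC> with
  the same type over \<open>M\<close>, and this replacement, a \<open>twist\<close>, can be
  described in terms of \<open>p\<close> alone. The larger monster enters through the fact that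
  every type in \<open>S\<^sub>m\<close> is the type of an automorphic image of \<open>m\<close>.
  The second obstacle is that type spaces over large sets are not metrizable: clopen sets need not
  generate the Borel sets. Measures are therefore compared through clopen sets and regularity, and a
  finitely additive function is extended by a Caratheodory construction that starts from open sets.
  For the same reason the family of push-forwards of \<nu>, as a function of the type of
  \<open>c\<close>, is known to be measurable on clopen sets only. Continuous integrands are the
  ones that can be averaged over such a family by uniform approximation.\<close>

abbreviation tmap :: "('a \<Rightarrow> 'b) \<Rightarrow> ('f, 'v, 'a) trm \<Rightarrow> ('f, 'v, 'b) trm" where
  "tmap \<equiv> map_trm (\<lambda>x. x) (\<lambda>x. x)"

abbreviation pmap :: "('a \<Rightarrow> 'b) \<Rightarrow> ('f, 'r, 'v, 'a) fml \<Rightarrow> ('f, 'r, 'v, 'b) fml" where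
  "pmap \<equiv> map_fml (\<lambda>x. x) (\<lambda>x. x) (\<lambda>x. x)"

lemma finite_fv_trm [simp]: "finite (fv_trm t)"
  by (induction t) auto

lemma finite_fv [simp]: "finite (fv \<phi>)"
  by (induction \<phi>) auto

lemma finite_params [simp]: "finite (params \<phi>)"
  by (induction \<phi>) auto

lemma fv_tmap [simp]: "fv_trm (tmap g t) = fv_trm t"
  by (induction t) auto

lemma fv_pmap [simp]: "fv (pmap g \<phi>) = fv \<phi>"
  by (induction \<phi>) auto

lemma wf_tmap [simp]: "wf_trm L (tmap g t) = wf_trm L t"
  by (induction t) auto

lemma wf_pmap [simp]: "wf_fml L (pmap g \<phi>) = wf_fml L \<phi>"
  by (induction \<phi>) auto

lemma pmap_cong: "(\<And>a. a \<in> params \<phi> \<Longrightarrow> g a = g' a) \<Longrightarrow> pmap g \<phi> = pmap g' \<phi>"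
  by (rule fml.map_cong0) auto

lemma pmap_idI: "(\<And>a. a \<in> params \<phi> \<Longrightarrow> g a = a) \<Longrightarrow> pmap g \<phi> = \<phi>"
  using pmap_cong[of \<phi> g "\<lambda>x. x"] by (simp add: fml.map_ident)

lemma eval_cong: "(\<And>v. v \<in> fv_trm t \<Longrightarrow> s v = s' v) \<Longrightarrow> eval S s t = eval S s' t"
proof (induction t)
  case (Fun f ts)
  then have "map (eval S s) ts = map (eval S s') ts" by (intro map_cong) auto
  then show ?case by (simp only: eval.simps)
qed auto

lemma sat_cong: "(\<And>v. v \<in> fv \<phi> \<Longrightarrow> s v = s' v) \<Longrightarrow> sat S s \<phi> = sat S s' \<phi>"
proof (induction \<phi> arbitrary: s s')
  case (Eq t u)
  then show ?case using eval_cong[of t s s' S] eval_cong[of u s s' S] by simp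
next
  case (Rel r ts)
  then have "map (eval S s) ts = map (eval S s') ts" by (intro map_cong eval_cong) auto
  then show ?case by (simp only: sat.simps)
next
  case (And \<phi>1 \<phi>2)
  show ?case using And.IH(1)[of s s'] And.IH(2)[of s s'] And.prems by simp
next
  case (Neg \<phi>)
  show ?case using Neg.IH[of s s'] Neg.prems by simp
next
  case (Exists v \<phi>)
  have "sat S (s(v := a)) \<phi> = sat S (s'(v := a)) \<phi>" for a
    by (rule Exists.IH) (use Exists.prems in auto)
  then show ?case by simp
qed

lemma structure_on_fint:
  assumes "structure_on L S" "(f, n) \<in> funs L" "set as \<subseteq> univ S" "length as = n"
  shows "fint S f as \<in> univ S"
  using assms unfolding structure_on_def by (metis (mono_tags, lifting) case_prodD)

lemma aut_fint:
  assumes "\<sigma> \<in> aut L S" "(f, n) \<in> funs L" "set as \<subseteq> univ S" "length as = n"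
  shows "\<sigma> (fint S f as) = fint S f (map \<sigma> as)"
proof -
  have "\<forall>(f, n)\<in>funs L. \<forall>as. set as \<subseteq> univ S \<and> length as = n \<longrightarrow> \<sigma> (fint S f as) = fint S f (map \<sigma> as)"
    using assms(1) by (simp add: aut_def)
  then show ?thesis using assms by blast
qed

lemma aut_rint:
  assumes "\<sigma> \<in> aut L S" "(r, n) \<in> rels L" "set as \<subseteq> univ S" "length as = n"
  shows "rint S r (map \<sigma> as) = rint S r as"
proof -
  have "\<forall>(r, n)\<in>rels L. \<forall>as. set as \<subseteq> univ S \<and> length as = n \<longrightarrow> rint S r (map \<sigma> as) = rint S r as"
    using assms(1) by (simp add: aut_def)
  then show ?thesis using assms by blast
qed

lemma eval_in_univ:
  assumes "structure_on L S"
  shows "wf_trm L t \<Longrightarrow> trm_params t \<subseteq> univ S \<Longrightarrow> s ` fv_trm t \<subseteq> univ S \<Longrightarrow> eval S s t \<in> univ S"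
proof (induction t)
  case (Fun f ts)
  have subs: "trm_params t \<subseteq> univ S" "s ` fv_trm t \<subseteq> univ S" if "t \<in> set ts" for t
    using that Fun.prems(2,3) by (simp_all add: image_UN) blast+
  have "eval S s t \<in> univ S" if "t \<in> set ts" for t
    using that Fun.prems subs[OF that] by (intro Fun.IH) auto
  then have "set (map (eval S s) ts) \<subseteq> univ S" by auto
  then show ?case using structure_on_fint[OF assms, of f "length ts" "map (eval S s) ts"] Fun.prems(1)
    by simp
qed auto

text \<open>Satisfaction depends only on the free variables, while \<open>types\<close> and
  \<open>satisfiable\<close> ask for assignments with all values in the structure. The values
  outside it are replaced by an arbitrary element.\<close>

definition patch :: "('f, 'r, 'a) struct \<Rightarrow> ('v \<Rightarrow> 'a) \<Rightarrow> 'v \<Rightarrow> 'a" where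
  "patch S s v = (if s v \<in> univ S then s v else (SOME x. x \<in> univ S))"

lemma range_patch: "univ S \<noteq> {} \<Longrightarrow> range (patch S s) \<subseteq> univ S"
  using some_in_eq[of "univ S"] by (auto simp: patch_def)

lemma patch_eq [simp]: "s v \<in> univ S \<Longrightarrow> patch S s v = s v"
  by (simp add: patch_def)

lemma sat_patch: "s ` fv \<phi> \<subseteq> univ S \<Longrightarrow> sat S (patch S s) \<phi> = sat S s \<phi>"
  by (rule sat_cong) auto

section \<open>Capture-avoiding substitution of terms for variables and for parameters\<close>

text \<open>Every bound variable is renamed to a fresh one, so the properties of substitution below require
  the target type of variables to be infinite.\<close>

fun subst_trm :: "('v \<Rightarrow> ('f, 'w, 'b) trm) \<Rightarrow> ('a \<Rightarrow> ('f, 'w, 'b) trm) \<Rightarrow> ('f, 'v, 'a) trm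
    \<Rightarrow> ('f, 'w, 'b) trm" where
  "subst_trm e c (Var v) = e v"
| "subst_trm e c (Par a) = c a"
| "subst_trm e c (Fun f ts) = Fun f (map (subst_trm e c) ts)"

definition fresh_var :: "('v \<Rightarrow> ('f, 'w, 'b) trm) \<Rightarrow> ('a \<Rightarrow> ('f, 'w, 'b) trm) \<Rightarrow> 'v
    \<Rightarrow> ('f, 'r, 'v, 'a) fml \<Rightarrow> 'w" where
  "fresh_var e c v \<phi> =
     (SOME w. w \<notin> (\<Union>u\<in>fv \<phi> - {v}. fv_trm (e u)) \<union> (\<Union>a\<in>params \<phi>. fv_trm (c a)))"

fun subst_fml :: "('v \<Rightarrow> ('f, 'w, 'b) trm) \<Rightarrow> ('a \<Rightarrow> ('f, 'w, 'b) trm) \<Rightarrow> ('f, 'r, 'v, 'a) fml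
    \<Rightarrow> ('f, 'r, 'w, 'b) fml" where
  "subst_fml e c (Eq t u) = Eq (subst_trm e c t) (subst_trm e c u)"
| "subst_fml e c (Rel r ts) = Rel r (map (subst_trm e c) ts)"
| "subst_fml e c (Neg \<phi>) = Neg (subst_fml e c \<phi>)"
| "subst_fml e c (And \<phi> \<psi>) = And (subst_fml e c \<phi>) (subst_fml e c \<psi>)"
| "subst_fml e c (Exists v \<phi>) =
     Exists (fresh_var e c v \<phi>) (subst_fml (e(v := Var (fresh_var e c v \<phi>))) c \<phi>)"

lemma fresh_var:
  fixes e :: "'v \<Rightarrow> ('f, 'w, 'b) trm"
  assumes "infinite (UNIV :: 'w set)"
  shows "u \<in> fv \<phi> \<Longrightarrow> u \<noteq> v \<Longrightarrow> fresh_var e c v \<phi> \<notin> fv_trm (e u)"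
    and "a \<in> params \<phi> \<Longrightarrow> fresh_var e c v \<phi> \<notin> fv_trm (c a)"
proof -
  have "finite ((\<Union>u\<in>fv \<phi> - {v}. fv_trm (e u)) \<union> (\<Union>a\<in>params \<phi>. fv_trm (c a)))" by simp
  then have "\<exists>w. w \<notin> (\<Union>u\<in>fv \<phi> - {v}. fv_trm (e u)) \<union> (\<Union>a\<in>params \<phi>. fv_trm (c a))"
    using assms ex_new_if_finite by blast
  then have "fresh_var e c v \<phi> \<notin> (\<Union>u\<in>fv \<phi> - {v}. fv_trm (e u)) \<union> (\<Union>a\<in>params \<phi>. fv_trm (c a))"
    unfolding fresh_var_def by (rule someI_ex)
  then show "u \<in> fv \<phi> \<Longrightarrow> u \<noteq> v \<Longrightarrow> fresh_var e c v \<phi> \<notin> fv_trm (e u)"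
    and "a \<in> params \<phi> \<Longrightarrow> fresh_var e c v \<phi> \<notin> fv_trm (c a)" by auto
qed

lemma eval_subst_pmap:
  "eval S s (tmap g (subst_trm e c t)) =
     eval S (\<lambda>v. eval S s (tmap g (e v))) (tmap (\<lambda>a. eval S s (tmap g (c a))) t)"
proof (induction t)
  case (Fun f ts)
  then show ?case by (simp cong: map_cong)
qed auto

text \<open>The substitution lemma in a form that lets a map \<open>g\<close> act afterwards on the
  parameters introduced by the substitution. Later \<open>g\<close> is an automorphism or a
  twist.\<close>

lemma sat_subst_pmap:
  fixes e :: "'v \<Rightarrow> ('f, 'w, 'b) trm"
  assumes "infinite (UNIV :: 'w set)"
  shows "sat S s (pmap g (subst_fml e c \<phi>)) =
     sat S (\<lambda>v. eval S s (tmap g (e v))) (pmap (\<lambda>a. eval S s (tmap g (c a))) \<phi>)"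
proof (induction \<phi> arbitrary: e s)
  case (Rel r ts)
  then show ?case by (simp add: eval_subst_pmap cong: map_cong)
next
  case (Exists v \<phi>)
  define w where "w = fresh_var e c v \<phi>"
  note w = fresh_var(1)[OF assms, of _ \<phi> v e c, folded w_def]
    fresh_var(2)[OF assms, of _ \<phi> e c v, folded w_def]
  have ev: "eval S (s(w := a)) (tmap g t) = eval S s (tmap g t)" if "w \<notin> fv_trm t" for a t
    by (rule eval_cong) (use that in auto)
  \<comment> \<open>A new value for \<open>w\<close> is invisible to the terms put in for the other
    free variables and for the parameters, as \<open>w\<close> is fresh for all of them. So
    \<open>w\<close> can take over the role of the bound variable \<open>v\<close>.\<close>
  have "sat S (s(w := a)) (pmap g (subst_fml (e(v := Var w)) c \<phi>)) =
      sat S ((\<lambda>v. eval S s (tmap g (e v)))(v := a)) (pmap (\<lambda>a. eval S s (tmap g (c a))) \<phi>)" for a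
  proof -
    have "pmap (\<lambda>x. eval S (s(w := a)) (tmap g (c x))) \<phi> = pmap (\<lambda>a. eval S s (tmap g (c a))) \<phi>"
      by (rule pmap_cong) (use w ev in blast)
    moreover have "sat S (\<lambda>u. eval S (s(w := a)) (tmap g ((e(v := Var w)) u))) \<psi> =
        sat S ((\<lambda>v. eval S s (tmap g (e v)))(v := a)) \<psi>" if "fv \<psi> = fv \<phi>" for \<psi>
    proof (rule sat_cong)
      fix u assume "u \<in> fv \<psi>"
      then show "eval S (s(w := a)) (tmap g ((e(v := Var w)) u)) = ((\<lambda>v. eval S s (tmap g (e v)))(v := a)) u"
        using that w(1)[of u] ev[of "e u"] by (cases "u = v") simp_all
    qed
    ultimately show ?thesis by (simp only: Exists.IH fv_pmap)
  qed
  then show ?case by (simp add: w_def)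
qed (auto simp: eval_subst_pmap)

lemma sat_subst:
  fixes e :: "'v \<Rightarrow> ('f, 'w, 'b) trm"
  assumes "infinite (UNIV :: 'w set)"
  shows "sat S s (subst_fml e c \<phi>) = sat S (\<lambda>v. eval S s (e v)) (pmap (\<lambda>a. eval S s (c a)) \<phi>)"
  using sat_subst_pmap[OF assms, of S s "\<lambda>x. x" e c \<phi>] by (simp add: fml.map_ident trm.map_ident)

lemma wf_subst_trm:
  "wf_trm L t \<Longrightarrow> (\<And>v. wf_trm L (e v)) \<Longrightarrow> (\<And>a. a \<in> trm_params t \<Longrightarrow> wf_trm L (c a)) \<Longrightarrow>
     wf_trm L (subst_trm e c t)"
  by (induction t) auto

lemma wf_subst_fml:
  "wf_fml L \<phi> \<Longrightarrow> (\<And>v. wf_trm L (e v)) \<Longrightarrow> (\<And>a. a \<in> params \<phi> \<Longrightarrow> wf_trm L (c a)) \<Longrightarrow>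
     wf_fml L (subst_fml e c \<phi>)"
proof (induction \<phi> arbitrary: e)
  case (Rel r ts)
  then have "wf_trm L (subst_trm e c t)" if "t \<in> set ts" for t
    using that by (intro wf_subst_trm) auto
  then show ?case using Rel by auto
qed (auto intro: wf_subst_trm)

lemma fv_subst_trm:
  "fv_trm (subst_trm e c t) = (\<Union>v\<in>fv_trm t. fv_trm (e v)) \<union> (\<Union>a\<in>trm_params t. fv_trm (c a))"
  by (induction t) auto

lemma fv_subst_fml:
  "fv (subst_fml e c \<phi>) \<subseteq> (\<Union>v\<in>fv \<phi>. fv_trm (e v)) \<union> (\<Union>a\<in>params \<phi>. fv_trm (c a))"
proof (induction \<phi> arbitrary: e)
  case (And \<phi> \<psi>)
  show ?case using And[of e] by auto
next
  case (Exists v \<phi>)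
  define w where "w = fresh_var e c v \<phi>"
  have "fv (subst_fml (e(v := Var w)) c \<phi>)
      \<subseteq> (\<Union>u\<in>fv \<phi>. fv_trm ((e(v := Var w)) u)) \<union> (\<Union>a\<in>params \<phi>. fv_trm (c a))"
    by (rule Exists)
  also have "(\<Union>u\<in>fv \<phi>. fv_trm ((e(v := Var w)) u)) \<subseteq> (\<Union>u\<in>fv \<phi> - {v}. fv_trm (e u)) \<union> {w}"
    by (auto split: if_splits)
  finally show ?case by (auto simp: w_def)
qed (auto simp: fv_subst_trm)

lemma params_subst_trm:
  "trm_params (subst_trm e c t) \<subseteq> (\<Union>v\<in>fv_trm t. trm_params (e v)) \<union> (\<Union>a\<in>trm_params t. trm_params (c a))"
proof (induction t)
  case (Fun f ts)
  then have "(\<Union>t\<in>set ts. trm_params (subst_trm e c t)) \<subseteq>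
      (\<Union>t\<in>set ts. (\<Union>v\<in>fv_trm t. trm_params (e v)) \<union> (\<Union>a\<in>trm_params t. trm_params (c a)))"
    by (intro UN_mono) auto
  then show ?case by (simp add: UN_Un_distrib)
qed auto

lemma params_subst_fml:
  "params (subst_fml e c \<phi>) \<subseteq> (\<Union>v\<in>fv \<phi>. trm_params (e v)) \<union> (\<Union>a\<in>params \<phi>. trm_params (c a))"
proof (induction \<phi> arbitrary: e)
  case (Eq t u)
  show ?case using params_subst_trm[of e c t] params_subst_trm[of e c u] by auto
next
  case (Rel r ts)
  have "(\<Union>t\<in>set ts. trm_params (subst_trm e c t)) \<subseteq>
      (\<Union>t\<in>set ts. (\<Union>v\<in>fv_trm t. trm_params (e v)) \<union> (\<Union>a\<in>trm_params t. trm_params (c a)))"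
    by (intro UN_mono params_subst_trm) auto
  then show ?case by (simp add: UN_Un_distrib)
next
  case (And \<phi> \<psi>)
  show ?case using And[of e] by auto
next
  case (Exists v \<phi>)
  define w where "w = fresh_var e c v \<phi>"
  have "params (subst_fml (e(v := Var w)) c \<phi>)
      \<subseteq> (\<Union>u\<in>fv \<phi>. trm_params ((e(v := Var w)) u)) \<union> (\<Union>a\<in>params \<phi>. trm_params (c a))"
    by (rule Exists)
  also have "(\<Union>u\<in>fv \<phi>. trm_params ((e(v := Var w)) u)) \<subseteq> (\<Union>u\<in>fv \<phi> - {v}. trm_params (e u))"
    by (auto split: if_splits)
  finally show ?case by (auto simp: w_def)
qed auto

lemma subst_fml_in_Fml:
  assumes "\<phi> \<in> Fml L A V"
    and "\<And>v. wf_trm L (e v)" and "\<And>v. v \<in> V \<Longrightarrow> fv_trm (e v) \<subseteq> W \<and> trm_params (e v) \<subseteq> B"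
    and "\<And>a. a \<in> A \<Longrightarrow> wf_trm L (c a) \<and> fv_trm (c a) \<subseteq> W \<and> trm_params (c a) \<subseteq> B"
  shows "subst_fml e c \<phi> \<in> Fml L B W"
proof -
  have "wf_fml L (subst_fml e c \<phi>)" using assms by (intro wf_subst_fml) (auto simp: Fml_def)
  moreover have "fv (subst_fml e c \<phi>) \<subseteq> W" using assms fv_subst_fml[of e c \<phi>] unfolding Fml_def by blast
  moreover have "params (subst_fml e c \<phi>) \<subseteq> B"
    using assms params_subst_fml[of e c \<phi>] unfolding Fml_def by blast
  ultimately show ?thesis by (simp add: Fml_def)
qed

section \<open>Instantiation of free variables by parameters\<close>

lemma eval_inst: "eval S s (inst_trm V b t) = eval S (\<lambda>v. if v \<in> V then b v else s v) t"
  by (induction t) (auto cong: map_cong)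

lemma sat_inst: "sat S s (inst V b \<phi>) = sat S (\<lambda>v. if v \<in> V then b v else s v) \<phi>"
proof (induction \<phi> arbitrary: s V)
  case (Exists v \<phi>)
  have "(\<lambda>u. if u \<in> V - {v} then b u else (s(v := a)) u) = (\<lambda>u. if u \<in> V then b u else s u)(v := a)" for a
    by auto
  then show ?case by (simp add: Exists)
qed (auto simp: eval_inst o_def cong: map_cong)

lemma fv_inst_trm: "fv_trm (inst_trm V b t) = fv_trm t - V"
  by (induction t) auto

lemma fv_inst: "fv (inst V b \<phi>) = fv \<phi> - V"
  by (induction \<phi> arbitrary: V) (auto simp: fv_inst_trm)

lemma wf_inst_trm: "wf_trm L (inst_trm V b t) = wf_trm L t"
  by (induction t) auto

lemma wf_inst: "wf_fml L (inst V b \<phi>) = wf_fml L \<phi>"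
  by (induction \<phi> arbitrary: V) (auto simp: wf_inst_trm)

lemma params_inst_trm: "trm_params (inst_trm V b t) = trm_params t \<union> b ` (fv_trm t \<inter> V)"
  by (induction t) auto

lemma params_inst: "params (inst V b \<phi>) = params \<phi> \<union> b ` (fv \<phi> \<inter> V)"
  by (induction \<phi> arbitrary: V) (auto simp: params_inst_trm)

lemma tmap_inst: "tmap g (inst_trm V b t) = inst_trm V (g \<circ> b) (tmap g t)"
  by (induction t) auto

lemma pmap_inst: "pmap g (inst V b \<phi>) = inst V (g \<circ> b) (pmap g \<phi>)"
  by (induction \<phi> arbitrary: V) (auto simp: tmap_inst)

lemma inst_trm_cong: "(\<And>v. v \<in> V \<Longrightarrow> b v = b' v) \<Longrightarrow> inst_trm V b t = inst_trm V b' t"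
  by (induction t) auto

lemma inst_cong: "(\<And>v. v \<in> V \<Longrightarrow> b v = b' v) \<Longrightarrow> inst V b \<phi> = inst V b' \<phi>"
proof (induction \<phi> arbitrary: V)
  case (Exists v \<phi>)
  then show ?case by (metis DiffD1 inst.simps(5))
qed (auto intro: inst_trm_cong)

lemma inst_in_Fml:
  assumes "\<phi> \<in> Fml L A (V \<union> W)" "b ` V \<subseteq> B" "A \<subseteq> B"
  shows "inst V b \<phi> \<in> Fml L B W"
  using assms by (auto simp: Fml_def wf_inst params_inst fv_inst)

lemma Fml_mono: "\<phi> \<in> Fml L A V \<Longrightarrow> A \<subseteq> B \<Longrightarrow> V \<subseteq> W \<Longrightarrow> \<phi> \<in> Fml L B W"
  by (auto simp: Fml_def)

lemma Neg_in_Fml [simp]: "Neg \<phi> \<in> Fml L A V \<longleftrightarrow> \<phi> \<in> Fml L A V"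
  by (simp add: Fml_def)

lemma And_in_Fml [simp]: "And \<phi> \<psi> \<in> Fml L A V \<longleftrightarrow> \<phi> \<in> Fml L A V \<and> \<psi> \<in> Fml L A V"
  by (auto simp: Fml_def)

lemma pmap_in_Fml: "\<phi> \<in> Fml L A V \<Longrightarrow> g ` A \<subseteq> B \<Longrightarrow> pmap g \<phi> \<in> Fml L B V"
  by (auto simp: Fml_def fml.set_map)

section \<open>Existential closures and finite conjunctions\<close>

definition exs :: "'v list \<Rightarrow> ('f, 'r, 'v, 'a) fml \<Rightarrow> ('f, 'r, 'v, 'a) fml" where
  "exs vs \<phi> = foldr Exists vs \<phi>"

lemma sat_exs:
  "sat S s (exs vs \<phi>) \<longleftrightarrow> (\<exists>s'. (\<forall>v. v \<notin> set vs \<longrightarrow> s' v = s v) \<and> s' ` set vs \<subseteq> univ S \<and> sat S s' \<phi>)"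
proof (induction vs arbitrary: s)
  case Nil
  have "(\<exists>s'. (\<forall>v. s' v = s v) \<and> sat S s' \<phi>) \<longleftrightarrow> sat S s \<phi>"
    by (metis ext)
  then show ?case by (simp add: exs_def)
next
  case (Cons x vs)
  have "sat S s (exs (x # vs) \<phi>) \<longleftrightarrow> (\<exists>a\<in>univ S. sat S (s(x := a)) (exs vs \<phi>))"
    by (simp add: exs_def)
  also have "\<dots> \<longleftrightarrow> (\<exists>s'. (\<forall>v. v \<notin> set (x # vs) \<longrightarrow> s' v = s v) \<and> s' ` set (x # vs) \<subseteq> univ S \<and> sat S s' \<phi>)"
    (is "?l \<longleftrightarrow> ?r")
  proof
    assume ?l
    then obtain a s' where "a \<in> univ S" "\<forall>v. v \<notin> set vs \<longrightarrow> s' v = (s(x := a)) v"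
      "s' ` set vs \<subseteq> univ S" "sat S s' \<phi>" unfolding Cons by blast
    then show ?r by (intro exI[of _ s']) (auto split: if_splits)
  next
    assume ?r
    then obtain s' where s': "\<forall>v. v \<notin> set (x # vs) \<longrightarrow> s' v = s v" "s' ` set (x # vs) \<subseteq> univ S" "sat S s' \<phi>"
      by blast
    then have "\<exists>s''. (\<forall>v. v \<notin> set vs \<longrightarrow> s'' v = (s(x := s' x)) v) \<and> s'' ` set vs \<subseteq> univ S \<and> sat S s'' \<phi>"
      by (intro exI[of _ s']) auto
    then show ?l unfolding Cons using s'(2) by (intro bexI[of _ "s' x"]) auto
  qed
  finally show ?case .
qed

lemma fv_exs [simp]: "fv (exs vs \<phi>) = fv \<phi> - set vs"
  by (induction vs) (auto simp: exs_def)

lemma wf_exs [simp]: "wf_fml L (exs vs \<phi>) = wf_fml L \<phi>"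
  by (induction vs) (auto simp: exs_def)

lemma params_exs [simp]: "params (exs vs \<phi>) = params \<phi>"
  by (induction vs) (auto simp: exs_def)

lemma pmap_exs [simp]: "pmap g (exs vs \<phi>) = exs vs (pmap g \<phi>)"
  by (induction vs) (auto simp: exs_def)

definition satisfiable :: "('f, 'r, 'a) struct \<Rightarrow> ('f, 'r, 'v, 'a) fml \<Rightarrow> bool" where
  "satisfiable S \<phi> \<longleftrightarrow> (\<exists>s. range s \<subseteq> univ S \<and> sat S s \<phi>)"

text \<open>Satisfiability becomes the truth of a sentence, which can be transferred between
  elementary structures and tested for membership in a type. The order of the quantifiers is an
  arbitrary choice.\<close>

definition ex_closure :: "('f, 'r, 'v, 'a) fml \<Rightarrow> ('f, 'r, 'v, 'a) fml" where
  "ex_closure \<phi> = exs (SOME vs. set vs = fv \<phi>) \<phi>"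

lemma set_some_fv: "set (SOME vs. set vs = fv \<phi>) = fv \<phi>"
  by (rule someI_ex) (rule finite_list, simp)

lemma fv_ex_closure [simp]: "fv (ex_closure \<phi>) = {}"
  by (simp add: ex_closure_def set_some_fv)

lemma ex_closure_in_Fml: "\<phi> \<in> Fml L A V \<Longrightarrow> ex_closure \<phi> \<in> Fml L A W"
  by (simp add: Fml_def) (simp add: ex_closure_def)

lemma pmap_ex_closure: "pmap g (ex_closure \<phi>) = ex_closure (pmap g \<phi>)"
  by (simp add: ex_closure_def)

lemma sat_ex_closure:
  assumes "univ S \<noteq> {}"
  shows "sat S s (ex_closure \<phi>) \<longleftrightarrow> satisfiable S \<phi>"
proof
  assume "sat S s (ex_closure \<phi>)"
  then obtain s' where "s' ` fv \<phi> \<subseteq> univ S" "sat S s' \<phi>"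
    unfolding ex_closure_def sat_exs set_some_fv by blast
  then show "satisfiable S \<phi>"
    using sat_patch[of s' \<phi> S] range_patch[OF assms, of s'] unfolding satisfiable_def by blast
next
  assume "satisfiable S \<phi>"
  then obtain s' where s': "range s' \<subseteq> univ S" "sat S s' \<phi>" unfolding satisfiable_def by blast
  have "sat S (\<lambda>v. if v \<in> fv \<phi> then s' v else s v) \<phi>"
    using s'(2) by (subst sat_cong[of \<phi> _ s']) auto
  then show "sat S s (ex_closure \<phi>)"
    unfolding ex_closure_def sat_exs set_some_fv
    by (intro exI[of _ "\<lambda>v. if v \<in> fv \<phi> then s' v else s v"]) (use s' in auto)
qed

text \<open>Binding the variable puts the formula in every \<open>Fml L A V\<close>, also for empty
  \<open>V\<close>. It names the whole type space.\<close>

definition truth :: "('f, 'r, 'v, 'a) fml" where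
  "truth = Exists undefined (Eq (Var undefined) (Var undefined))"

lemma truth_in_Fml [simp]: "truth \<in> Fml L A V"
  by (auto simp: truth_def Fml_def)

lemma sat_truth: "univ S \<noteq> {} \<Longrightarrow> sat S s truth"
  by (auto simp: truth_def)

lemma finite_conjunction:
  assumes "finite F" "F \<subseteq> Fml L A V"
  shows "\<exists>\<phi>\<in>Fml L A V. \<forall>S s. univ S \<noteq> {} \<longrightarrow> sat S s \<phi> = (\<forall>\<psi>\<in>F. sat S s \<psi>)"
  using assms
proof (induction F)
  case empty
  show ?case by (rule bexI[of _ truth]) (auto simp: sat_truth)
next
  case (insert \<psi> F)
  then obtain \<phi> where "\<phi> \<in> Fml L A V" "\<forall>S s. univ S \<noteq> {} \<longrightarrow> sat S s \<phi> = (\<forall>\<psi>\<in>F. sat S s \<psi>)" by auto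
  then show ?case using insert.prems by (intro bexI[of _ "And \<psi> \<phi>"]) auto
qed

section \<open>Formulas under automorphisms and in elementary extensions\<close>

lemma eval_aut:
  assumes "\<sigma> \<in> aut L S" "structure_on L S"
  shows "wf_trm L t \<Longrightarrow> trm_params t \<subseteq> univ S \<Longrightarrow> s ` fv_trm t \<subseteq> univ S \<Longrightarrow>
    eval S (\<sigma> \<circ> s) (tmap \<sigma> t) = \<sigma> (eval S s t)"
proof (induction t)
  case (Fun f ts)
  have subs: "trm_params t \<subseteq> univ S" "s ` fv_trm t \<subseteq> univ S" if "t \<in> set ts" for t
    using that Fun.prems(2,3) by (simp_all add: image_UN) blast+
  have IH: "eval S (\<sigma> \<circ> s) (tmap \<sigma> t) = \<sigma> (eval S s t)" if "t \<in> set ts" for t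
    using that Fun.prems subs[OF that] by (intro Fun.IH) auto
  have "eval S s t \<in> univ S" if "t \<in> set ts" for t
    using that Fun.prems subs[OF that] by (intro eval_in_univ[OF assms(2)]) auto
  then have "\<sigma> (fint S f (map (eval S s) ts)) = fint S f (map \<sigma> (map (eval S s) ts))"
    using Fun.prems(1) by (intro aut_fint[OF assms(1)]) auto
  then show ?case using IH by (simp add: o_def cong: map_cong)
qed auto

lemma sat_aut:
  assumes "\<sigma> \<in> aut L S" "structure_on L S"
  shows "wf_fml L \<phi> \<Longrightarrow> params \<phi> \<subseteq> univ S \<Longrightarrow> s ` fv \<phi> \<subseteq> univ S \<Longrightarrow>
    sat S (\<sigma> \<circ> s) (pmap \<sigma> \<phi>) = sat S s \<phi>"
proof (induction \<phi> arbitrary: s)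
  case (Eq t u)
  have "inj_on \<sigma> (univ S)" using assms(1) by (auto simp: aut_def bij_betw_def)
  moreover have "eval S s t \<in> univ S" "eval S s u \<in> univ S"
    using Eq by (auto intro!: eval_in_univ[OF assms(2)])
  moreover have "eval S (\<sigma> \<circ> s) (tmap \<sigma> t) = \<sigma> (eval S s t)" "eval S (\<sigma> \<circ> s) (tmap \<sigma> u) = \<sigma> (eval S s u)"
    using Eq by (auto intro!: eval_aut[OF assms] simp del: o_apply)
  ultimately show ?case by (simp only: fml.map sat.simps inj_on_eq_iff)
next
  case (Rel r ts)
  have subs: "trm_params t \<subseteq> univ S" "s ` fv_trm t \<subseteq> univ S" if "t \<in> set ts" for t
    using that Rel.prems(2,3) by (simp_all add: image_UN) blast+
  have "eval S (\<sigma> \<circ> s) (tmap \<sigma> t) = \<sigma> (eval S s t)" "eval S s t \<in> univ S" if "t \<in> set ts" for t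
    using that Rel subs[OF that] by (auto intro!: eval_aut[OF assms] eval_in_univ[OF assms(2)] simp del: o_apply)
  moreover from this have "rint S r (map \<sigma> (map (eval S s) ts)) = rint S r (map (eval S s) ts)"
    using Rel.prems(1) by (intro aut_rint[OF assms(1)]) auto
  ultimately show ?case by (simp add: o_def cong: map_cong)
next
  case (And \<phi>1 \<phi>2)
  then show ?case by (simp add: image_Un)
next
  case (Exists v \<phi>)
  have "sat S (\<sigma> \<circ> s(v := a)) (pmap \<sigma> \<phi>) = sat S (s(v := a)) \<phi>" if "a \<in> univ S" for a
    using that Exists.prems by (intro Exists.IH) auto
  moreover have "\<sigma> \<circ> s(v := a) = (\<sigma> \<circ> s)(v := \<sigma> a)" for a by auto
  ultimately have *: "sat S ((\<sigma> \<circ> s)(v := \<sigma> a)) (pmap \<sigma> \<phi>) = sat S (s(v := a)) \<phi>" if "a \<in> univ S" for a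
    using that by metis
  have "univ S = \<sigma> ` univ S" using assms(1) by (auto simp: aut_def bij_betw_def)
  then have "(\<exists>a\<in>univ S. P a) = (\<exists>a\<in>univ S. P (\<sigma> a))" for P by (metis image_iff)
  from this[of "\<lambda>b. sat S ((\<sigma> \<circ> s)(v := b)) (pmap \<sigma> \<phi>)"] show ?case using * by (simp add: o_def)
qed auto

text \<open>\<open>elem_sub\<close> speaks of parameter-free formulas in the variables
  \<open>nat\<close>. The finitely many free variables and parameters of \<phi> are coded by
  distinct numbers, and the parameters become variables that are assigned their own values.\<close>

lemma elem_sub_sat:
  fixes \<phi> :: "('f, 'r, 'v, 'a) fml"
  assumes "elem_sub L M S" "\<phi> \<in> Fml L (univ M) V" "s ` fv \<phi> \<subseteq> univ M"
  shows "sat M s \<phi> = sat S s \<phi>"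
proof -
  define F where "F = Inl ` fv \<phi> \<union> Inr ` params \<phi>"
  have "finite F" by (simp add: F_def)
  then obtain k :: "'v + 'a \<Rightarrow> nat" where k: "inj_on k F" using finite_imp_inj_to_nat_seg by blast
  define \<theta> :: "('f, 'r, nat, 'a) fml" where "\<theta> = subst_fml (\<lambda>v. Var (k (Inl v))) (\<lambda>a. Var (k (Inr a))) \<phi>"
  have "\<theta> \<in> Fml L {} UNIV" unfolding \<theta>_def
    by (rule subst_fml_in_Fml[OF assms(2)]) auto
  moreover have "univ M \<noteq> {}" using assms(1) by (auto simp: elem_sub_def structure_on_def)
  then obtain d where d: "d \<in> univ M" by blast
  \<comment> \<open>Decodes numbers. Off the codes the default \<open>d\<close> keeps the range of
    \<open>t\<close> inside \<open>M\<close>, as \<open>elem_sub\<close> demands.\<close>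
  define t where "t n = (if n \<in> k ` F then case inv_into F k n of Inl v \<Rightarrow> s v | Inr a \<Rightarrow> a else d)" for n
  have t: "t (k (Inl v)) = s v" if "v \<in> fv \<phi>" for v
    using that k by (auto simp: t_def F_def)
  have t': "t (k (Inr a)) = a" if "a \<in> params \<phi>" for a
    using that k by (auto simp: t_def F_def)
  have "range t \<subseteq> univ M"
  proof -
    have "(case x of Inl v \<Rightarrow> s v | Inr a \<Rightarrow> a) \<in> univ M" if "x \<in> F" for x
      using that assms(2,3) by (auto simp: F_def Fml_def)
    then show ?thesis using d k by (auto simp: t_def)
  qed
  ultimately have "sat M t \<theta> = sat S t \<theta>" using assms(1) unfolding elem_sub_def by blast
  moreover have "sat X t \<theta> = sat X s \<phi>" for X :: "('f, 'r, 'a) struct"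
  proof -
    have "sat X t \<theta> = sat X (\<lambda>v. t (k (Inl v))) (pmap (\<lambda>a. t (k (Inr a))) \<phi>)"
      by (simp add: \<theta>_def sat_subst)
    also have "pmap (\<lambda>a. t (k (Inr a))) \<phi> = \<phi>" by (rule pmap_idI) (rule t')
    also have "sat X (\<lambda>v. t (k (Inl v))) \<phi> = sat X s \<phi>" by (rule sat_cong) (rule t)
    finally show ?thesis .
  qed
  ultimately show ?thesis by simp
qed

lemma elem_sub_satisfiable:
  assumes "elem_sub L M S" "\<phi> \<in> Fml L (univ M) V" "satisfiable S \<phi>"
  shows "satisfiable M \<phi>"
proof -
  have ne: "univ M \<noteq> {}" "univ S \<noteq> {}" using assms(1) by (auto simp: elem_sub_def structure_on_def)
  have "sat M undefined (ex_closure \<phi>) = sat S undefined (ex_closure \<phi>)"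
    by (rule elem_sub_sat[OF assms(1) ex_closure_in_Fml[OF assms(2)]]) simp
  then show ?thesis using assms(3) by (simp add: sat_ex_closure ne)
qed

text \<open>For finite \<open>M\<close> one formula says that a variable differs from every element
  of \<open>M\<close>. It has no solution in \<open>M\<close>, hence none in \<open>S\<close>. This
  settles the case of a finite index type in \<open>finite_cover\<close>.\<close>

lemma elem_sub_finite:
  fixes M S :: "('b, 'c, 'a) struct"
  assumes "elem_sub L M S" "finite (univ M)"
  shows "univ S = univ M"
proof -
  have sub: "univ M \<subseteq> univ S" using assms(1) by (simp add: elem_sub_def)
  have ne: "univ M \<noteq> {}" using assms(1) by (simp add: elem_sub_def structure_on_def)
  let ?v = "0 :: nat"
  let ?F = "(\<lambda>a. Neg (Eq (Var ?v) (Par a))) ` univ M :: ('b, 'c, nat, 'a) fml set"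
  have "\<exists>\<phi>\<in>Fml L (univ M) {?v}. \<forall>S s. univ S \<noteq> {} \<longrightarrow> sat S s \<phi> = (\<forall>\<psi>\<in>?F. sat S s \<psi>)"
    by (rule finite_conjunction) (use assms(2) in \<open>auto simp: Fml_def\<close>)
  then obtain \<phi> where \<phi>: "\<phi> \<in> Fml L (univ M) {?v}"
    "\<And>S s. univ S \<noteq> {} \<Longrightarrow> sat S s \<phi> = (\<forall>\<psi>\<in>?F. sat S s \<psi>)" by blast
  have "\<not> satisfiable M \<phi>" using \<phi>(2)[OF ne] by (auto simp: satisfiable_def image_subset_iff)
  then have "\<not> satisfiable S \<phi>" using elem_sub_satisfiable[OF assms(1) \<phi>(1)] by blast
  have "x \<in> univ M" if "x \<in> univ S" for x
  proof (rule ccontr)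
    assume "x \<notin> univ M"
    then have "sat S (\<lambda>_. x) \<phi>" using \<phi>(2)[of S] sub ne by auto
    then show False using \<open>\<not> satisfiable S \<phi>\<close> that
      unfolding satisfiable_def by (auto dest: spec[where x = "\<lambda>_. x"])
  qed
  then show ?thesis using sub by blast
qed

section \<open>Measures on compact spaces with a base of clopen sets\<close>

definition regular_prob :: "'p topology \<Rightarrow> 'p measure \<Rightarrow> bool" where
  "regular_prob X \<rho> \<longleftrightarrow> sets \<rho> = sigma_sets (topspace X) {U. openin X U} \<and> prob_space \<rho> \<and>
     (\<forall>C\<in>sets \<rho>. emeasure \<rho> C = (INF U\<in>{U. openin X U \<and> C \<subseteq> U}. emeasure \<rho> U) \<and>
        emeasure \<rho> C = (SUP K\<in>{K. compactin X K \<and> K \<subseteq> C}. emeasure \<rho> K))"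

locale clopen_base =
  fixes X :: "'p topology" and B :: "'p set set"
  assumes algebra: "algebra (topspace X) B"
    and compact: "compact_space X"
    and base: "openin X U \<longleftrightarrow> U \<subseteq> topspace X \<and> (\<forall>x\<in>U. \<exists>b\<in>B. x \<in> b \<and> b \<subseteq> U)"
begin

sublocale algebra "topspace X" B by (rule algebra)

lemma openin_base: "b \<in> B \<Longrightarrow> openin X b"
  using base sets_into_space by blast

lemma closedin_base: "b \<in> B \<Longrightarrow> closedin X b"
  using openin_base[OF compl_sets, of b] sets_into_space[of b] by (simp add: closedin_def)

lemma compactin_base: "b \<in> B \<Longrightarrow> compactin X b"
  using closedin_base closedin_compact_space[OF compact] by blast

text \<open>Finitely many of the base sets inside \<open>U\<close> cover \<open>K\<close>, and their
  union stays in the algebra.\<close>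

lemma base_between:
  assumes "compactin X K" "openin X U" "K \<subseteq> U"
  obtains b where "b \<in> B" "K \<subseteq> b" "b \<subseteq> U"
proof -
  have "K \<subseteq> \<Union>{b\<in>B. b \<subseteq> U}" using assms(2,3) base[of U] by blast
  moreover have "\<forall>b\<in>{b\<in>B. b \<subseteq> U}. openin X b" using openin_base by blast
  ultimately obtain F where F: "finite F" "F \<subseteq> {b\<in>B. b \<subseteq> U}" "K \<subseteq> \<Union>F"
    using assms(1) unfolding compactin_def by meson
  then have "\<Union>F \<in> B" by (intro finite_Union) auto
  then show ?thesis using that F by blast
qed

abbreviation borel_sets :: "'p set set" where
  "borel_sets \<equiv> sigma_sets (topspace X) {U. openin X U}"

lemma opens_Pow: "{U. openin X U} \<subseteq> Pow (topspace X)"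
  by (auto dest: openin_subset)

lemma open_in_borel: "openin X U \<Longrightarrow> U \<in> borel_sets"
  by (auto intro: sigma_sets.Basic)

lemma base_in_borel: "b \<in> B \<Longrightarrow> b \<in> borel_sets"
  using open_in_borel openin_base by blast

section \<open>Regular measures are determined by their values on the base\<close>

lemma regular_prob_space:
  "regular_prob X \<rho> \<Longrightarrow> space \<rho> = topspace X"
  by (metis opens_Pow regular_prob_def sets_eq_imp_space_eq sets_measure_of space_measure_of)

text \<open>Inner regularity of \<rho> reduces the claim to compact subsets of \<open>U\<close>, and
  a base set squeezed between such a subset and \<open>U\<close> passes the value on to
  \<rho>'.\<close>

lemma regular_prob_le_open:
  assumes "regular_prob X \<rho>" "sets \<rho>' = borel_sets" "\<And>b. b \<in> B \<Longrightarrow> emeasure \<rho> b = emeasure \<rho>' b"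
    and U: "openin X U"
  shows "emeasure \<rho> U \<le> emeasure \<rho>' U"
proof -
  have UI: "U \<in> sets \<rho>" "U \<in> sets \<rho>'"
    using open_in_borel[OF U] assms(1,2) by (auto simp: regular_prob_def)
  have "emeasure \<rho> K \<le> emeasure \<rho>' U" if K: "compactin X K" "K \<subseteq> U" for K
  proof -
    obtain b where b: "b \<in> B" "K \<subseteq> b" "b \<subseteq> U" using base_between[OF K(1) U K(2)] .
    have "emeasure \<rho> K \<le> emeasure \<rho> b"
      using b base_in_borel[OF b(1)] assms(1) by (intro emeasure_mono) (auto simp: regular_prob_def)
    also have "\<dots> = emeasure \<rho>' b" using assms(3) b by blast
    also have "\<dots> \<le> emeasure \<rho>' U" using b UI by (intro emeasure_mono) auto
    finally show ?thesis .
  qed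
  moreover have "emeasure \<rho> U = (SUP K\<in>{K. compactin X K \<and> K \<subseteq> U}. emeasure \<rho> K)"
    using assms(1) UI(1) unfolding regular_prob_def by blast
  ultimately show ?thesis by (auto intro: SUP_least)
qed

text \<open>Inner regularity of both measures gives agreement on open sets, and outer regularity
  spreads it to all Borel sets. Agreement on a generating system closed under intersections would
  not suffice, because open sets may be uncountable unions of base sets.\<close>

lemma regular_prob_unique:
  assumes "regular_prob X \<rho>" "regular_prob X \<rho>'" "\<And>b. b \<in> B \<Longrightarrow> measure \<rho> b = measure \<rho>' b"
  shows "\<rho> = \<rho>'"
proof -
  interpret \<rho>: prob_space \<rho> using assms(1) by (simp add: regular_prob_def)
  interpret \<rho>': prob_space \<rho>' using assms(2) by (simp add: regular_prob_def)
  have sets: "sets \<rho> = borel_sets" "sets \<rho>' = borel_sets" using assms(1,2) by (auto simp: regular_prob_def)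
  have "emeasure \<rho> b = emeasure \<rho>' b" if "b \<in> B" for b
    using assms(3)[OF that] by (simp add: \<rho>.emeasure_eq_measure \<rho>'.emeasure_eq_measure)
  then have op: "emeasure \<rho> U = emeasure \<rho>' U" if "openin X U" for U
    using regular_prob_le_open[OF assms(1) sets(2) _ that] regular_prob_le_open[OF assms(2) sets(1) _ that]
    by (auto intro: antisym)
  show ?thesis
  proof (rule measure_eqI)
    fix C assume C: "C \<in> sets \<rho>"
    have "emeasure \<rho> C = (INF U\<in>{U. openin X U \<and> C \<subseteq> U}. emeasure \<rho> U)"
      using assms(1) C by (simp add: regular_prob_def)
    also have "\<dots> = (INF U\<in>{U. openin X U \<and> C \<subseteq> U}. emeasure \<rho>' U)"
      by (rule INF_cong) (auto simp: op)
    also have "\<dots> = emeasure \<rho>' C"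
      using assms(2) C sets by (simp add: regular_prob_def)
    finally show "emeasure \<rho> C = emeasure \<rho>' C" .
  qed (simp add: sets)
qed

lemma closed_Inter_base:
  assumes "F \<subseteq> B"
  shows "closedin X (topspace X \<inter> \<Inter>F)"
proof (cases "F = {}")
  case False
  then have "closedin X (\<Inter>F)" using assms closedin_base by (intro closedin_Inter) auto
  then show ?thesis by (simp add: closedin_Int)
qed auto

text \<open>\<open>F\<close> may be uncountable, so countable additivity does not apply directly. A
  compact subset of the complement is covered by finitely many complements of members of
  \<open>F\<close>, each of them null, and inner regularity makes the whole complement null.\<close>

lemma regular_prob_Inter:
  assumes "regular_prob X \<rho>" "F \<subseteq> B" "\<And>b. b \<in> F \<Longrightarrow> measure \<rho> b = 1"
  shows "measure \<rho> (topspace X \<inter> \<Inter>F) = 1"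
proof -
  interpret \<rho>: prob_space \<rho> using assms(1) by (simp add: regular_prob_def)
  have sets: "sets \<rho> = borel_sets" using assms(1) by (auto simp: regular_prob_def)
  have space: "space \<rho> = topspace X" using assms(1) by (rule regular_prob_space)
  define U where "U = topspace X - (topspace X \<inter> \<Inter>F)"
  have U: "openin X U" using closed_Inter_base[OF assms(2)] by (simp add: U_def closedin_def)
  have null: "emeasure \<rho> K = 0" if K: "compactin X K" "K \<subseteq> U" for K
  proof -
    have "K \<subseteq> \<Union>((\<lambda>b. topspace X - b) ` F)" using K(2) by (auto simp: U_def)
    moreover have "\<forall>V\<in>(\<lambda>b. topspace X - b) ` F. openin X V" using openin_base assms(2) by auto
    ultimately obtain F' where F': "finite F'" "F' \<subseteq> (\<lambda>b. topspace X - b) ` F" "K \<subseteq> \<Union>F'"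
      using K(1) unfolding compactin_def by meson
    have "V \<in> null_sets \<rho>" if V: "V \<in> F'" for V
    proof -
      obtain b where b: "b \<in> F" "V = space \<rho> - b" using F'(2) V space by auto
      then have "b \<in> sets \<rho>" using assms(2) base_in_borel sets by auto
      then have "measure \<rho> V = 0" using \<rho>.prob_compl assms(3) b by simp
      then show ?thesis using \<open>b \<in> sets \<rho>\<close> b(2) by (intro null_setsI) (auto simp: \<rho>.emeasure_eq_measure)
    qed
    then have "\<Union>F' \<in> null_sets \<rho>" using F'(1)
      by (intro null_sets_UN'[where N = "\<lambda>x. x", simplified]) (auto intro: countable_finite)
    then have "emeasure \<rho> (\<Union>F') = 0" "\<Union>F' \<in> sets \<rho>" by auto
    then show ?thesis using emeasure_mono[OF F'(3)] by (metis le_zero_eq)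
  qed
  have "emeasure \<rho> U = (SUP K\<in>{K. compactin X K \<and> K \<subseteq> U}. emeasure \<rho> K)"
    using assms(1) open_in_borel[OF U] unfolding regular_prob_def by blast
  also have "\<dots> \<le> 0" by (rule SUP_least) (use null in auto)
  finally have "emeasure \<rho> U \<le> 0" .
  then have "measure \<rho> U = 0" by (simp add: measure_def)
  moreover have "topspace X \<inter> \<Inter>F = space \<rho> - U" by (auto simp: space U_def)
  ultimately show ?thesis using \<rho>.prob_compl[of U] open_in_borel[OF U] sets by simp
qed

section \<open>Extension of a finitely additive probability on the base to a regular Borel
  measure\<close>

context
  fixes v :: "'p set \<Rightarrow> real"
  assumes v_nonneg: "\<And>b. b \<in> B \<Longrightarrow> 0 \<le> v b"
    and v_add: "\<And>b c. b \<in> B \<Longrightarrow> c \<in> B \<Longrightarrow> b \<inter> c = {} \<Longrightarrow> v (b \<union> c) = v b + v c"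
    and v_top: "v (topspace X) = 1"
begin

text \<open>For open \<open>U\<close> this value is forced on any regular extension: a compact
  subset of \<open>U\<close> lies in a base set that is still inside \<open>U\<close>. Outer
  regularity then forces \<open>outer_content\<close> on Borel sets.\<close>

definition inner_content :: "'p set \<Rightarrow> ennreal" where
  "inner_content U = (SUP b\<in>{b\<in>B. b \<subseteq> U}. ennreal (v b))"

definition outer_content :: "'p set \<Rightarrow> ennreal" where
  "outer_content A = (INF U\<in>{U. openin X U \<and> A \<subseteq> U}. inner_content U)"

lemma v_mono: "b \<in> B \<Longrightarrow> c \<in> B \<Longrightarrow> b \<subseteq> c \<Longrightarrow> v b \<le> v c"
  using v_add[of b "c - b"] v_nonneg[of "c - b"] Diff[of c b] by (simp add: Un_absorb1)

lemma v_subadd2: "b \<in> B \<Longrightarrow> c \<in> B \<Longrightarrow> v (b \<union> c) \<le> v b + v c"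
  using v_add[of b "c - b"] v_mono[of "c - b" c] Diff[of c b] by auto

lemma v_empty: "v {} = 0"
  using v_add[of "{}" "{}"] by simp

lemma v_subadd: "finite I \<Longrightarrow> (\<And>i. i \<in> I \<Longrightarrow> b i \<in> B) \<Longrightarrow> v (\<Union>i\<in>I. b i) \<le> (\<Sum>i\<in>I. v (b i))"
proof (induction I rule: finite_induct)
  case (insert i I)
  have "v (\<Union>i\<in>insert i I. b i) \<le> v (b i) + v (\<Union>i\<in>I. b i)"
    using insert v_subadd2[of "b i" "\<Union>i\<in>I. b i"] by auto
  then show ?case using insert by simp
qed (simp add: v_empty)

lemma inner_content_mono: "U \<subseteq> W \<Longrightarrow> inner_content U \<le> inner_content W"
  unfolding inner_content_def by (rule SUP_subset_mono) auto

lemma inner_content_ge: "b \<in> B \<Longrightarrow> b \<subseteq> U \<Longrightarrow> ennreal (v b) \<le> inner_content U"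
  unfolding inner_content_def by (rule SUP_upper) auto

lemma inner_content_base: "b \<in> B \<Longrightarrow> inner_content b = ennreal (v b)"
  unfolding inner_content_def
  by (rule antisym) (auto intro!: SUP_least SUP_upper ennreal_leI v_mono)

lemma outer_content_open: "openin X U \<Longrightarrow> outer_content U = inner_content U"
  unfolding outer_content_def by (rule antisym) (auto intro: INF_lower INF_greatest inner_content_mono)

lemma outer_content_mono: "A \<subseteq> A' \<Longrightarrow> outer_content A \<le> outer_content A'"
  unfolding outer_content_def by (rule INF_superset_mono) auto

lemma outer_content_empty: "outer_content {} = 0"
  using outer_content_open[of "{}"] inner_content_base[of "{}"] v_empty by simp

text \<open>A base set \<open>b\<close> inside the union is compact, so finitely many base sets,
  each inside one \<open>U n\<close>, already cover it. The claim thus reduces to finite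
  subadditivity of \<open>v\<close>.\<close>

lemma inner_content_subadditive:
  fixes U :: "nat \<Rightarrow> 'p set"
  assumes "\<And>n. openin X (U n)"
  shows "inner_content (\<Union>n. U n) \<le> (\<Sum>n. inner_content (U n))"
  unfolding inner_content_def[of "\<Union>n. U n"]
proof (rule SUP_least)
  fix b assume "b \<in> {b \<in> B. b \<subseteq> (\<Union>n. U n)}"
  then have b: "b \<in> B" "b \<subseteq> (\<Union>n. U n)" by auto
  have "\<forall>c\<in>{c\<in>B. \<exists>n. c \<subseteq> U n}. openin X c" using openin_base by blast
  moreover have "b \<subseteq> \<Union>{c\<in>B. \<exists>n. c \<subseteq> U n}" 
  proof
    fix x assume "x \<in> b"
    then obtain n where "x \<in> U n" using b(2) by blast
    then show "x \<in> \<Union>{c\<in>B. \<exists>n. c \<subseteq> U n}" using assms[of n] base[of "U n"] by blast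
  qed
  ultimately obtain F where F: "finite F" "F \<subseteq> {c\<in>B. \<exists>n. c \<subseteq> U n}" "b \<subseteq> \<Union>F"
    using compactinD[OF compactin_base[OF b(1)], of "{c\<in>B. \<exists>n. c \<subseteq> U n}"] by blast
  then have "\<forall>c\<in>F. \<exists>n. c \<subseteq> U n" by blast
  then obtain n where n: "\<And>c. c \<in> F \<Longrightarrow> c \<subseteq> U (n c)" by metis
  \<comment> \<open>Several members of \<open>F\<close> may be assigned to the same index. Merging
    them makes each \<open>inner_content (U k)\<close> count once in the sum.\<close>
  define d where "d k = \<Union>{c\<in>F. n c = k}" for k
  have d: "d k \<in> B" for k using F(1,2) unfolding d_def by (intro finite_Union) auto
  have dU: "d k \<subseteq> U k" for k using n unfolding d_def by blast
  have "b \<subseteq> (\<Union>k\<in>n ` F. d k)" using F(3) by (fastforce simp: d_def)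
  then have "v b \<le> v (\<Union>k\<in>n ` F. d k)" using b F d by (intro v_mono) auto
  also have "\<dots> \<le> (\<Sum>k\<in>n ` F. v (d k))" using F d by (intro v_subadd) auto
  finally have "ennreal (v b) \<le> (\<Sum>k\<in>n ` F. ennreal (v (d k)))"
    using d v_nonneg by (simp add: sum_nonneg ennreal_leI)
  also have "\<dots> \<le> (\<Sum>k\<in>n ` F. inner_content (U k))"
    by (intro sum_mono inner_content_ge d dU)
  also have "\<dots> \<le> (\<Sum>k. inner_content (U k))"
    by (rule sum_le_suminf) (use F in auto)
  finally show "ennreal (v b) \<le> (\<Sum>k. inner_content (U k))" .
qed

lemma outer_content_close:
  assumes "outer_content A < e"
  obtains U where "openin X U" "A \<subseteq> U" "inner_content U < e"
  using assms unfolding outer_content_def INF_less_iff by blast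

lemma outer_measure_space_outer_content: "outer_measure_space (Pow (topspace X)) outer_content"
  unfolding outer_measure_space_def
proof (intro conjI)
  show "positive (Pow (topspace X)) outer_content"
    by (simp add: positive_def outer_content_empty)
  show "increasing (Pow (topspace X)) outer_content"
    by (simp add: increasing_def outer_content_mono)
  show "countably_subadditive (Pow (topspace X)) outer_content"
    unfolding countably_subadditive_def
  proof safe
    fix A :: "nat \<Rightarrow> 'p set"
    show "outer_content (\<Union>(range A)) \<le> (\<Sum>i. outer_content (A i))"
    proof (rule ennreal_le_epsilon)
      fix e :: real assume e: "0 < e" "(\<Sum>i. outer_content (A i)) < top"
      then have *: "\<And>n. outer_content (A n) < outer_content (A n) + e * (1/2)^Suc n"
        by (auto simp add: less_top dest!: ennreal_suminf_lessD)
      have "\<exists>U. openin X U \<and> A n \<subseteq> U \<and> inner_content U < outer_content (A n) + e * (1/2)^Suc n" for n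
        using outer_content_close[OF *] by metis
      then obtain U where U: "\<And>n. openin X (U n)" "\<And>n. A n \<subseteq> U n"
        "\<And>n. inner_content (U n) < outer_content (A n) + e * (1/2)^Suc n" by metis
      have "outer_content (\<Union>(range A)) \<le> outer_content (\<Union>n. U n)"
        by (rule outer_content_mono) (use U(2) in blast)
      also have "\<dots> = inner_content (\<Union>n. U n)"
        by (rule outer_content_open) (use U(1) in auto)
      also have "\<dots> \<le> (\<Sum>n. inner_content (U n))"
        by (rule inner_content_subadditive[OF U(1)])
      also have "\<dots> \<le> (\<Sum>n. outer_content (A n) + e * (1/2) ^ Suc n)"
        by (intro suminf_le less_imp_le[OF U(3)]) auto
      also have "... = (\<Sum>n. outer_content (A n)) + (\<Sum>n. ennreal e * ennreal ((1/2) ^ Suc n))"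
        using \<open>0 < e\<close> by (subst suminf_add[symmetric])
          (auto simp del: ennreal_suminf_cmult simp add: ennreal_mult[symmetric])
      also have "\<dots> = (\<Sum>n. outer_content (A n)) + e"
        unfolding ennreal_suminf_cmult
        by (subst suminf_ennreal_eq[OF zero_le_power power_half_series]) auto
      finally show "outer_content (\<Union>(range A)) \<le> (\<Sum>n. outer_content (A n)) + e" .
    qed
  qed
qed

lemma outer_content_subadd2:
  assumes "A \<subseteq> topspace X" "A' \<subseteq> topspace X" "A \<inter> A' = {}"
  shows "outer_content (A \<union> A') \<le> outer_content A + outer_content A'"
proof -
  interpret P: ring_of_sets "topspace X" "Pow (topspace X)" by (rule ring_of_sets_Pow)
  have "subadditive (Pow (topspace X)) outer_content"
    by (rule P.countably_subadditive_subadditive)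
      (use outer_measure_space_outer_content in \<open>auto simp: outer_measure_space_def\<close>)
  then show ?thesis using assms unfolding subadditive_def by auto
qed

text \<open>It suffices to bound the two parts by the content of an open \<open>W\<close> containing
  \<open>A\<close>. For a base set \<open>b\<close> inside U \<inter> W, the set
  \<open>W - b\<close> is open and contains \<open>W - U\<close>. Base sets inside
  \<open>W - b\<close> are disjoint from \<open>b\<close>, so additivity of \<open>v\<close> keeps
  the sum below the content of \<open>W\<close>.\<close>

lemma open_in_lambda_system:
  assumes U: "openin X U"
  shows "U \<in> lambda_system (topspace X) (Pow (topspace X)) outer_content"
  unfolding lambda_system_def
proof safe
  fix x assume "x \<in> U" then show "x \<in> topspace X" using openin_subset[OF U] by blast
next
  fix A assume A: "A \<subseteq> topspace X"
  show "outer_content (U \<inter> A) + outer_content ((topspace X - U) \<inter> A) = outer_content A"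
  proof (rule antisym)
    have "(U \<inter> A) \<union> ((topspace X - U) \<inter> A) = A" using A by blast
    then show "outer_content A \<le> outer_content (U \<inter> A) + outer_content ((topspace X - U) \<inter> A)"
      using outer_content_subadd2[of "U \<inter> A" "(topspace X - U) \<inter> A"] A by auto
    have "outer_content (U \<inter> A) + outer_content ((topspace X - U) \<inter> A) \<le> inner_content W"
      if W: "openin X W" "A \<subseteq> W" for W
    proof -
      have "ennreal (v b) + outer_content ((topspace X - U) \<inter> W) \<le> inner_content W"
        if b: "b \<in> B" "b \<subseteq> U \<inter> W" for b
      proof -
        have op: "openin X (W - b)" using W(1) closedin_base[OF b(1)] by (rule openin_diff)
        have "outer_content ((topspace X - U) \<inter> W) \<le> inner_content (W - b)"
          unfolding outer_content_open[OF op, symmetric] by (rule outer_content_mono) (use b in blast)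
        then have "ennreal (v b) + outer_content ((topspace X - U) \<inter> W)
            \<le> ennreal (v b) + inner_content (W - b)" by (rule add_left_mono)
        also have "\<dots> = (SUP c\<in>{c\<in>B. c \<subseteq> W - b}. ennreal (v b) + ennreal (v c))"
          unfolding inner_content_def by (subst ennreal_SUP_add_right) auto
        also have "\<dots> \<le> inner_content W"
        proof (rule SUP_least)
          fix c assume "c \<in> {c\<in>B. c \<subseteq> W - b}"
          then have c: "c \<in> B" "c \<subseteq> W" "b \<inter> c = {}" by auto
          have "ennreal (v b) + ennreal (v c) = ennreal (v (b \<union> c))"
            using v_add[OF b(1) c(1,3)] v_nonneg b c by (simp add: ennreal_plus)
          also have "\<dots> \<le> inner_content W" using b c by (intro inner_content_ge) auto
          finally show "ennreal (v b) + ennreal (v c) \<le> inner_content W" .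
        qed
        finally show ?thesis .
      qed
      moreover have "inner_content (U \<inter> W) + outer_content ((topspace X - U) \<inter> W) =
          (SUP b\<in>{b\<in>B. b \<subseteq> U \<inter> W}. ennreal (v b) + outer_content ((topspace X - U) \<inter> W))"
        unfolding inner_content_def by (subst ennreal_SUP_add_left) auto
      ultimately have "inner_content (U \<inter> W) + outer_content ((topspace X - U) \<inter> W) \<le> inner_content W"
        by (auto intro!: SUP_least)
      moreover have "outer_content (U \<inter> A) \<le> inner_content (U \<inter> W)"
        using outer_content_open[OF openin_Int[OF U W(1)]] outer_content_mono[of "U \<inter> A" "U \<inter> W"] W(2)
        by auto
      moreover have "outer_content ((topspace X - U) \<inter> A) \<le> outer_content ((topspace X - U) \<inter> W)"
        by (rule outer_content_mono) (use W in auto)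
      ultimately show ?thesis by (meson add_mono order_trans)
    qed
    then show "outer_content (U \<inter> A) + outer_content ((topspace X - U) \<inter> A) \<le> outer_content A"
      unfolding outer_content_def[of A] by (auto intro: INF_greatest)
  qed
qed

text \<open>By Caratheodory, \<open>outer_content\<close> is countably additive on the sets that
  split every set, and these include the open sets, hence the Borel sets. Outer regularity is built
  into \<open>outer_content\<close>. Inner regularity is outer regularity of the complement, because
  closed sets are compact here.\<close>

lemma regular_prob_extension_aux:
  "regular_prob X (measure_of (topspace X) borel_sets outer_content)"
  "b \<in> B \<Longrightarrow> measure (measure_of (topspace X) borel_sets outer_content) b = v b"
proof -
  define \<rho> where "\<rho> = measure_of (topspace X) borel_sets outer_content"
  have sa: "sigma_algebra (topspace X) borel_sets" by (rule sigma_algebra_sigma_sets[OF opens_Pow])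
  have "measure_space (topspace X) (lambda_system (topspace X) (Pow (topspace X)) outer_content) outer_content"
    by (rule sigma_algebra.caratheodory_lemma[OF sigma_algebra_Pow outer_measure_space_outer_content])
  then have L: "sigma_algebra (topspace X) (lambda_system (topspace X) (Pow (topspace X)) outer_content)"
    "countably_additive (lambda_system (topspace X) (Pow (topspace X)) outer_content) outer_content"
    by (auto simp: measure_space_def)
  have sub: "borel_sets \<subseteq> lambda_system (topspace X) (Pow (topspace X)) outer_content"
    by (rule sigma_algebra.sigma_sets_subset[OF L(1)]) (use open_in_lambda_system in auto)
  have ca: "countably_additive borel_sets outer_content"
    using L(2) sub unfolding countably_additive_def by blast
  have em: "emeasure \<rho> C = outer_content C" if "C \<in> borel_sets" for C
    unfolding \<rho>_def by (rule emeasure_measure_of_sigma[OF sa _ ca that])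
      (simp add: positive_def outer_content_empty)
  have sets: "sets \<rho> = borel_sets" unfolding \<rho>_def by (simp add: sigma_algebra.sets_measure_of_eq[OF sa])
  have space: "space \<rho> = topspace X" unfolding \<rho>_def
    by (simp add: sigma_algebra.space_measure_of_eq[OF sa])
  have emb: "emeasure \<rho> b = ennreal (v b)" if "b \<in> B" for b
    using that by (simp add: em base_in_borel outer_content_open openin_base inner_content_base)
  then have mb: "measure \<rho> b = v b" if "b \<in> B" for b
    using that v_nonneg by (simp add: measure_def)
  interpret \<rho>: prob_space \<rho>
    by standard (simp add: space emb v_top)
  have outer: "emeasure \<rho> C = (INF U\<in>{U. openin X U \<and> C \<subseteq> U}. emeasure \<rho> U)" if "C \<in> borel_sets" for C
    unfolding em[OF that] outer_content_def[of C]
    by (rule INF_cong) (auto simp: em open_in_borel outer_content_open)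
  have inner: "emeasure \<rho> C = (SUP K\<in>{K. compactin X K \<and> K \<subseteq> C}. emeasure \<rho> K)" if C: "C \<in> borel_sets" for C
  proof (rule antisym)
    show "(SUP K\<in>{K. compactin X K \<and> K \<subseteq> C}. emeasure \<rho> K) \<le> emeasure \<rho> C"
      by (rule SUP_least, rule emeasure_mono) (use C sets in auto)
    show "emeasure \<rho> C \<le> (SUP K\<in>{K. compactin X K \<and> K \<subseteq> C}. emeasure \<rho> K)"
    proof (rule ennreal_le_epsilon)
      fix e :: real assume e: "0 < e"
      \<comment> \<open>An open set slightly larger than \<open>D\<close> has a compact complement,
        which lies in \<open>C\<close> and misses only a set of measure at most
        \<open>e\<close>.\<close>
      define D where "D = topspace X - C"
      have D: "D \<in> borel_sets" unfolding D_def using C by (rule sigma_sets.Compl)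
      have "emeasure \<rho> D < emeasure \<rho> D + ennreal e" using e by (simp add: \<rho>.emeasure_eq_measure less_top)
      then have "\<exists>U\<in>{U. openin X U \<and> D \<subseteq> U}. emeasure \<rho> U < emeasure \<rho> D + ennreal e"
        unfolding outer[OF D] INF_less_iff .
      then obtain U where U: "openin X U" "D \<subseteq> U" "emeasure \<rho> U < emeasure \<rho> D + ennreal e" by blast
      have Us: "U \<in> sets \<rho>" using U(1) open_in_borel sets by blast
      define K where "K = topspace X - U"
      have K: "compactin X K" using U(1) closedin_compact_space[OF compact] by (auto simp: K_def)
      have Ks: "K \<in> sets \<rho>" using Us sets.compl_sets[of U \<rho>] by (simp add: K_def space)
      have KC: "K \<subseteq> C" using U(2) by (auto simp: K_def D_def)
      have "emeasure \<rho> (U - D) = emeasure \<rho> U - emeasure \<rho> D"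
        using U(2) Us D sets by (intro emeasure_Diff) auto
      also have "\<dots> \<le> ennreal e"
        using U(3) by (simp add: ennreal_minus_le_iff add.commute less_imp_le)
      finally have UD: "emeasure \<rho> (U - D) \<le> ennreal e" .
      have "C \<subseteq> topspace X" using C sets sets.sets_into_space space by metis
      then have "C \<subseteq> K \<union> (U - D)" by (auto simp: K_def D_def)
      then have "emeasure \<rho> C \<le> emeasure \<rho> (K \<union> (U - D))" by (intro emeasure_mono sets.Un sets.Diff Ks Us) (use D sets in auto)
      also have "\<dots> \<le> emeasure \<rho> K + emeasure \<rho> (U - D)"
        using Ks Us D sets by (intro emeasure_subadditive) auto
      also have "\<dots> \<le> (SUP K\<in>{K. compactin X K \<and> K \<subseteq> C}. emeasure \<rho> K) + ennreal e"
        using K KC UD by (intro add_mono SUP_upper) auto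
      finally show "emeasure \<rho> C \<le> (SUP K\<in>{K. compactin X K \<and> K \<subseteq> C}. emeasure \<rho> K) + ennreal e" .
    qed
  qed
  have "regular_prob X \<rho>" unfolding regular_prob_def
    using sets outer inner \<rho>.prob_space_axioms by metis
  then show "regular_prob X (measure_of (topspace X) borel_sets outer_content)"
    "b \<in> B \<Longrightarrow> measure (measure_of (topspace X) borel_sets outer_content) b = v b"
    using mb by (auto simp: \<rho>_def)
qed

end

lemma regular_prob_extension:
  fixes v :: "'p set \<Rightarrow> real"
  assumes "\<And>b. b \<in> B \<Longrightarrow> 0 \<le> v b"
    and "\<And>b c. b \<in> B \<Longrightarrow> c \<in> B \<Longrightarrow> b \<inter> c = {} \<Longrightarrow> v (b \<union> c) = v b + v c"
    and "v (topspace X) = 1"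
  shows "\<exists>\<rho>. regular_prob X \<rho> \<and> (\<forall>b\<in>B. measure \<rho> b = v b)"
  using regular_prob_extension_aux[of v] assms by blast

text \<open>Around each point some base set keeps \<open>f\<close> within \<open>e\<close> of its
  value there. Finitely many of these cover the space, and making them disjoint inside the algebra
  turns the values at their centres into a step function.\<close>

lemma continuous_approx:
  fixes f :: "'p \<Rightarrow> real"
  assumes f: "continuous_map X euclideanreal f" and "0 < e"
  obtains N :: nat and D :: "nat \<Rightarrow> 'p set" and r :: "nat \<Rightarrow> real"
  where "\<And>k. D k \<in> B" "\<And>x. x \<in> topspace X \<Longrightarrow> \<bar>f x - (\<Sum>k<N. r k * indicat_real (D k) x)\<bar> < e"
proof -
  have "\<exists>b\<in>B. x \<in> b \<and> (\<forall>y\<in>b. \<bar>f y - f x\<bar> < e)" if x: "x \<in> topspace X" for x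
  proof -
    have "openin X {y \<in> topspace X. f y \<in> ball (f x) e}"
      by (rule openin_continuous_map_preimage[OF f]) auto
    then obtain b where "b \<in> B" "x \<in> b" "b \<subseteq> {y \<in> topspace X. f y \<in> ball (f x) e}"
      using x \<open>0 < e\<close> base by (metis (no_types, lifting) centre_in_ball mem_Collect_eq)
    then show ?thesis by (intro bexI[of _ b]) (auto simp: dist_real_def abs_minus_commute)
  qed
  then obtain c where c: "\<And>x. x \<in> topspace X \<Longrightarrow> c x \<in> B \<and> x \<in> c x \<and> (\<forall>y\<in>c x. \<bar>f y - f x\<bar> < e)"
    by metis
  have "\<forall>U\<in>c ` topspace X. openin X U" "topspace X \<subseteq> \<Union>(c ` topspace X)"
    using c openin_base by auto
  then obtain F where F: "finite F" "F \<subseteq> c ` topspace X" "topspace X \<subseteq> \<Union>F"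
    using compact unfolding compact_space_def compactin_def by meson
  then obtain G where G: "G \<subseteq> topspace X" "finite G" "F = c ` G"
    by (meson finite_subset_image)
  obtain xs where xs: "set xs = G" using finite_list[OF G(2)] by blast
  \<comment> \<open>\<open>disjointed\<close> works on infinite sequences, so the finite list is
    continued by empty sets.\<close>
  define A where "A k = (if k < length xs then c (xs ! k) else {})" for k
  have A: "A k \<in> B" for k
    using c G(1) xs nth_mem[of k xs] by (auto simp: A_def)
  define D where "D = disjointed A"
  have "D k \<in> B" for k unfolding D_def using A range_disjointed_sets[of A] by auto
  moreover have "\<bar>f x - (\<Sum>k<length xs. f (xs ! k) * indicat_real (D k) x)\<bar> < e" if x: "x \<in> topspace X" for x
  proof -
    obtain y where "y \<in> G" "x \<in> c y" using F(3) G(3) x by blast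
    then obtain j where "j < length xs" "xs ! j = y" using xs by (metis in_set_conv_nth)
    then have "x \<in> (\<Union>k. A k)" using \<open>x \<in> c y\<close> by (auto simp: A_def)
    then have "x \<in> (\<Union>k. D k)" by (simp add: D_def UN_disjointed_eq)
    then obtain i where i: "x \<in> D i" by blast
    then have "x \<in> A i" using disjointed_subset[of A i] unfolding D_def by blast
    then have il: "i < length xs" "x \<in> c (xs ! i)" by (auto simp: A_def split: if_splits)
    \<comment> \<open>The pieces are disjoint, so exactly one term of the step function survives at
      \<open>x\<close>. The piece \<open>D i\<close> lies inside \<open>A i\<close>, where the value
      at the centre \<open>xs ! i\<close> is a good approximation.\<close>
    have "indicat_real (D k) x = (if k = i then 1 else 0)" for k
      using i disjoint_family_disjointed[of A] unfolding D_def disjoint_family_on_def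
      by (auto simp: indicator_def)
    then have "(\<Sum>k<length xs. f (xs ! k) * indicat_real (D k) x) = f (xs ! i)"
      using il(1) by (simp add: if_distrib[of "\<lambda>t. _ * t"] cong: if_cong)
    moreover have "xs ! i \<in> topspace X" using il(1) xs G(1) by auto
    ultimately show ?thesis using c il(2) by auto
  qed
  ultimately show ?thesis by (rule that)
qed

lemma continuous_borel_measurable:
  fixes f :: "'p \<Rightarrow> real"
  assumes "continuous_map X euclideanreal f" "sets \<rho> = borel_sets" "space \<rho> = topspace X"
  shows "f \<in> borel_measurable \<rho>"
proof (rule borel_measurableI)
  fix S :: "real set" assume "open S"
  then have "openin X {x \<in> topspace X. f x \<in> S}"
    by (intro openin_continuous_map_preimage[OF assms(1)]) auto
  moreover have "f -` S \<inter> space \<rho> = {x \<in> topspace X. f x \<in> S}" using assms(3) by auto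
  ultimately show "f -` S \<inter> space \<rho> \<in> sets \<rho>" using assms(2) open_in_borel by simp
qed

text \<open>The kernel \<open>K\<close> is only assumed to be measurable on clopen sets, so \<open>\<xi>\<close> need not be a mixture of
  the measures \<open>K q\<close> on all Borel sets.\<close>

lemma integral_kernel:
  fixes f :: "'p \<Rightarrow> real" and K :: "'q \<Rightarrow> 'p measure"
  assumes f: "continuous_map X euclideanreal f"
    and N: "prob_space N"
    and \<xi>: "prob_space \<xi>" "sets \<xi> = borel_sets"
    and K: "\<And>q. q \<in> space N \<Longrightarrow> prob_space (K q)" "\<And>q. q \<in> space N \<Longrightarrow> sets (K q) = borel_sets"
    and meas: "\<And>b. b \<in> B \<Longrightarrow> (\<lambda>q. measure (K q) b) \<in> borel_measurable N"
    and mix: "\<And>b. b \<in> B \<Longrightarrow> measure \<xi> b = (\<integral>q. measure (K q) b \<partial>N)"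
  shows "(\<integral>x. f x \<partial>\<xi>) = (\<integral>q. (\<integral>x. f x \<partial>K q) \<partial>N)"
proof -
  interpret N: prob_space N by (rule N)
  have sp: "space \<rho> = topspace X" if "sets \<rho> = borel_sets" for \<rho>
    using that by (metis opens_Pow sets_eq_imp_space_eq sets_measure_of space_measure_of)
  obtain C where C: "\<And>x. x \<in> topspace X \<Longrightarrow> \<bar>f x\<bar> \<le> C"
  proof -
    have "compact (f ` topspace X)"
      using image_compactin[OF _ f, of "topspace X"] compact by (simp add: compact_space_def)
    then show ?thesis using that compact_imp_bounded bounded_real by (metis image_eqI)
  qed
  have int_f: "integrable \<rho> f" if "prob_space \<rho>" "sets \<rho> = borel_sets" for \<rho>
  proof -
    interpret prob_space \<rho> by (rule that(1))
    show ?thesis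
      by (rule integrable_const_bound[of f C])
        (use C that sp[OF that(2)] continuous_borel_measurable[OF f] in auto)
  qed
  \<comment> \<open>One step function has to serve \<xi> and all the measures \<open>K q\<close>
    simultaneously. Uniform approximation gives an error bound independent of the probability
    measure, and for a step function the claim is linearity together with
    \<open>mix\<close>.\<close>
  have "\<exists>g. (\<forall>\<rho>. prob_space \<rho> \<longrightarrow> sets \<rho> = borel_sets \<longrightarrow>
        integrable \<rho> g \<and> \<bar>(\<integral>x. f x \<partial>\<rho>) - (\<integral>x. g x \<partial>\<rho>)\<bar> \<le> e) \<and>
      (\<lambda>q. \<integral>x. g x \<partial>K q) \<in> borel_measurable N \<and> integrable N (\<lambda>q. \<integral>x. g x \<partial>K q) \<and>
      (\<integral>x. g x \<partial>\<xi>) = (\<integral>q. (\<integral>x. g x \<partial>K q) \<partial>N)" if e: "0 < e" for e :: real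
  proof -
    obtain n :: nat and D r where D: "\<And>k. D k \<in> B"
      and a: "\<And>x. x \<in> topspace X \<Longrightarrow> \<bar>f x - (\<Sum>k<n. r k * indicat_real (D k) x)\<bar> < e"
      by (rule continuous_approx[OF f e]) blast
    define g where "g x = (\<Sum>k<n. r k * indicat_real (D k) x)" for x
    have Ds: "D k \<in> sets \<rho>" if "sets \<rho> = borel_sets" for k \<rho> using D base_in_borel that by simp
    have ig: "integrable \<rho> g" "(\<integral>x. g x \<partial>\<rho>) = (\<Sum>k<n. r k * measure \<rho> (D k))"
      if "prob_space \<rho>" "sets \<rho> = borel_sets" for \<rho>
    proof -
      interpret prob_space \<rho> by (rule that(1))
      have i: "integrable \<rho> (\<lambda>x. r k * indicat_real (D k) x)" for k
        using Ds[OF that(2), of k] by (auto simp: less_top[symmetric])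
      then show "integrable \<rho> g" unfolding g_def[abs_def] by (rule Bochner_Integration.integrable_sum)
      have "(\<integral>x. g x \<partial>\<rho>) = (\<Sum>k<n. \<integral>x. r k * indicat_real (D k) x \<partial>\<rho>)"
        unfolding g_def using i by (rule Bochner_Integration.integral_sum)
      also have "\<dots> = (\<Sum>k<n. r k * measure \<rho> (D k))"
        using Ds[OF that(2)] sets.Int_space_eq2 by (intro sum.cong) auto
      finally show "(\<integral>x. g x \<partial>\<rho>) = (\<Sum>k<n. r k * measure \<rho> (D k))" .
    qed
    have "\<bar>(\<integral>x. f x \<partial>\<rho>) - (\<integral>x. g x \<partial>\<rho>)\<bar> \<le> e" if \<rho>: "prob_space \<rho>" "sets \<rho> = borel_sets" for \<rho>
    proof -
      interpret prob_space \<rho> by (rule \<rho>(1))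
      have "\<bar>(\<integral>x. f x \<partial>\<rho>) - (\<integral>x. g x \<partial>\<rho>)\<bar> = \<bar>\<integral>x. f x - g x \<partial>\<rho>\<bar>"
        using int_f[OF \<rho>] ig[OF \<rho>] by simp
      also have "\<dots> \<le> (\<integral>x. \<bar>f x - g x\<bar> \<partial>\<rho>)" by (rule integral_abs_bound)
      also have "\<dots> \<le> (\<integral>x. e \<partial>\<rho>)"
        by (intro integral_mono integrable_abs Bochner_Integration.integrable_diff int_f[OF \<rho>] ig(1)[OF \<rho>])
          (use a[folded g_def] sp[OF \<rho>(2)] in \<open>auto simp: less_imp_le\<close>)
      finally show ?thesis by (simp add: prob_space)
    qed
    moreover have eq: "(\<integral>x. g x \<partial>K q) = (\<Sum>k<n. r k * measure (K q) (D k))" if "q \<in> space N" for q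
      using ig(2) K that by blast
    moreover have "(\<lambda>q. \<Sum>k<n. r k * measure (K q) (D k)) \<in> borel_measurable N"
      using meas D by auto
    moreover have im: "integrable N (\<lambda>q. r k * measure (K q) (D k))" for k
      using meas[OF D, of k] K(1) prob_space.prob_le_1
      by (intro integrable_mult_right N.integrable_const_bound[of _ 1]) auto
    then have "integrable N (\<lambda>q. \<Sum>k<n. r k * measure (K q) (D k))" by auto
    moreover have "(\<integral>x. g x \<partial>\<xi>) = (\<integral>q. (\<integral>x. g x \<partial>K q) \<partial>N)"
    proof -
      have "(\<integral>x. g x \<partial>\<xi>) = (\<Sum>k<n. r k * (\<integral>q. measure (K q) (D k) \<partial>N))"
        using ig(2)[OF \<xi>] mix D by simp
      also have "\<dots> = (\<integral>q. (\<Sum>k<n. r k * measure (K q) (D k)) \<partial>N)"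
        using im by (simp add: Bochner_Integration.integral_sum)
      also have "\<dots> = (\<integral>q. (\<integral>x. g x \<partial>K q) \<partial>N)"
        by (rule Bochner_Integration.integral_cong) (auto simp: eq)
      finally show ?thesis .
    qed
    ultimately show ?thesis using ig(1)
      by (intro exI[of _ g]) (auto cong: measurable_cong Bochner_Integration.integrable_cong)
  qed
  then have "\<forall>e. \<exists>g. 0 < e \<longrightarrow> (\<forall>\<rho>. prob_space \<rho> \<longrightarrow> sets \<rho> = borel_sets \<longrightarrow>
        integrable \<rho> g \<and> \<bar>(\<integral>x. f x \<partial>\<rho>) - (\<integral>x. g x \<partial>\<rho>)\<bar> \<le> e) \<and>
      (\<lambda>q. \<integral>x. g x \<partial>K q) \<in> borel_measurable N \<and> integrable N (\<lambda>q. \<integral>x. g x \<partial>K q) \<and>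
      (\<integral>x. g x \<partial>\<xi>) = (\<integral>q. (\<integral>x. g x \<partial>K q) \<partial>N)" by blast
  then obtain g where g: "\<And>e. 0 < e \<Longrightarrow> (\<forall>\<rho>. prob_space \<rho> \<longrightarrow> sets \<rho> = borel_sets \<longrightarrow>
        integrable \<rho> (g e) \<and> \<bar>(\<integral>x. f x \<partial>\<rho>) - (\<integral>x. g e x \<partial>\<rho>)\<bar> \<le> e) \<and>
      (\<lambda>q. \<integral>x. g e x \<partial>K q) \<in> borel_measurable N \<and> integrable N (\<lambda>q. \<integral>x. g e x \<partial>K q) \<and>
      (\<integral>x. g e x \<partial>\<xi>) = (\<integral>q. (\<integral>x. g e x \<partial>K q) \<partial>N)" by metis
  have lim: "(\<lambda>n. \<integral>x. g (1 / real (Suc n)) x \<partial>\<rho>) \<longlonglongrightarrow> (\<integral>x. f x \<partial>\<rho>)"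
    if "prob_space \<rho>" "sets \<rho> = borel_sets" for \<rho>
  proof (rule LIMSEQ_I)
    fix r :: real assume "0 < r"
    then obtain n0 where n0: "1 / real (Suc n0) < r" using nat_approx_posE by blast
    have "norm ((\<integral>x. g (1 / real (Suc n)) x \<partial>\<rho>) - (\<integral>x. f x \<partial>\<rho>)) < r" if "n \<ge> n0" for n
    proof -
      have "\<bar>(\<integral>x. f x \<partial>\<rho>) - (\<integral>x. g (1 / real (Suc n)) x \<partial>\<rho>)\<bar> \<le> 1 / real (Suc n)"
        using g[of "1 / real (Suc n)"] \<open>prob_space \<rho>\<close> \<open>sets \<rho> = borel_sets\<close> by simp
      also have "\<dots> \<le> 1 / real (Suc n0)" using that by (simp add: frac_le)
      finally show ?thesis using n0 by (simp add: abs_minus_commute)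
    qed
    then show "\<exists>no. \<forall>n\<ge>no. norm ((\<integral>x. g (1 / real (Suc n)) x \<partial>\<rho>) - (\<integral>x. f x \<partial>\<rho>)) < r" by blast
  qed
  \<comment> \<open>Measurability of the inner integral is obtained as a pointwise limit of step
    integrals, which involve \<open>K q\<close> on clopen sets alone.\<close>
  have mf: "(\<lambda>q. \<integral>x. f x \<partial>K q) \<in> borel_measurable N"
    by (rule borel_measurable_LIMSEQ_real[where u = "\<lambda>n q. \<integral>x. g (1 / real (Suc n)) x \<partial>K q"])
      (use lim K g in auto)
  have bf: "\<bar>\<integral>x. f x \<partial>\<rho>\<bar> \<le> C" if "prob_space \<rho>" "sets \<rho> = borel_sets" for \<rho>
  proof -
    interpret prob_space \<rho> by (rule that(1))
    have "\<bar>\<integral>x. f x \<partial>\<rho>\<bar> \<le> (\<integral>x. \<bar>f x\<bar> \<partial>\<rho>)" by (rule integral_abs_bound)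
    also have "\<dots> \<le> (\<integral>x. C \<partial>\<rho>)"
      using int_f[OF that] C sp[OF that(2)] by (intro integral_mono) auto
    finally show ?thesis by (simp add: prob_space)
  qed
  have intf: "integrable N (\<lambda>q. \<integral>x. f x \<partial>K q)"
    by (rule N.integrable_const_bound[of _ C]) (use mf bf K in auto)
  have "\<bar>(\<integral>x. f x \<partial>\<xi>) - (\<integral>q. (\<integral>x. f x \<partial>K q) \<partial>N)\<bar> \<le> e" if "0 < e" for e
  proof -
    have e: "0 < e / 2" using that by simp
    note g = g[OF e]
    have "\<bar>(\<integral>x. f x \<partial>\<xi>) - (\<integral>x. g (e/2) x \<partial>\<xi>)\<bar> \<le> e / 2" using g \<xi> by blast
    moreover have "\<bar>(\<integral>q. (\<integral>x. f x \<partial>K q) \<partial>N) - (\<integral>q. (\<integral>x. g (e/2) x \<partial>K q) \<partial>N)\<bar> \<le> e / 2"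
    proof -
      have i: "integrable N (\<lambda>q. \<integral>x. g (e/2) x \<partial>K q)" using g by blast
      then have "\<bar>(\<integral>q. (\<integral>x. f x \<partial>K q) \<partial>N) - (\<integral>q. (\<integral>x. g (e/2) x \<partial>K q) \<partial>N)\<bar> =
          \<bar>\<integral>q. (\<integral>x. f x \<partial>K q) - (\<integral>x. g (e/2) x \<partial>K q) \<partial>N\<bar>" using intf by simp
      also have "\<dots> \<le> (\<integral>q. \<bar>(\<integral>x. f x \<partial>K q) - (\<integral>x. g (e/2) x \<partial>K q)\<bar> \<partial>N)" by (rule integral_abs_bound)
      also have "\<dots> \<le> (\<integral>q. e / 2 \<partial>N)"
        using intf i g K by (intro integral_mono) auto
      finally show ?thesis by (simp add: N.prob_space)
    qed
    moreover have "(\<integral>x. g (e/2) x \<partial>\<xi>) = (\<integral>q. (\<integral>x. g (e/2) x \<partial>K q) \<partial>N)" using g by blast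
    ultimately show ?thesis by linarith
  qed
  then show ?thesis
    by (metis abs_le_zero_iff eq_iff_diff_eq_0 field_le_epsilon add_0)
qed

end

section \<open>Type spaces\<close>

lemma types_finsat:
  assumes "p \<in> types L S A V" "finite F" "F \<subseteq> p"
  shows "\<exists>s. range s \<subseteq> univ S \<and> (\<forall>\<phi>\<in>F. sat S s \<phi>)"
proof -
  have "\<forall>F. finite F \<and> F \<subseteq> p \<longrightarrow> (\<exists>s. range s \<subseteq> univ S \<and> (\<forall>\<phi>\<in>F. sat S s \<phi>))"
    using assms(1) by (simp add: types_def)
  then show ?thesis using assms(2,3) by simp
qed

lemma types_Fml: "p \<in> types L S A V \<Longrightarrow> \<phi> \<in> p \<Longrightarrow> \<phi> \<in> Fml L A V"
  by (auto simp: types_def)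

lemma types_complete: "p \<in> types L S A V \<Longrightarrow> \<phi> \<in> Fml L A V \<Longrightarrow> \<phi> \<in> p \<or> Neg \<phi> \<in> p"
  by (simp add: types_def)

lemma typesI:
  assumes "\<And>\<phi>. \<phi> \<in> p \<Longrightarrow> \<phi> \<in> Fml L A V"
    and "\<And>\<phi>. \<phi> \<in> Fml L A V \<Longrightarrow> \<phi> \<in> p \<or> Neg \<phi> \<in> p"
    and "\<And>F. finite F \<Longrightarrow> F \<subseteq> p \<Longrightarrow> \<exists>s. range s \<subseteq> univ S \<and> (\<forall>\<phi>\<in>F. sat S s \<phi>)"
  shows "p \<in> types L S A V"
  using assms by (simp add: types_def subset_iff)

lemma types_Neg:
  assumes "p \<in> types L S A V" "\<phi> \<in> Fml L A V"
  shows "Neg \<phi> \<in> p \<longleftrightarrow> \<phi> \<notin> p"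
proof -
  have "\<not> (\<phi> \<in> p \<and> Neg \<phi> \<in> p)"
  proof
    assume "\<phi> \<in> p \<and> Neg \<phi> \<in> p"
    then show False using types_finsat[OF assms(1), of "{\<phi>, Neg \<phi>}"] by simp
  qed
  then show ?thesis using types_complete[OF assms] by blast
qed

lemma types_entails:
  assumes "p \<in> types L S A V" "finite F" "F \<subseteq> p" "\<psi> \<in> Fml L A V"
    and "\<And>s. range s \<subseteq> univ S \<Longrightarrow> \<forall>\<phi>\<in>F. sat S s \<phi> \<Longrightarrow> sat S s \<psi>"
  shows "\<psi> \<in> p"
proof (rule ccontr)
  assume "\<psi> \<notin> p"
  then have "insert (Neg \<psi>) F \<subseteq> p" using types_Neg assms by blast
  then obtain s where "range s \<subseteq> univ S" "\<forall>\<phi>\<in>insert (Neg \<psi>) F. sat S s \<phi>"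
    using types_finsat[OF assms(1), of "insert (Neg \<psi>) F"] assms(2) by blast
  then show False using assms(5)[of s] by simp
qed

lemma types_equiv:
  assumes "p \<in> types L S A V" "finite F" "F \<subseteq> p" "\<phi> \<in> Fml L A V" "\<psi> \<in> Fml L A V"
    and "\<And>s. range s \<subseteq> univ S \<Longrightarrow> \<forall>\<phi>\<in>F. sat S s \<phi> \<Longrightarrow> sat S s \<phi> = sat S s \<psi>"
  shows "\<phi> \<in> p \<longleftrightarrow> \<psi> \<in> p"
proof
  assume "\<phi> \<in> p"
  show "\<psi> \<in> p"
    by (rule types_entails[OF assms(1), of "insert \<phi> F"]) (use assms \<open>\<phi> \<in> p\<close> in auto)
next
  assume "\<psi> \<in> p"
  show "\<phi> \<in> p"
    by (rule types_entails[OF assms(1), of "insert \<psi> F"]) (use assms \<open>\<psi> \<in> p\<close> in auto)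
qed

lemma types_And:
  assumes "p \<in> types L S A V" "\<phi> \<in> Fml L A V" "\<psi> \<in> Fml L A V"
  shows "And \<phi> \<psi> \<in> p \<longleftrightarrow> \<phi> \<in> p \<and> \<psi> \<in> p"
proof -
  have "And \<phi> \<psi> \<in> p" if "\<phi> \<in> p" "\<psi> \<in> p"
    by (rule types_entails[OF assms(1), of "{\<phi>, \<psi>}"]) (use that assms in auto)
  moreover have "\<phi> \<in> p" "\<psi> \<in> p" if "And \<phi> \<psi> \<in> p"
    by (rule types_entails[OF assms(1), of "{And \<phi> \<psi>}"]; use that assms in force)+
  ultimately show ?thesis by blast
qed

lemma types_satisfiable: "p \<in> types L S A V \<Longrightarrow> \<phi> \<in> p \<Longrightarrow> satisfiable S \<phi>"
  using types_finsat[of p L S A V "{\<phi>}"] by (auto simp: satisfiable_def)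

lemma types_univ_nonempty: "p \<in> types L S A V \<Longrightarrow> univ S \<noteq> {}"
  using types_finsat[of p L S A V "{}"] by auto

lemma tp_in_types:
  assumes "univ S \<noteq> {}" "s ` V \<subseteq> univ S"
  shows "tp L S A V s \<in> types L S A V"
proof -
  have "\<exists>s. range s \<subseteq> univ S \<and> (\<forall>\<phi>\<in>F. sat S s \<phi>)" if "F \<subseteq> tp L S A V s" for F
  proof (intro exI conjI ballI)
    show "range (patch S s) \<subseteq> univ S" using assms(1) by (rule range_patch)
    fix \<phi> assume "\<phi> \<in> F"
    then have "fv \<phi> \<subseteq> V" "sat S s \<phi>" using that by (auto simp: tp_def Fml_def)
    moreover from this have "s ` fv \<phi> \<subseteq> univ S" using assms(2) by blast
    ultimately show "sat S (patch S s) \<phi>" by (simp add: sat_patch)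
  qed
  then show ?thesis by (intro typesI) (auto simp: tp_def)
qed

lemma types_restrict:
  assumes "p \<in> types L S A V" "W \<subseteq> V"
  shows "p \<inter> Fml L A W \<in> types L S A W"
proof -
  have "\<phi> \<in> p \<inter> Fml L A W \<or> Neg \<phi> \<in> p \<inter> Fml L A W" if "\<phi> \<in> Fml L A W" for \<phi>
    using that assms Fml_mono[OF that order_refl assms(2)] by (auto simp: types_Neg)
  moreover have "\<exists>s. range s \<subseteq> univ S \<and> (\<forall>\<phi>\<in>F. sat S s \<phi>)" if "finite F" "F \<subseteq> p \<inter> Fml L A W" for F
    using types_finsat[OF assms(1) that(1)] that(2) by (metis inf.boundedE)
  ultimately show ?thesis by (intro typesI) auto
qed

text \<open>A maximal finitely satisfiable set is complete. If neither \<phi> nor its negation could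
  be added, there would be finite unsatisfiable \<open>F\<close> and \<open>G\<close> witnessing
  this. Their parts inside \<open>p\<close> have a common solution, and that solution satisfies
  \<phi> or its negation, hence all of \<open>F\<close> or all of \<open>G\<close>.\<close>

lemma Lindenbaum:
  fixes \<Gamma> :: "('f, 'r, 'v, 'a) fml set"
  assumes "\<Gamma> \<subseteq> Fml L A V"
    and "\<And>F. finite F \<Longrightarrow> F \<subseteq> \<Gamma> \<Longrightarrow> \<exists>s. range s \<subseteq> univ S \<and> (\<forall>\<phi>\<in>F. sat S s \<phi>)"
  shows "\<exists>p\<in>types L S A V. \<Gamma> \<subseteq> p"
proof -
  define fs where "fs \<Delta> \<longleftrightarrow> (\<forall>F. finite F \<and> F \<subseteq> \<Delta> \<longrightarrow> (\<exists>s. range s \<subseteq> univ S \<and> (\<forall>\<phi>\<in>F. sat S s \<phi>)))"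
    for \<Delta> :: "('f, 'r, 'v, 'a) fml set"
  define Z where "Z = {\<Delta>. \<Gamma> \<subseteq> \<Delta> \<and> \<Delta> \<subseteq> Fml L A V \<and> fs \<Delta>}"
  have "\<exists>p\<in>Z. \<forall>q\<in>Z. p \<subseteq> q \<longrightarrow> q = p"
  proof (rule subset_Zorn_nonempty)
    show "Z \<noteq> {}" using assms by (auto simp: Z_def fs_def)
    fix \<C> assume C: "\<C> \<noteq> {}" "subset.chain Z \<C>"
    then have CZ: "\<C> \<subseteq> Z" by (simp add: subset.chain_def)
    have "fs (\<Union>\<C>)" unfolding fs_def
    proof safe
      fix F assume F: "finite F" "F \<subseteq> \<Union>\<C>"
      obtain D where "D \<in> \<C>" "F \<subseteq> D" using finite_subset_Union_chain[OF F C] by blast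
      then show "\<exists>s. range s \<subseteq> univ S \<and> (\<forall>\<phi>\<in>F. sat S s \<phi>)"
        using CZ F(1) by (auto simp: Z_def fs_def)
    qed
    then show "\<Union>\<C> \<in> Z" using C(1) CZ unfolding Z_def by blast
  qed
  then obtain p where p: "p \<in> Z" "\<And>q. q \<in> Z \<Longrightarrow> p \<subseteq> q \<Longrightarrow> q = p" by blast
  have "\<phi> \<in> p \<or> Neg \<phi> \<in> p" if \<phi>: "\<phi> \<in> Fml L A V" for \<phi>
  proof (rule ccontr)
    assume n: "\<not> (\<phi> \<in> p \<or> Neg \<phi> \<in> p)"
    have "insert \<phi> p \<notin> Z" "insert (Neg \<phi>) p \<notin> Z" using p(2) n by blast+
    then have "\<not> fs (insert \<phi> p)" "\<not> fs (insert (Neg \<phi>) p)" using p(1) \<phi> by (auto simp: Z_def)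
    then obtain F G where F: "finite F" "F \<subseteq> insert \<phi> p" "\<nexists>s. range s \<subseteq> univ S \<and> (\<forall>\<psi>\<in>F. sat S s \<psi>)"
      and G: "finite G" "G \<subseteq> insert (Neg \<phi>) p" "\<nexists>s. range s \<subseteq> univ S \<and> (\<forall>\<psi>\<in>G. sat S s \<psi>)"
      unfolding fs_def by auto
    have "finite ((F - {\<phi>}) \<union> (G - {Neg \<phi>}))" "(F - {\<phi>}) \<union> (G - {Neg \<phi>}) \<subseteq> p" using F G by auto
    moreover have "fs p" using p(1) by (simp add: Z_def)
    ultimately have "\<exists>s. range s \<subseteq> univ S \<and> (\<forall>\<psi>\<in>(F - {\<phi>}) \<union> (G - {Neg \<phi>}). sat S s \<psi>)"
      by (simp add: fs_def)
    then obtain s where s: "range s \<subseteq> univ S" "\<forall>\<psi>\<in>(F - {\<phi>}) \<union> (G - {Neg \<phi>}). sat S s \<psi>" by blast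
    show False
    proof (cases "sat S s \<phi>")
      case True
      then have "\<forall>\<psi>\<in>F. sat S s \<psi>" using s(2) by blast
      then show False using F(3) s(1) by blast
    next
      case False
      then have "\<forall>\<psi>\<in>G. sat S s \<psi>" using s(2) by (auto split: if_splits)
      then show False using G(3) s(1) by blast
    qed
  qed
  moreover have "p \<subseteq> Fml L A V" "fs p" using p(1) by (auto simp: Z_def)
  ultimately have "p \<in> types L S A V" unfolding fs_def by (intro typesI) blast+
  then show ?thesis using p(1) by (auto simp: Z_def)
qed

section \<open>Clopen sets and the topology of type spaces\<close>

lemma clopen_Neg: "\<phi> \<in> Fml L A V \<Longrightarrow> clopen L S A V (Neg \<phi>) = types L S A V - clopen L S A V \<phi>"
  by (auto simp: clopen_def types_Neg)

lemma clopen_And: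
  "\<phi> \<in> Fml L A V \<Longrightarrow> \<psi> \<in> Fml L A V \<Longrightarrow>
     clopen L S A V (And \<phi> \<psi>) = clopen L S A V \<phi> \<inter> clopen L S A V \<psi>"
  by (auto simp: clopen_def types_And)

lemma clopen_truth: "clopen L S A V truth = types L S A V"
proof -
  have "truth \<in> p" if "p \<in> types L S A V" for p
    by (rule types_entails[OF that, of "{}"]) (use types_univ_nonempty[OF that] in \<open>auto simp: sat_truth\<close>)
  then show ?thesis by (auto simp: clopen_def)
qed

lemma clopen_subset: "clopen L S A V \<phi> \<subseteq> types L S A V"
  by (auto simp: clopen_def)

lemma clopen_empty_iff:
  assumes "\<phi> \<in> Fml L A V"
  shows "clopen L S A V \<phi> = {} \<longleftrightarrow> \<not> satisfiable S \<phi>"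
proof
  assume e: "clopen L S A V \<phi> = {}"
  show "\<not> satisfiable S \<phi>"
  proof
    assume "satisfiable S \<phi>"
    then obtain s where s: "range s \<subseteq> univ S" "sat S s \<phi>" by (auto simp: satisfiable_def)
    then have "tp L S A V s \<in> clopen L S A V \<phi>"
      using assms tp_in_types[of S s V L A] by (auto simp: clopen_def tp_def)
    then show False using e by blast
  qed
qed (auto simp: clopen_def dest: types_satisfiable)

lemma clopen_eqI:
  assumes "\<phi> \<in> Fml L A V" "\<psi> \<in> Fml L A V" "\<And>s. range s \<subseteq> univ S \<Longrightarrow> sat S s \<phi> = sat S s \<psi>"
  shows "clopen L S A V \<phi> = clopen L S A V \<psi>"
  using types_equiv[of _ L S A V "{}" \<phi> \<psi>] assms by (auto simp: clopen_def)

lemma topspace_type_top [simp]: "topspace (type_top L S A V) = types L S A V"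
proof -
  have "types L S A V \<in> clopen L S A V ` Fml L A V"
    using clopen_truth truth_in_Fml by blast
  then show ?thesis using clopen_subset
    unfolding type_top_def topology_generated_by_topspace by blast
qed

lemma openin_type_top: "openin (type_top L S A V) U \<Longrightarrow> U \<subseteq> types L S A V"
  using openin_subset[of "type_top L S A V" U] by simp

text \<open>Compactness comes from \<open>Lindenbaum\<close>. Given a cover without finite subcover,
  the negations of all formulas whose clopen set lies in a member of the cover are finitely
  satisfiable. A type containing them lies in no member of the cover.\<close>

lemma clopen_base_types: "clopen_base (type_top L S A V) (clopen L S A V ` Fml L A V)"
proof (rule clopen_base.intro)
  let ?B = "clopen L S A V ` Fml L A V"
  have alg: "?B \<subseteq> Pow (types L S A V) \<and> {} \<in> ?B \<and> (\<forall>a\<in>?B. types L S A V - a \<in> ?B) \<and>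
      (\<forall>a\<in>?B. \<forall>b\<in>?B. a \<inter> b \<in> ?B)"
  proof (intro conjI ballI)
    show "?B \<subseteq> Pow (types L S A V)" using clopen_subset[of L S A V] by auto
    have "clopen L S A V (Neg truth) = {}" by (simp add: clopen_Neg clopen_truth)
    then show "{} \<in> ?B" by (metis Neg_in_Fml image_eqI truth_in_Fml)
    show "types L S A V - a \<in> ?B" if "a \<in> ?B" for a
      using that by (auto simp: clopen_Neg[symmetric])
    show "a \<inter> b \<in> ?B" if "a \<in> ?B" "b \<in> ?B" for a b
      using that by (auto simp: clopen_And[symmetric])
  qed
  then show "algebra (topspace (type_top L S A V)) ?B" by (simp add: algebra_iff_Int)
  show base: "openin (type_top L S A V) U \<longleftrightarrow>
      U \<subseteq> topspace (type_top L S A V) \<and> (\<forall>x\<in>U. \<exists>b\<in>?B. x \<in> b \<and> b \<subseteq> U)" for U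
  proof
    assume U: "openin (type_top L S A V) U"
    then have "generate_topology_on ?B U" by (simp add: type_top_def openin_topology_generated_by_iff)
    then have "\<forall>x\<in>U. \<exists>b\<in>?B. x \<in> b \<and> b \<subseteq> U"
    proof (induction)
      case (Int a b)
      show ?case
      proof
        fix x assume "x \<in> a \<inter> b"
        then obtain c d where "c \<in> ?B" "x \<in> c" "c \<subseteq> a" "d \<in> ?B" "x \<in> d" "d \<subseteq> b"
          using Int.IH by (meson IntD1 IntD2)
        moreover from this have "c \<inter> d \<in> ?B" using alg by blast
        ultimately show "\<exists>e\<in>?B. x \<in> e \<and> e \<subseteq> a \<inter> b" by (intro bexI[of _ "c \<inter> d"]) auto
      qed
    next
      case (UN K)
      show ?case
      proof
        fix x assume "x \<in> \<Union>K"
        then obtain k where "k \<in> K" "x \<in> k" by blast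
        moreover from this obtain b where "b \<in> ?B" "x \<in> b" "b \<subseteq> k" using UN.IH by meson
        ultimately show "\<exists>b\<in>?B. x \<in> b \<and> b \<subseteq> \<Union>K" by (intro bexI[of _ b]) auto
      qed
    next
      case (Basis s)
      then show ?case by (intro ballI bexI[of _ s]) auto
    qed auto
    then show "U \<subseteq> topspace (type_top L S A V) \<and> (\<forall>x\<in>U. \<exists>b\<in>?B. x \<in> b \<and> b \<subseteq> U)"
      using openin_subset[OF U] by blast
  next
    assume U: "U \<subseteq> topspace (type_top L S A V) \<and> (\<forall>x\<in>U. \<exists>b\<in>?B. x \<in> b \<and> b \<subseteq> U)"
    have "openin (type_top L S A V) (\<Union>{b\<in>?B. b \<subseteq> U})"
      by (rule openin_Union) (auto simp: type_top_def intro: topology_generated_by_Basis)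
    moreover have "\<Union>{b\<in>?B. b \<subseteq> U} = U"
    proof (rule equalityI)
      show "U \<subseteq> \<Union>{b\<in>?B. b \<subseteq> U}"
      proof
        fix x assume "x \<in> U"
        then obtain b where "b \<in> ?B" "x \<in> b" "b \<subseteq> U" using U by meson
        then show "x \<in> \<Union>{b\<in>?B. b \<subseteq> U}" by (intro UnionI[of b]) simp_all
      qed
    qed blast
    ultimately show "openin (type_top L S A V) U" by simp
  qed
  show "compact_space (type_top L S A V)"
    unfolding compact_space_alt topspace_type_top
  proof safe
    fix \<U> assume op: "\<forall>U\<in>\<U>. openin (type_top L S A V) U" and cov: "types L S A V \<subseteq> \<Union>\<U>"
    show "\<exists>\<F>. finite \<F> \<and> \<F> \<subseteq> \<U> \<and> types L S A V \<subseteq> \<Union>\<F>"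
    proof (rule ccontr)
      assume no: "\<not> ?thesis"
      define \<Gamma> where "\<Gamma> = {Neg \<phi> |\<phi>. \<phi> \<in> Fml L A V \<and> (\<exists>U\<in>\<U>. clopen L S A V \<phi> \<subseteq> U)}"
      have "\<exists>s. range s \<subseteq> univ S \<and> (\<forall>\<phi>\<in>F. sat S s \<phi>)" if F: "finite F" "F \<subseteq> \<Gamma>" for F
      proof -
        have "\<forall>\<psi>\<in>F. \<exists>U\<in>\<U>. types L S A V - U \<subseteq> clopen L S A V \<psi>"
        proof
          fix \<psi> assume "\<psi> \<in> F"
          then obtain \<phi> U where "\<psi> = Neg \<phi>" "\<phi> \<in> Fml L A V" "U \<in> \<U>" "clopen L S A V \<phi> \<subseteq> U"
            using F(2) unfolding \<Gamma>_def by blast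
          then show "\<exists>U\<in>\<U>. types L S A V - U \<subseteq> clopen L S A V \<psi>"
            by (intro bexI[of _ U]) (auto simp: clopen_Neg)
        qed
        then obtain u where u: "\<And>\<psi>. \<psi> \<in> F \<Longrightarrow> u \<psi> \<in> \<U>"
          "\<And>\<psi>. \<psi> \<in> F \<Longrightarrow> types L S A V - u \<psi> \<subseteq> clopen L S A V \<psi>" by metis
        have "finite (u ` F)" "u ` F \<subseteq> \<U>" using F u by auto
        then have "\<not> types L S A V \<subseteq> \<Union>(u ` F)" using no by blast
        then obtain p where p: "p \<in> types L S A V" "p \<notin> \<Union>(u ` F)" by blast
        then have "F \<subseteq> p" using u(2) by (auto simp: clopen_def)
        then show ?thesis using types_finsat[OF p(1) F(1)] by metis
      qed
      moreover have "\<Gamma> \<subseteq> Fml L A V" by (auto simp: \<Gamma>_def)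
      ultimately obtain p where p: "p \<in> types L S A V" "\<Gamma> \<subseteq> p" using Lindenbaum[of \<Gamma> L A V S] by metis
      then obtain U where U: "U \<in> \<U>" "p \<in> U" using cov by blast
      then obtain b where b: "b \<in> ?B" "p \<in> b" "b \<subseteq> U" using op base[of U] by meson
      then obtain \<phi> where \<phi>: "\<phi> \<in> Fml L A V" "b = clopen L S A V \<phi>" by blast
      then have "Neg \<phi> \<in> p" using p(2) U(1) b(3) by (auto simp: \<Gamma>_def)
      moreover have "\<phi> \<in> p" using b(2) \<phi>(2) by (simp add: clopen_def)
      ultimately show False using types_Neg[OF p(1) \<phi>(1)] by blast
    qed
  qed
qed

lemma sets_type_borel:
  "sets (type_borel L S A V) = sigma_sets (topspace (type_top L S A V)) {U. openin (type_top L S A V) U}"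
  unfolding type_borel_def topspace_type_top
  by (rule sets_measure_of) (use openin_type_top in blast)

lemma space_type_borel: "space (type_borel L S A V) = types L S A V"
  unfolding type_borel_def by (rule space_measure_of) (use openin_type_top in blast)

lemma clopen_in_type_borel: "\<phi> \<in> Fml L A V \<Longrightarrow> clopen L S A V \<phi> \<in> sets (type_borel L S A V)"
  using clopen_base.base_in_borel[OF clopen_base_types, of "clopen L S A V \<phi>" L S A V] by (simp add: sets_type_borel)

lemma keisler_iff: "keisler L S A V \<mu> \<longleftrightarrow> regular_prob (type_top L S A V) \<mu>"
  by (simp add: keisler_def regular_prob_def sets_type_borel)

lemma elem_sub_types:
  assumes "elem_sub L S S'" "A \<subseteq> univ S" "p \<in> types L S A V"
  shows "p \<in> types L S' A V"
proof -
  have sub: "univ S \<subseteq> univ S'" using assms(1) by (simp add: elem_sub_def)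
  have "\<exists>s. range s \<subseteq> univ S' \<and> (\<forall>\<phi>\<in>F. sat S' s \<phi>)" if F: "finite F" "F \<subseteq> p" for F
  proof -
    obtain s where s: "range s \<subseteq> univ S" "\<And>\<phi>. \<phi> \<in> F \<Longrightarrow> sat S s \<phi>"
      using types_finsat[OF assms(3) F] by metis
    have "sat S' s \<phi>" if "\<phi> \<in> F" for \<phi>
    proof -
      have "\<phi> \<in> Fml L (univ S) V" using types_Fml[OF assms(3)] F(2) that assms(2) Fml_mono by blast
      then show ?thesis using elem_sub_sat[OF assms(1)] s that by blast
    qed
    then show ?thesis using s(1) sub by blast
  qed
  then show ?thesis using types_Fml[OF assms(3)] types_complete[OF assms(3)] by (intro typesI) auto
qed

text \<open>The tuple may lie outside \<open>S\<close>. Still, any finite part of its type over A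
  \<subseteq> \<open>S\<close> is expressed by one formula over \<open>S\<close>, and elementarity
  brings a solution down to \<open>S\<close>.\<close>

lemma tp_elem_sub_in_types:
  assumes "elem_sub L S S'" "A \<subseteq> univ S" "s ` V \<subseteq> univ S'"
  shows "tp L S' A V s \<in> types L S A V"
proof -
  have ne: "univ S \<noteq> {}" "univ S' \<noteq> {}" using assms(1) by (auto simp: elem_sub_def structure_on_def)
  have p: "tp L S' A V s \<in> types L S' A V" by (rule tp_in_types[OF ne(2) assms(3)])
  have "\<exists>s. range s \<subseteq> univ S \<and> (\<forall>\<phi>\<in>F. sat S s \<phi>)" if F: "finite F" "F \<subseteq> tp L S' A V s" for F
  proof -
    have FF: "F \<subseteq> Fml L (univ S) V" using F(2) assms(2) by (auto simp: tp_def intro: Fml_mono)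
    then obtain \<phi> where \<phi>: "\<phi> \<in> Fml L (univ S) V"
      "\<And>X s. univ X \<noteq> {} \<Longrightarrow> sat X s \<phi> = (\<forall>\<psi>\<in>F. sat X s \<psi>)"
      using finite_conjunction[OF F(1)] by blast
    obtain s' where "range s' \<subseteq> univ S'" "\<And>\<phi>. \<phi> \<in> F \<Longrightarrow> sat S' s' \<phi>" using types_finsat[OF p F] by metis
    then have "satisfiable S' \<phi>" using \<phi>(2)[OF ne(2)] by (auto simp: satisfiable_def)
    then have "satisfiable S \<phi>" by (rule elem_sub_satisfiable[OF assms(1) \<phi>(1)])
    then show ?thesis using \<phi>(2)[OF ne(1)] by (auto simp: satisfiable_def)
  qed
  then show ?thesis using types_Fml[OF p] types_complete[OF p] by (intro typesI) auto
qed

section \<open>Realizing types in many variables\<close>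

lemma infinite_Field: "Card_order \<kappa> \<Longrightarrow> natLeq <o \<kappa> \<Longrightarrow> infinite (Field \<kappa>)"
  using cinfinite_mono[OF ordLess_imp_ordLeq natLeq_cinfinite] by (auto simp: cinfinite_def)

text \<open>A maximal partial realization, given by its graph \<open>R\<close>, is total: the type of one further
  variable over the parameters and the values used so far is a type in a single variable over a
  small set.\<close>

lemma realize_type:
  fixes p :: "('f, 'r, 'v, 'a) fml set"
  assumes sat: "saturated L \<kappa> S" and \<kappa>: "Card_order \<kappa>" "natLeq <o \<kappa>"
    and inf: "infinite (UNIV :: 'v set)"
    and p: "p \<in> types L S A V" and A: "A \<subseteq> univ S" "|A| <o \<kappa>" and V: "|V| <o \<kappa>"
  obtains s where "range s \<subseteq> univ S" "tp L S A V s = p"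
proof -
  obtain d where d: "d \<in> univ S" using types_univ_nonempty[OF p] by blast
  \<comment> \<open>A formula of \<open>p\<close> is tested only once all its free variables have
    received values. The empty relation therefore has to satisfy just the sentences of
    \<open>p\<close>.\<close>
  define ok where "ok R \<longleftrightarrow> R \<subseteq> V \<times> univ S \<and> single_valued R \<and>
      (\<forall>\<theta>\<in>p. \<forall>s. (\<forall>v\<in>fv \<theta>. (v, s v) \<in> R) \<longrightarrow> sat S s \<theta>)" for R
  have ne: "{R. ok R} \<noteq> {}"
  proof -
    have "sat S s \<theta>" if \<theta>: "\<theta> \<in> p" "fv \<theta> = {}" for s \<theta>
    proof -
      obtain s' where "sat S s' \<theta>" using types_satisfiable[OF p \<theta>(1)] by (auto simp: satisfiable_def)
      then show ?thesis using sat_cong[of \<theta> s s' S] \<theta>(2) by simp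
    qed
    then have "ok {}" by (auto simp: ok_def)
    then show ?thesis by blast
  qed
  have "\<exists>R\<in>{R. ok R}. \<forall>Q\<in>{R. ok R}. R \<subseteq> Q \<longrightarrow> Q = R"
  proof (rule subset_Zorn_nonempty[OF ne])
    fix \<C> assume C: "\<C> \<noteq> {}" "subset.chain {R. ok R} \<C>"
    then have CO: "\<And>R. R \<in> \<C> \<Longrightarrow> ok R" by (auto simp: subset.chain_def)
    have "\<Union>\<C> \<subseteq> V \<times> univ S" using CO unfolding ok_def by blast
    moreover have "single_valued (\<Union>\<C>)"
    proof (rule single_valuedI)
      fix x y z assume "(x, y) \<in> \<Union>\<C>" "(x, z) \<in> \<Union>\<C>"
      then have "finite {(x, y), (x, z)}" "{(x, y), (x, z)} \<subseteq> \<Union>\<C>" by auto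
      then obtain R where "R \<in> \<C>" "{(x, y), (x, z)} \<subseteq> R"
        using finite_subset_Union_chain[OF _ _ C] by metis
      then show "y = z" using CO[of R] by (auto simp: ok_def single_valued_def)
    qed
    moreover have "sat S s \<theta>" if \<theta>: "\<theta> \<in> p" "\<forall>v\<in>fv \<theta>. (v, s v) \<in> \<Union>\<C>" for \<theta> s
    proof -
      have "finite ((\<lambda>v. (v, s v)) ` fv \<theta>)" "(\<lambda>v. (v, s v)) ` fv \<theta> \<subseteq> \<Union>\<C>" using \<theta>(2) by auto
      then obtain R where "R \<in> \<C>" "(\<lambda>v. (v, s v)) ` fv \<theta> \<subseteq> R"
        using finite_subset_Union_chain[OF _ _ C] by metis
      then show ?thesis using CO[of R] \<theta>(1) unfolding ok_def by blast
    qed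
    ultimately show "\<Union>\<C> \<in> {R. ok R}" unfolding ok_def by blast
  qed
  then obtain R where R: "ok R" and max: "\<And>Q. ok Q \<Longrightarrow> R \<subseteq> Q \<Longrightarrow> Q = R" by blast
  then have RV: "R \<subseteq> V \<times> univ S" and sv: "single_valued R"
    and Rsat: "\<And>\<theta> s. \<theta> \<in> p \<Longrightarrow> (\<And>v. v \<in> fv \<theta> \<Longrightarrow> (v, s v) \<in> R) \<Longrightarrow> sat S s \<theta>"
    unfolding ok_def by blast+
  define r where "r v = (if v \<in> Domain R then THE a. (v, a) \<in> R else d)" for v
  have r: "r v = a" if "(v, a) \<in> R" for v a
  proof -
    have "(THE a. (v, a) \<in> R) = a" using that sv by (intro the_equality) (auto dest: single_valuedD)
    then show ?thesis using that by (auto simp: r_def)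
  qed
  have rR: "(v, r v) \<in> R" if "v \<in> Domain R" for v using that r by auto
  have ru: "range r \<subseteq> univ S" using rR RV d by (auto simp: r_def)
  have "Domain R = V"
  proof (rule ccontr)
    assume "Domain R \<noteq> V"
    then obtain v where v: "v \<in> V" "v \<notin> Domain R" using RV by blast
    define D where "D = A \<union> Range R"
    have DS: "D \<subseteq> univ S" using A RV by (auto simp: D_def)
    have "|Range R| <o \<kappa>"
    proof -
      have "Range R \<subseteq> r ` Domain R" using r by force
      then have "|Range R| \<le>o |r ` Domain R|" by (rule card_of_mono1)
      moreover have "|r ` Domain R| \<le>o |Domain R|" by (rule card_of_image)
      moreover have "|Domain R| \<le>o |V|" using RV by (intro card_of_mono1) auto
      ultimately show ?thesis using V by (meson ordLeq_ordLess_trans ordLeq_transitive)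
    qed
    then have Dc: "|D| <o \<kappa>" unfolding D_def
      by (rule card_of_Un_ordLess_infinite_Field[OF infinite_Field[OF \<kappa>] \<kappa>(1) A(2)])
    define u where "u a = (SOME w. (w, a) \<in> R)" for a
    have u: "(u a, a) \<in> R" if "a \<in> Range R" for a
      using that unfolding u_def by (auto intro: someI)
    \<comment> \<open>Parameters of \<open>D\<close> outside \<open>A\<close> are values of
      \<open>R\<close>. Replacing each by a variable that takes this value turns an
      \<open>L(D)\<close>-formula in one variable into an \<open>L(A)\<close>-formula in
      \<open>V\<close>, so that \<open>p\<close> can decide it.\<close>
    define c :: "'a \<Rightarrow> ('f, 'v, 'a) trm" where "c a = (if a \<in> A then Par a else Var (u a))" for a
    define t :: "('f, 'r, nat, 'a) fml \<Rightarrow> ('f, 'r, 'v, 'a) fml" where "t = subst_fml (\<lambda>_. Var v) c"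
    have tF: "t \<psi> \<in> Fml L A V" "fv (t \<psi>) \<subseteq> insert v (Domain R)" if "\<psi> \<in> Fml L D {0}" for \<psi>
    proof -
      have ua: "u a \<in> Domain R \<inter> V" if "a \<in> D" "a \<notin> A" for a
        using u[of a] that RV by (auto simp: D_def)
      have "t \<psi> \<in> Fml L A V" unfolding t_def
        by (rule subst_fml_in_Fml[OF that]) (use v ua in \<open>auto simp: c_def\<close>)
      moreover have "t \<psi> \<in> Fml L A (insert v (Domain R))" unfolding t_def
        by (rule subst_fml_in_Fml[OF that]) (use v ua in \<open>auto simp: c_def\<close>)
      ultimately show "t \<psi> \<in> Fml L A V" "fv (t \<psi>) \<subseteq> insert v (Domain R)" by (auto simp: Fml_def)
    qed
    have tsat: "sat S (r(v := a)) (t \<psi>) = sat S (\<lambda>_. a) \<psi>" if "\<psi> \<in> Fml L D {0}" for a \<psi>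
    proof -
      have "pmap (\<lambda>b. eval S (r(v := a)) (c b)) \<psi> = \<psi>"
      proof (rule pmap_idI)
        fix b assume "b \<in> params \<psi>"
        then have "b \<in> D" using that by (auto simp: Fml_def)
        then show "eval S (r(v := a)) (c b) = b"
          using u[of b] r v(2) by (auto simp: c_def D_def)
      qed
      then show ?thesis by (simp add: t_def sat_subst[OF inf])
    qed
    \<comment> \<open>The conjunction of \<open>F\<close>, quantified over \<open>v\<close>, is in
      \<open>p\<close> and has its free variables in the domain of \<open>R\<close>. It is therefore
      already true at \<open>r\<close>, and its witness is the required element.\<close>
    have ext: "\<exists>a\<in>univ S. \<forall>\<theta>\<in>F. sat S (r(v := a)) \<theta>"
      if F: "finite F" "F \<subseteq> p" "\<And>\<theta>. \<theta> \<in> F \<Longrightarrow> fv \<theta> \<subseteq> insert v (Domain R)" for F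
    proof -
      have "F \<subseteq> Fml L A (V \<inter> insert v (Domain R))"
      proof
        fix \<theta> assume "\<theta> \<in> F"
        then have "\<theta> \<in> Fml L A V" "fv \<theta> \<subseteq> insert v (Domain R)" using F types_Fml[OF p] by auto
        then show "\<theta> \<in> Fml L A (V \<inter> insert v (Domain R))" by (auto simp: Fml_def)
      qed
      then obtain \<theta> where \<theta>: "\<theta> \<in> Fml L A (V \<inter> insert v (Domain R))"
        "\<And>X s. univ X \<noteq> {} \<Longrightarrow> sat X s \<theta> = (\<forall>\<psi>\<in>F. sat X s \<psi>)"
        using finite_conjunction[OF F(1)] by blast
      note \<theta>S = \<theta>(2)[OF types_univ_nonempty[OF p]]
      have "Exists v \<theta> \<in> p"
      proof (rule types_entails[OF p F(1,2)])
        show "Exists v \<theta> \<in> Fml L A V" using \<theta>(1) by (auto simp: Fml_def)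
        fix s assume "range s \<subseteq> univ S" "\<forall>\<phi>\<in>F. sat S s \<phi>"
        then show "sat S s (Exists v \<theta>)" using \<theta>S by (auto intro!: bexI[of _ "s v"])
      qed
      moreover have "fv (Exists v \<theta>) \<subseteq> Domain R" using \<theta>(1) by (auto simp: Fml_def)
      ultimately have "sat S r (Exists v \<theta>)" using rR by (intro Rsat) blast+
      then show ?thesis using \<theta>S by auto
    qed
    define q where "q = {\<psi> \<in> Fml L D {0}. t \<psi> \<in> p}"
    have "q \<in> types L S D {0}"
    proof -
      have "\<psi> \<in> q \<or> Neg \<psi> \<in> q" if \<psi>: "\<psi> \<in> Fml L D {0}" for \<psi>
      proof -
        have "t (Neg \<psi>) = Neg (t \<psi>)" by (simp add: t_def)
        then show ?thesis using \<psi> types_Neg[OF p tF(1)[OF \<psi>]] by (auto simp: q_def)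
      qed
      moreover have "\<exists>s. range s \<subseteq> univ S \<and> (\<forall>\<psi>\<in>F. sat S s \<psi>)" if F: "finite F" "F \<subseteq> q" for F
      proof -
        have "\<exists>a\<in>univ S. \<forall>\<theta>\<in>t ` F. sat S (r(v := a)) \<theta>"
          using F tF(2) by (intro ext) (auto simp: q_def)
        then obtain a where "a \<in> univ S" "\<forall>\<psi>\<in>F. sat S (r(v := a)) (t \<psi>)" by blast
        then show ?thesis using tsat F(2) by (intro exI[of _ "\<lambda>_. a"]) (auto simp: q_def)
      qed
      ultimately show ?thesis by (intro typesI) (auto simp: q_def)
    qed
    then obtain s0 :: "nat \<Rightarrow> 'a" where s0: "range s0 \<subseteq> univ S" "tp L S D {0} s0 = q"
      using sat DS Dc unfolding saturated_def by (metis finite.emptyI finite.insertI)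
    define Q where "Q = insert (v, s0 0) R"
    have "ok Q" unfolding ok_def
    proof (intro conjI ballI allI impI)
      show "Q \<subseteq> V \<times> univ S" using RV v s0(1) by (auto simp: Q_def)
      show "single_valued Q" using sv v(2) by (auto simp: Q_def single_valued_def)
      fix \<theta> s assume \<theta>: "\<theta> \<in> p" and s: "\<forall>w\<in>fv \<theta>. (w, s w) \<in> Q"
      have sw: "s w = (r(v := s0 0)) w \<and> (w = v \<or> (w, s w) \<in> R)" if "w \<in> fv \<theta>" for w
        using s that r v(2) by (auto simp: Q_def)
      have rw: "r w \<in> A \<union> Range R" if "w \<in> fv \<theta>" "w \<noteq> v" for w
      proof -
        have "(w, r w) \<in> R" using sw[OF that(1)] that(2) by (metis fun_upd_other)
        then show ?thesis by blast
      qed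
      \<comment> \<open>The translation back: variables in the domain of \<open>R\<close> become
        parameters naming their values, and \<open>v\<close> becomes the single variable 0.\<close>
      define e :: "'v \<Rightarrow> ('f, nat, 'a) trm" where "e w = (if w = v then Var 0 else Par (r w))" for w
      define \<psi> where "\<psi> = subst_fml e Par \<theta>"
      have \<theta>F: "\<theta> \<in> Fml L A (fv \<theta>)" using types_Fml[OF p \<theta>] by (simp add: Fml_def)
      have \<psi>F: "\<psi> \<in> Fml L D {0}" unfolding \<psi>_def
        by (rule subst_fml_in_Fml[OF \<theta>F]) (use rw in \<open>auto simp: e_def D_def split: if_splits\<close>)
      have \<psi>sat: "sat S x \<psi> = sat S (r(v := x 0)) \<theta>" for x
        unfolding \<psi>_def by (subst sat_subst) (auto simp: fml.map_ident e_def intro!: sat_cong)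
      \<comment> \<open>\<open>t \<psi>\<close> may name a value of \<open>R\<close> by another
        variable than \<theta> does, so the two formulas need not be equivalent. They agree at every
        \<open>r(v := a)\<close>, however, and by \<open>ext\<close> this prevents \<open>p\<close>
        from containing \<theta> and the negation of \<open>t \<psi>\<close>.\<close>
      have "t \<psi> \<in> p"
      proof (rule ccontr)
        assume "t \<psi> \<notin> p"
        then have "Neg (t \<psi>) \<in> p" using types_Neg[OF p tF(1)[OF \<psi>F]] by blast
        then have "\<exists>a\<in>univ S. \<forall>\<theta>\<in>{\<theta>, Neg (t \<psi>)}. sat S (r(v := a)) \<theta>"
          using \<theta> tF(2)[OF \<psi>F] sw by (intro ext) auto
        then show False using tsat[OF \<psi>F] \<psi>sat by auto
      qed
      then have "\<psi> \<in> q" using \<psi>F by (simp add: q_def)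
      then have "sat S s0 \<psi>" using s0(2) by (auto simp: tp_def)
      then have "sat S (r(v := s0 0)) \<theta>" using \<psi>sat by simp
      then show "sat S s \<theta>" using sat_cong[of \<theta> s "r(v := s0 0)" S] sw by blast
    qed
    moreover have "R \<subseteq> Q" by (auto simp: Q_def)
    ultimately have "Q = R" by (rule max)
    then show False using v(2) by (auto simp: Q_def)
  qed
  then have "sat S r \<theta>" if "\<theta> \<in> p" for \<theta>
  proof -
    have "fv \<theta> \<subseteq> Domain R" using types_Fml[OF p that] \<open>Domain R = V\<close> by (simp add: Fml_def)
    then show ?thesis using rR that by (intro Rsat) blast+
  qed
  then have "tp L S A V r = p"
    using p types_Neg[OF p] types_Fml[OF p] by (fastforce simp: tp_def)
  then show ?thesis using that ru by blast
qed

section \<open>Types of automorphic images of the enumeration\<close>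

lemma infinite_var: "infinite (UNIV :: 'i var set)"
proof -
  have "inj (Zv :: nat \<Rightarrow> 'i var)" by (auto simp: inj_def)
  then show ?thesis by (metis finite_imageD finite_subset infinite_UNIV_nat subset_UNIV)
qed

lemmas sat_subst_var = sat_subst[OF infinite_var] and sat_subst_pmap_var = sat_subst_pmap[OF infinite_var]

locale monster_pair =
  fixes L :: "('f, 'r) language" and \<CC> \<CC>' M :: "('f, 'r, 'a) struct"
    and \<kappa> :: "'k rel" and \<kappa>' :: "'l rel" and m :: "'i \<Rightarrow> 'a"
  assumes monster: "monster L \<kappa> \<CC>" and monster': "monster L \<kappa>' \<CC>'"
    and elem': "elem_sub L \<CC> \<CC>'" and small': "|univ \<CC>| <o \<kappa>'"
    and elem: "elem_sub L M \<CC>" and small: "|univ M| <o \<kappa>"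
    and m: "range m = univ M" and small_i: "|UNIV :: 'i set| <o \<kappa>"
begin

lemma M_sub: "univ M \<subseteq> univ \<CC>" using elem by (simp add: elem_sub_def)
lemma C_sub: "univ \<CC> \<subseteq> univ \<CC>'" using elem' by (simp add: elem_sub_def)
lemma C_nonempty: "univ \<CC> \<noteq> {}" using elem' by (simp add: elem_sub_def structure_on_def)
lemma structure': "structure_on L \<CC>'" using elem' by (simp add: elem_sub_def)
lemma m_in: "m i \<in> univ M" using m by auto
lemma m_in_C: "m i \<in> univ \<CC>" using m_in M_sub by blast

text \<open>The enumeration may repeat elements. One coordinate is selected for each element of
  \<open>M\<close>, and its \<open>y\<close>-variable serves as a name for that element.\<close>

definition idx :: "'a \<Rightarrow> 'i" where "idx = inv m"

lemma m_idx: "a \<in> univ M \<Longrightarrow> m (idx a) = a"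
  using m by (simp add: idx_def f_inv_into_f)

abbreviation "S\<^sub>m \<equiv> types_m L \<CC> m"

lemma Sm_types: "p \<in> S\<^sub>m \<Longrightarrow> p \<in> types L \<CC> (univ \<CC>) Ys"
  by (simp add: types_m_def)

text \<open>The type of \<open>m\<close> over the empty set is complete, so containing it decides
  every parameter-free formula in \<open>y\<close>.\<close>

lemma Sm_tp:
  assumes "p \<in> S\<^sub>m" "\<phi> \<in> Fml L {} Ys"
  shows "\<phi> \<in> p \<longleftrightarrow> sat \<CC> (asg m) \<phi>"
proof -
  have "\<phi> \<in> Fml L (univ \<CC>) Ys" using assms(2) by (rule Fml_mono) auto
  moreover have "tp L \<CC> {} Ys (asg m) \<subseteq> p" using assms(1) by (simp add: types_m_def)
  moreover have "\<phi> \<in> tp L \<CC> {} Ys (asg m) \<or> Neg \<phi> \<in> tp L \<CC> {} Ys (asg m)" "\<phi> \<in> tp L \<CC> {} Ys (asg m) \<longleftrightarrow> sat \<CC> (asg m) \<phi>"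
    using assms(2) by (auto simp: tp_def)
  ultimately show ?thesis using types_Neg[OF Sm_types[OF assms(1)], of \<phi>] by blast
qed

text \<open>Only one coordinate for every element of \<open>M\<close> has to be realized, and there are fewer
  than \<open>\<kappa>'\<close> of these even if the index type has many elements.\<close>

lemma Sm_realized:
  assumes p: "p \<in> S\<^sub>m"
  shows "\<exists>\<sigma>\<in>aut L \<CC>'. p = tp L \<CC>' (univ \<CC>) Ys (asg (\<sigma> \<circ> m))"
proof -
  have pt: "p \<in> types L \<CC> (univ \<CC>) Ys" by (rule Sm_types[OF p])
  define W :: "'i var set" where "W = (\<lambda>a. Yv (idx a)) ` univ M"
  have M_small': "|univ M| <o \<kappa>'"
    using card_of_mono1[OF M_sub] small' by (rule ordLeq_ordLess_trans)
  have W_small: "|W| <o \<kappa>'"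
    unfolding W_def using card_of_image M_small' by (rule ordLeq_ordLess_trans)
  have "p \<inter> Fml L (univ \<CC>) W \<in> types L \<CC>' (univ \<CC>) W"
    by (rule elem_sub_types[OF elem' order_refl types_restrict[OF pt]]) (auto simp: W_def)
  moreover have "saturated L \<kappa>' \<CC>'" "Card_order \<kappa>'" "natLeq <o \<kappa>'" using monster' by (auto simp: monster_def)
  ultimately obtain n :: "'i var \<Rightarrow> 'a" where n: "range n \<subseteq> univ \<CC>'" "tp L \<CC>' (univ \<CC>) W n = p \<inter> Fml L (univ \<CC>) W"
    using realize_type[of L \<kappa>' \<CC>' "p \<inter> Fml L (univ \<CC>) W" "univ \<CC>" W] infinite_var C_sub small' W_small by metis
  define g where "g a = n (Yv (idx a))" for a
  have key: "\<phi> \<in> p \<longleftrightarrow> sat \<CC>' (asg (g \<circ> m)) \<phi>" if \<phi>: "\<phi> \<in> Fml L (univ \<CC>) Ys" for \<phi>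
  proof -
    define e :: "'i var \<Rightarrow> ('f, 'i var, 'a) trm" where
      "e v = (case v of Yv i \<Rightarrow> Var (Yv (idx (m i))) | _ \<Rightarrow> Var v)" for v
    define \<phi>' where "\<phi>' = subst_fml e Par \<phi>"
    have \<phi>': "\<phi>' \<in> Fml L (univ \<CC>) W" unfolding \<phi>'_def
      by (rule subst_fml_in_Fml[OF \<phi>]) (auto simp: e_def W_def m_in split: var.splits)
    \<comment> \<open>Equations between each \<open>y\<close>-variable and the representative
      variable of the same element of \<open>M\<close>. They are true of \<open>m\<close>, hence
      belong to \<open>p\<close>, and modulo them \<phi> and its version in the variables
      \<open>W\<close> are equivalent.\<close>
    define E :: "('f, 'r, 'i var, 'a) fml set" where
      "E = (\<lambda>v. Eq (Var v) (e v)) ` fv \<phi>"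
    have "E \<subseteq> p"
    proof
      fix \<psi> assume "\<psi> \<in> E"
      then obtain i where "\<psi> = Eq (Var (Yv i)) (Var (Yv (idx (m i))))"
        using \<phi> by (auto simp: E_def Fml_def e_def)
      then show "\<psi> \<in> p" using Sm_tp[OF p, of \<psi>] by (auto simp: Fml_def m_idx m_in)
    qed
    then have "\<phi> \<in> p \<longleftrightarrow> \<phi>' \<in> p"
    proof (rule types_equiv[OF pt, rotated])
      show "finite E" by (simp add: E_def)
      show "\<phi> \<in> Fml L (univ \<CC>) Ys" by (rule \<phi>)
      show "\<phi>' \<in> Fml L (univ \<CC>) Ys" using \<phi>' by (rule Fml_mono) (auto simp: W_def)
      fix s assume "\<forall>\<psi>\<in>E. sat \<CC> s \<psi>"
      then have "eval \<CC> s (e v) = s v" if "v \<in> fv \<phi>" for v using that by (auto simp: E_def)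
      then show "sat \<CC> s \<phi> = sat \<CC> s \<phi>'"
        by (auto simp: \<phi>'_def sat_subst_var fml.map_ident intro!: sat_cong)
    qed
    also have "\<phi>' \<in> p \<longleftrightarrow> \<phi>' \<in> tp L \<CC>' (univ \<CC>) W n" using \<phi>' by (simp add: n(2))
    also have "\<dots> \<longleftrightarrow> sat \<CC>' n \<phi>'" using \<phi>' by (simp add: tp_def)
    also have "\<dots> \<longleftrightarrow> sat \<CC>' (\<lambda>v. eval \<CC>' n (e v)) \<phi>"
      by (simp add: \<phi>'_def sat_subst_var fml.map_ident)
    also have "\<dots> \<longleftrightarrow> sat \<CC>' (asg (g \<circ> m)) \<phi>"
      by (rule sat_cong) (use \<phi> in \<open>auto simp: Fml_def e_def g_def\<close>)
    finally show ?thesis .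
  qed
  \<comment> \<open>\<open>p\<close> and \<open>m\<close> satisfy the same parameter-free formulas,
    so the partial map from \<open>M\<close> to the realization is elementary. Strong homogeneity of
    \<CC>' extends it to an automorphism.\<close>
  have "elementary_map L \<CC>' (univ M) g"
    unfolding elementary_map_def
  proof (intro conjI ballI allI impI)
    show "univ M \<subseteq> univ \<CC>'" using M_sub C_sub by blast
    show "g ` univ M \<subseteq> univ \<CC>'" using n(1) by (auto simp: g_def)
    fix \<phi> :: "('f, 'r, nat, 'a) fml" and s :: "nat \<Rightarrow> 'a"
    assume \<phi>: "\<phi> \<in> Fml L {} UNIV" and s: "range s \<subseteq> univ M"
    define \<theta> :: "('f, 'r, 'i var, 'a) fml" where "\<theta> = subst_fml (\<lambda>k. Var (Yv (idx (s k)))) Par \<phi>"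
    have \<theta>: "\<theta> \<in> Fml L {} Ys" unfolding \<theta>_def by (rule subst_fml_in_Fml[OF \<phi>]) auto
    have \<theta>C: "\<theta> \<in> Fml L (univ \<CC>) Ys" using \<theta> by (rule Fml_mono) auto
    have "g \<circ> s = (\<lambda>k. (g \<circ> m) (idx (s k)))" using s m_idx by (auto simp: image_subset_iff)
    then have "sat \<CC>' (g \<circ> s) \<phi> \<longleftrightarrow> sat \<CC>' (asg (g \<circ> m)) \<theta>"
      by (simp add: \<theta>_def sat_subst_var fml.map_ident)
    also have "\<dots> \<longleftrightarrow> sat \<CC> (asg m) \<theta>" using key[OF \<theta>C] Sm_tp[OF p \<theta>] by simp
    also have "\<dots> \<longleftrightarrow> sat \<CC>' (asg m) \<theta>"
      by (rule elem_sub_sat[OF elem' \<theta>C]) (use \<theta> m_in_C in \<open>auto simp: Fml_def dest!: subsetD\<close>)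
    also have "\<dots> \<longleftrightarrow> sat \<CC>' (\<lambda>k. m (idx (s k))) \<phi>"
      by (simp add: \<theta>_def sat_subst_var fml.map_ident)
    also have "(\<lambda>k. m (idx (s k))) = s" using s m_idx by (auto simp: image_subset_iff)
    finally show "sat \<CC>' (g \<circ> s) \<phi> = sat \<CC>' s \<phi>" .
  qed
  moreover have "strongly_homogeneous L \<kappa>' \<CC>'" using monster' by (simp add: monster_def)
  ultimately obtain \<sigma> where \<sigma>: "\<sigma> \<in> aut L \<CC>'" "\<forall>a\<in>univ M. \<sigma> a = g a"
    using M_small' unfolding strongly_homogeneous_def by blast
  have "\<sigma> \<circ> m = g \<circ> m" using \<sigma>(2) m_in by auto
  then have "p = tp L \<CC>' (univ \<CC>) Ys (asg (\<sigma> \<circ> m))"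
    using key types_Fml[OF pt] by (auto simp: tp_def)
  then show ?thesis using \<sigma>(1) by blast
qed

text \<open>Recovers \<phi>(x; y) from \<theta> = \<phi>(x; m): each parameter from \<open>M\<close>
  is replaced by the \<open>y\<close>-variable that names it.\<close>

definition unname :: "('f, 'r, 'i var, 'a) fml \<Rightarrow> ('f, 'r, 'i var, 'a) fml" where
  "unname \<theta> = subst_fml Var (\<lambda>a. Var (Yv (idx a))) \<theta>"

lemma unname_in_Fml: "\<theta> \<in> Fml L (univ M) Xs \<Longrightarrow> unname \<theta> \<in> Fml L {} (Xs \<union> Ys)"
  unfolding unname_def by (rule subst_fml_in_Fml) auto

lemma inst_Xs_in_Fml: "\<phi> \<in> Fml L {} (Xs \<union> Ys) \<Longrightarrow> range b \<subseteq> B \<Longrightarrow> inst Xs (asg b) \<phi> \<in> Fml L B Ys"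
  by (rule inst_in_Fml[of _ _ "{}"]) auto

text \<open>The explicit form of \<open>h b p\<close>: writing \<open>\<theta> = \<phi>(x; m)\<close>, one has \<open>\<theta> \<in> h b p\<close> iff \<open>\<phi>(b; y) \<in> p\<close>.\<close>

definition hset :: "('i \<Rightarrow> 'a) \<Rightarrow> ('f, 'r, 'i var, 'a) fml set \<Rightarrow> ('f, 'r, 'i var, 'a) fml set" where
  "hset b p = {\<theta> \<in> Fml L (univ M) Xs. inst Xs (asg b) (unname \<theta>) \<in> p}"

lemma sat_inst_unname:
  assumes "\<theta> \<in> Fml L (univ M) Xs"
  shows "sat S (asg (\<sigma> \<circ> m)) (inst Xs (asg b) (unname \<theta>)) = sat S (asg b) (pmap \<sigma> \<theta>)"
proof -
  define u where "u v = (if v \<in> Xs then asg b v else asg (\<sigma> \<circ> m) v)" for v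
  have "sat S (asg (\<sigma> \<circ> m)) (inst Xs (asg b) (unname \<theta>)) = sat S u (unname \<theta>)"
    by (simp add: sat_inst u_def[abs_def])
  also have "\<dots> = sat S u (pmap (\<lambda>a. u (Yv (idx a))) \<theta>)" by (simp add: unname_def sat_subst_var)
  also have "pmap (\<lambda>a. u (Yv (idx a))) \<theta> = pmap \<sigma> \<theta>"
    by (rule pmap_cong) (use assms m_idx in \<open>auto simp: u_def Fml_def\<close>)
  also have "sat S u (pmap \<sigma> \<theta>) = sat S (asg b) (pmap \<sigma> \<theta>)"
    by (rule sat_cong) (use assms in \<open>auto simp: u_def Fml_def\<close>)
  finally show ?thesis .
qed

text \<open>Write \<theta> = \<phi>(x; m). Applying \<sigma> turns the truth of \<phi> at the
  inverse image of \<open>b\<close> and at \<open>m\<close> into its truth at \<open>b\<close> and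
  \<sigma>(m), and \<open>p\<close> alone decides the latter. Hence the definite description in
  \<open>h\<close> does not depend on \<sigma>.\<close>

lemma tp_inv_eq_hset:
  assumes b: "range b \<subseteq> univ \<CC>" and \<sigma>: "\<sigma> \<in> aut L \<CC>'"
    and p: "p = tp L \<CC>' (univ \<CC>) Ys (asg (\<sigma> \<circ> m))"
  shows "tp L \<CC>' (univ M) Xs (asg (inv_into (univ \<CC>') \<sigma> \<circ> b)) = hset b p"
proof -
  have bij: "\<sigma> ` univ \<CC>' = univ \<CC>'" using \<sigma> by (auto simp: aut_def bij_betw_def)
  have bC: "b i \<in> univ \<CC>'" for i using b C_sub by auto
  have "sat \<CC>' (asg (inv_into (univ \<CC>') \<sigma> \<circ> b)) \<theta> \<longleftrightarrow> inst Xs (asg b) (unname \<theta>) \<in> p"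
    if \<theta>: "\<theta> \<in> Fml L (univ M) Xs" for \<theta>
  proof -
    have fv: "fv \<theta> \<subseteq> Xs" using \<theta> by (simp add: Fml_def)
    have "asg (inv_into (univ \<CC>') \<sigma> \<circ> b) ` fv \<theta> \<subseteq> univ \<CC>'"
      using fv bC bij by (auto dest!: subsetD intro!: inv_into_into)
    then have "sat \<CC>' (asg (inv_into (univ \<CC>') \<sigma> \<circ> b)) \<theta> =
        sat \<CC>' (\<sigma> \<circ> asg (inv_into (univ \<CC>') \<sigma> \<circ> b)) (pmap \<sigma> \<theta>)"
      using \<theta> M_sub C_sub by (subst sat_aut[OF \<sigma> structure']) (auto simp: Fml_def)
    also have "\<dots> = sat \<CC>' (asg b) (pmap \<sigma> \<theta>)"
    proof (rule sat_cong)
      fix v assume "v \<in> fv (pmap \<sigma> \<theta>)"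
      then obtain i where "v = Xv i" using fv by auto
      then show "(\<sigma> \<circ> asg (inv_into (univ \<CC>') \<sigma> \<circ> b)) v = asg b v"
        using bC bij by (simp add: f_inv_into_f)
    qed
    also have "\<dots> = sat \<CC>' (asg (\<sigma> \<circ> m)) (inst Xs (asg b) (unname \<theta>))"
      by (simp only: sat_inst_unname[OF \<theta>])
    also have "\<dots> \<longleftrightarrow> inst Xs (asg b) (unname \<theta>) \<in> p"
      using inst_Xs_in_Fml[OF unname_in_Fml[OF \<theta>] b] by (simp add: p tp_def)
    finally show ?thesis .
  qed
  then show ?thesis by (auto simp: tp_def hset_def)
qed

lemma h_eq_hset:
  assumes p: "p \<in> S\<^sub>m" and b: "range b \<subseteq> univ \<CC>"
  shows "h L \<CC> \<CC>' M m b p = hset b p"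
proof -
  obtain \<sigma> where "\<sigma> \<in> aut L \<CC>'" "p = tp L \<CC>' (univ \<CC>) Ys (asg (\<sigma> \<circ> m))"
    using Sm_realized[OF p] by blast
  then show ?thesis unfolding h_def
    using tp_inv_eq_hset[OF b] by (intro the_equality) blast+
qed

text \<open>The inverse image of \<open>b\<close> may leave \<CC>, but its type over
  \<open>M\<close> is finitely satisfiable in \<CC> by elementarity.\<close>

lemma hset_in_types:
  assumes p: "p \<in> S\<^sub>m" and b: "range b \<subseteq> univ \<CC>"
  shows "hset b p \<in> types L \<CC> (univ M) Xs"
proof -
  obtain \<sigma> where \<sigma>: "\<sigma> \<in> aut L \<CC>'" "p = tp L \<CC>' (univ \<CC>) Ys (asg (\<sigma> \<circ> m))"
    using Sm_realized[OF p] by blast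
  have "\<sigma> ` univ \<CC>' = univ \<CC>'" "b i \<in> univ \<CC>'" for i
    using \<sigma>(1) b C_sub by (auto simp: aut_def bij_betw_def)
  then have "asg (inv_into (univ \<CC>') \<sigma> \<circ> b) ` Xs \<subseteq> univ \<CC>'"
    by (auto intro!: inv_into_into)
  then show ?thesis
    unfolding tp_inv_eq_hset[OF b \<sigma>, symmetric] by (rule tp_elem_sub_in_types[OF elem' M_sub])
qed

lemma realize_Xs:
  assumes "q \<in> types L \<CC> (univ M) Xs"
  shows "\<exists>c :: 'i var \<Rightarrow> 'a. range c \<subseteq> univ \<CC> \<and> tp L \<CC> (univ M) Xs c = q"
proof -
  have "saturated L \<kappa> \<CC>" "Card_order \<kappa>" "natLeq <o \<kappa>" using monster by (auto simp: monster_def)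
  moreover have "|Xs :: 'i var set| <o \<kappa>" using card_of_image small_i by (rule ordLeq_ordLess_trans)
  ultimately show ?thesis
    using realize_type[of L \<kappa> \<CC> q "univ M" Xs] infinite_var assms M_sub small by metis
qed

section \<open>Measures along a type\<close>

text \<open>\<open>twist p P \<tau>\<close>: writing \<open>p = tp(\<sigma>(m)/\<CC>)\<close>, the tuple \<open>\<tau>(P)\<close> in \<open>\<CC>\<close> has the same type over \<open>M\<close>
  as \<open>\<sigma>\<^sup>-\<^sup>1(P)\<close>. Conjugating the parameters of \<open>\<psi>\<close> accordingly, \<open>along \<mu> p \<psi>\<close> is the \<open>\<mu>\<close>-measure of
  \<open>\<sigma>\<^sup>-\<^sup>1(\<psi>)\<close>, and \<open>\<mu> * \<nu>\<close> turns out to be the \<open>\<nu>\<close>-average of the measures \<open>along \<mu> p\<close>.\<close>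

definition twist :: "('f, 'r, 'i var, 'a) fml set \<Rightarrow> 'a set \<Rightarrow> ('a \<Rightarrow> 'a) \<Rightarrow> bool" where
  "twist p P \<tau> \<longleftrightarrow> \<tau> ` P \<subseteq> univ \<CC> \<and> (\<forall>\<theta>\<in>Fml L P Ys. \<theta> \<in> p \<longleftrightarrow> sat \<CC> (asg m) (pmap \<tau> \<theta>))"

definition along :: "('f, 'r, 'i var, 'a) fml set measure \<Rightarrow> ('f, 'r, 'i var, 'a) fml set
    \<Rightarrow> ('f, 'r, 'i var, 'a) fml \<Rightarrow> real" where
  "along \<mu> p \<psi> = mval L \<CC> \<mu> (pmap (SOME \<tau>. twist p (params \<psi>) \<tau>) \<psi>)"

lemma twist_mono: "twist p P \<tau> \<Longrightarrow> Q \<subseteq> P \<Longrightarrow> twist p Q \<tau>"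
  unfolding twist_def by (blast intro: Fml_mono)

text \<open>Brings the conjugated parameters back from \<CC>' to \<CC>: a realization in \<CC> of
  the type \<open>hset b p\<close> takes the place of the inverse image of \<open>b\<close>.\<close>

lemma realization_twist:
  assumes p: "p \<in> S\<^sub>m" and b: "range b \<subseteq> univ \<CC>"
    and c: "range c \<subseteq> univ \<CC>" "tp L \<CC> (univ M) Xs c = hset b p"
  shows "\<exists>\<tau>. twist p (range b) \<tau> \<and> (\<forall>i. \<tau> (b i) = c (Xv i))"
proof -
  define \<tau> where "\<tau> a = c (Xv (inv b a))" for a
  have pt: "p \<in> types L \<CC> (univ \<CC>) Ys" by (rule Sm_types[OF p])
  obtain \<sigma> where \<sigma>: "\<sigma> \<in> aut L \<CC>'" "p = tp L \<CC>' (univ \<CC>) Ys (asg (\<sigma> \<circ> m))"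
    using Sm_realized[OF p] by blast
  have "\<tau> (b i) = c (Xv i)" for i
  proof -
    define j where "j = inv b (b i)"
    have j: "b j = b i" unfolding j_def by (rule f_inv_into_f) simp
    \<comment> \<open>Equal entries of \<open>b\<close> need equal images. If b_i = b_j, then
      \<open>p\<close> contains the instantiated equation, so the type \<open>hset b p\<close>
      contains x_i = x_j and its realization \<open>c\<close> satisfies it.\<close>
    define \<theta> :: "('f, 'r, 'i var, 'a) fml" where "\<theta> = Eq (Var (Xv i)) (Var (Xv j))"
    have \<theta>: "\<theta> \<in> Fml L (univ M) Xs" by (auto simp: \<theta>_def Fml_def)
    have "inst Xs (asg b) (unname \<theta>) \<in> p"
      by (rule types_entails[OF pt, of "{}"])
        (use inst_Xs_in_Fml[OF unname_in_Fml[OF \<theta>] b] j in \<open>auto simp: \<theta>_def unname_def\<close>)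
    then have "\<theta> \<in> tp L \<CC> (univ M) Xs c" using \<theta> c(2) by (simp add: hset_def)
    then show ?thesis by (simp add: \<theta>_def tp_def \<tau>_def j_def)
  qed
  moreover have "\<theta> \<in> p \<longleftrightarrow> sat \<CC> (asg m) (pmap \<tau> \<theta>)" if \<theta>: "\<theta> \<in> Fml L (range b) Ys" for \<theta>
  proof -
    \<comment> \<open>The two kinds of variables exchange roles: the parameters from
      \<open>b\<close> become \<open>x\<close>-variables and the \<open>y\<close>-variables become
      parameters from \<open>m\<close>. The resulting formula is read once at \<open>c\<close> and
      once, through \<open>hset\<close>, in \<open>p\<close>.\<close>
    define e :: "'i var \<Rightarrow> ('f, 'i var, 'a) trm" where
      "e v = (case v of Yv i \<Rightarrow> Par (m i) | _ \<Rightarrow> Var v)" for v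
    define \<theta>' where "\<theta>' = subst_fml e (\<lambda>a. Var (Xv (inv b a))) \<theta>"
    have \<theta>': "\<theta>' \<in> Fml L (univ M) Xs" unfolding \<theta>'_def
      by (rule subst_fml_in_Fml[OF \<theta>]) (auto simp: e_def m_in split: var.splits)
    have "sat \<CC> (asg m) (pmap \<tau> \<theta>) \<longleftrightarrow> sat \<CC> (\<lambda>v. eval \<CC> c (e v)) (pmap \<tau> \<theta>)"
      by (rule sat_cong) (use \<theta> in \<open>auto simp: Fml_def e_def\<close>)
    also have "\<dots> \<longleftrightarrow> sat \<CC> c \<theta>'" by (simp add: \<theta>'_def sat_subst_var \<tau>_def[abs_def])
    also have "\<dots> \<longleftrightarrow> \<theta>' \<in> hset b p" using \<theta>' by (simp add: c(2)[symmetric] tp_def)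
    also have "\<dots> \<longleftrightarrow> sat \<CC>' (asg (\<sigma> \<circ> m)) (inst Xs (asg b) (unname \<theta>'))"
      using \<theta>' inst_Xs_in_Fml[OF unname_in_Fml[OF \<theta>'] b] by (simp add: hset_def \<sigma>(2) tp_def)
    also have "\<dots> \<longleftrightarrow> sat \<CC>' (asg b) (pmap \<sigma> \<theta>')" by (rule sat_inst_unname[OF \<theta>'])
    also have "\<dots> \<longleftrightarrow> sat \<CC>' (\<lambda>v. eval \<CC>' (asg b) (tmap \<sigma> (e v))) (pmap (\<lambda>a. b (inv b a)) \<theta>)"
      by (simp add: \<theta>'_def sat_subst_pmap_var)
    also have "pmap (\<lambda>a. b (inv b a)) \<theta> = \<theta>"
      by (rule pmap_idI) (use \<theta> in \<open>auto simp: Fml_def f_inv_into_f dest!: subsetD\<close>)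
    also have "sat \<CC>' (\<lambda>v. eval \<CC>' (asg b) (tmap \<sigma> (e v))) \<theta> \<longleftrightarrow> sat \<CC>' (asg (\<sigma> \<circ> m)) \<theta>"
      by (rule sat_cong) (use \<theta> in \<open>auto simp: Fml_def e_def\<close>)
    also have "\<dots> \<longleftrightarrow> \<theta> \<in> p" using Fml_mono[OF \<theta> b order_refl] by (simp add: \<sigma>(2) tp_def)
    finally show ?thesis by simp
  qed
  moreover have "\<tau> ` range b \<subseteq> univ \<CC>" using c(1) by (auto simp: \<tau>_def)
  ultimately show ?thesis unfolding twist_def by blast
qed

text \<open>An infinite index type has room for any finite set, with a default element at the other
  indices. If it is finite, then \<open>M\<close> is finite, so \<CC> equals \<open>M\<close> and
  \<open>m\<close> itself covers everything.\<close>

lemma finite_cover: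
  assumes "finite P" "P \<subseteq> univ \<CC>"
  shows "\<exists>b :: 'i \<Rightarrow> 'a. range b \<subseteq> univ \<CC> \<and> P \<subseteq> range b"
proof (cases "finite (UNIV :: 'i set)")
  case True
  then have "finite (univ M)" using m by (metis finite_imageI)
  then have "univ \<CC> = univ M" by (rule elem_sub_finite[OF elem])
  then show ?thesis using m assms by (intro exI[of _ m]) auto
next
  case False
  then obtain B :: "'i set" where "finite B" "card B = card P"
    using infinite_arbitrarily_large by blast
  then obtain f where f: "bij_betw f B P" using finite_same_card_bij assms(1) by blast
  obtain d where "d \<in> univ \<CC>" using C_nonempty by blast
  then show ?thesis using f assms(2)
    by (intro exI[of _ "\<lambda>i. if i \<in> B then f i else d"]) (auto simp: bij_betw_def)
qed

lemma twist_exists: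
  assumes "p \<in> S\<^sub>m" "finite P" "P \<subseteq> univ \<CC>"
  shows "\<exists>\<tau>. twist p P \<tau>"
proof -
  obtain b :: "'i \<Rightarrow> 'a" where b: "range b \<subseteq> univ \<CC>" "P \<subseteq> range b" using finite_cover assms by blast
  obtain c :: "'i var \<Rightarrow> 'a" where "range c \<subseteq> univ \<CC>" "tp L \<CC> (univ M) Xs c = hset b p"
    using realize_Xs[OF hset_in_types[OF assms(1) b(1)]] by blast
  then show ?thesis using realization_twist[OF assms(1) b(1)] twist_mono[OF _ b(2)] by blast
qed

text \<open>The existential closure is a sentence, so its twisted form being true puts it in
  \<open>p\<close>, and a sentence over \<CC> in \<open>p\<close> is true in \<CC>. Used
  contrapositively: twisting preserves unsatisfiability.\<close>

lemma twist_satisfiable: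
  fixes \<psi> :: "('f, 'r, 'i var, 'a) fml"
  assumes p: "p \<in> S\<^sub>m" and t: "twist p P \<tau>" and \<psi>: "\<psi> \<in> Fml L P Ys" and s: "satisfiable \<CC> (pmap \<tau> \<psi>)"
  shows "satisfiable \<CC> \<psi>"
proof -
  have "sat \<CC> (asg m) (pmap \<tau> (ex_closure \<psi>))" using s C_nonempty by (simp add: pmap_ex_closure sat_ex_closure)
  then have "ex_closure \<psi> \<in> p" using t ex_closure_in_Fml[OF \<psi>] unfolding twist_def by blast
  then have "satisfiable \<CC> (ex_closure \<psi>)" by (rule types_satisfiable[OF Sm_types[OF p]])
  then show ?thesis using C_nonempty by (auto simp: satisfiable_def[of _ "ex_closure \<psi>"] sat_ex_closure)
qed

text \<open>\<open>p\<close> determines the type over \<open>M\<close> of the twisted parameters: a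
  formula with parameters from \<open>m\<close> holds of them iff the corresponding formula in
  \<open>y\<close>, with the original parameters, is in \<open>p\<close>. Any two twists therefore
  give tuples of equal type, and invariance applies.\<close>

lemma twist_mval:
  fixes \<psi> :: "('f, 'r, 'i var, 'a) fml"
  assumes inv: "invariant L \<CC> (univ M) \<mu>"
    and P: "finite P" "P \<subseteq> univ \<CC>" and t: "twist p P \<tau>" "twist p P \<tau>'" and \<psi>: "\<psi> \<in> Fml L P Ys"
  shows "mval L \<CC> \<mu> (pmap \<tau> \<psi>) = mval L \<CC> \<mu> (pmap \<tau>' \<psi>)"
proof -
  obtain k :: "'a \<Rightarrow> nat" where k: "inj_on k P" using finite_imp_inj_to_nat_seg[OF P(1)] by blast
  obtain d where d: "d \<in> univ \<CC>" using C_nonempty by blast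
  \<comment> \<open>Invariance is stated for instantiations of variables disjoint from
    \<open>y\<close>, so the parameters are turned into \<open>Zv\<close>-variables.
    \<open>bb\<close> puts their twisted values there, with the default \<open>d\<close> keeping its
    range in \<CC>.\<close>
  define V :: "'i var set" where "V = Zv ` k ` P"
  define \<phi> :: "('f, 'r, 'i var, 'a) fml" where "\<phi> = subst_fml Var (\<lambda>a. Var (Zv (k a))) \<psi>"
  define bb :: "('a \<Rightarrow> 'a) \<Rightarrow> 'i var \<Rightarrow> 'a" where
    "bb \<tau> w = (case w of Zv n \<Rightarrow> if n \<in> k ` P then \<tau> (inv_into P k n) else d | _ \<Rightarrow> d)" for \<tau> w
  define e :: "'i var \<Rightarrow> ('f, 'i var, 'a) trm" where
    "e v = (case v of Zv n \<Rightarrow> Par (inv_into P k n) | _ \<Rightarrow> Var v)" for v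
  \<comment> \<open>The flipped formula: the \<open>Zv\<close>-variables return to the parameters
    they stand for, and the parameters from \<open>M\<close> become
    \<open>y\<close>-variables.\<close>
  define fl where "fl \<theta> = subst_fml e (\<lambda>a. Var (Yv (idx a))) \<theta>" for \<theta> :: "('f, 'r, 'i var, 'a) fml"
  have \<phi>: "\<phi> \<in> Fml L {} (Ys \<union> V)" unfolding \<phi>_def
    by (rule subst_fml_in_Fml[OF \<psi>]) (auto simp: V_def)
  have VY: "V \<subseteq> - Ys" by (auto simp: V_def)
  have *: "range (bb \<tau>) \<subseteq> univ \<CC>" "tp L \<CC> (univ M) V (bb \<tau>) = {\<theta> \<in> Fml L (univ M) V. fl \<theta> \<in> p}"
    "mval L \<CC> \<mu> (inst V (bb \<tau>) \<phi>) = mval L \<CC> \<mu> (pmap \<tau> \<psi>)" if t: "twist p P \<tau>" for \<tau>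
  proof -
    have tP: "\<tau> a \<in> univ \<CC>" if "a \<in> P" for a using t that by (auto simp: twist_def)
    show ran: "range (bb \<tau>) \<subseteq> univ \<CC>" using tP d by (auto simp: bb_def inv_into_into split: var.splits)
    have "sat \<CC> (bb \<tau>) \<theta> \<longleftrightarrow> fl \<theta> \<in> p" if \<theta>: "\<theta> \<in> Fml L (univ M) V" for \<theta>
    proof -
      have fl: "fl \<theta> \<in> Fml L P Ys" unfolding fl_def
        by (rule subst_fml_in_Fml[OF \<theta>]) (auto simp: e_def V_def inv_into_into split: var.splits)
      then have "fl \<theta> \<in> p \<longleftrightarrow> sat \<CC> (asg m) (pmap \<tau> (fl \<theta>))" using t by (simp add: twist_def)
      also have "\<dots> \<longleftrightarrow> sat \<CC> (\<lambda>v. eval \<CC> (asg m) (tmap \<tau> (e v))) (pmap (\<lambda>a. m (idx a)) \<theta>)"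
        by (simp add: fl_def sat_subst_pmap_var)
      also have "pmap (\<lambda>a. m (idx a)) \<theta> = \<theta>"
        by (rule pmap_idI) (use \<theta> m_idx in \<open>auto simp: Fml_def\<close>)
      also have "sat \<CC> (\<lambda>v. eval \<CC> (asg m) (tmap \<tau> (e v))) \<theta> \<longleftrightarrow> sat \<CC> (bb \<tau>) \<theta>"
        by (rule sat_cong) (use \<theta> in \<open>auto simp: Fml_def V_def e_def bb_def dest!: subsetD\<close>)
      finally show ?thesis by simp
    qed
    then show "tp L \<CC> (univ M) V (bb \<tau>) = {\<theta> \<in> Fml L (univ M) V. fl \<theta> \<in> p}" by (auto simp: tp_def)
    have "clopen L \<CC> (univ \<CC>) Ys (inst V (bb \<tau>) \<phi>) = clopen L \<CC> (univ \<CC>) Ys (pmap \<tau> \<psi>)"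
    proof (rule clopen_eqI)
      show "inst V (bb \<tau>) \<phi> \<in> Fml L (univ \<CC>) Ys"
        by (rule inst_in_Fml[of _ _ "{}"]) (use \<phi> ran in \<open>auto simp: Un_commute\<close>)
      show "pmap \<tau> \<psi> \<in> Fml L (univ \<CC>) Ys" by (rule pmap_in_Fml[OF \<psi>]) (use tP in auto)
      fix s :: "'i var \<Rightarrow> 'a"
      define u where "u v = (if v \<in> V then bb \<tau> v else s v)" for v
      have "sat \<CC> s (inst V (bb \<tau>) \<phi>) = sat \<CC> u (pmap (\<lambda>a. u (Zv (k a))) \<psi>)"
        by (simp add: sat_inst \<phi>_def sat_subst_var u_def[abs_def])
      also have "pmap (\<lambda>a. u (Zv (k a))) \<psi> = pmap \<tau> \<psi>"
      proof (rule pmap_cong)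
        fix a assume "a \<in> params \<psi>"
        then have "a \<in> P" using \<psi> by (auto simp: Fml_def)
        then show "u (Zv (k a)) = \<tau> a" using k by (simp add: u_def V_def bb_def)
      qed
      also have "sat \<CC> u (pmap \<tau> \<psi>) = sat \<CC> s (pmap \<tau> \<psi>)"
        by (rule sat_cong) (use \<psi> VY in \<open>auto simp: u_def Fml_def\<close>)
      finally show "sat \<CC> s (inst V (bb \<tau>) \<phi>) = sat \<CC> s (pmap \<tau> \<psi>)" .
    qed
    then show "mval L \<CC> \<mu> (inst V (bb \<tau>) \<phi>) = mval L \<CC> \<mu> (pmap \<tau> \<psi>)" by (simp add: mval_def)
  qed
  have "mval L \<CC> \<mu> (inst V (bb \<tau>) \<phi>) = mval L \<CC> \<mu> (inst V (bb \<tau>') \<phi>)"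
    using inv VY \<phi> *(1,2)[OF t(1)] *(1,2)[OF t(2)] unfolding invariant_def by simp
  then show ?thesis using *(3)[OF t(1)] *(3)[OF t(2)] by simp
qed

text \<open>Frees \<open>along\<close> from the chosen twist and from the exact parameter set.
  Several formulas can then be treated with one twist over all their parameters.\<close>

lemma along_eq:
  assumes "invariant L \<CC> (univ M) \<mu>" "p \<in> S\<^sub>m" "twist p P \<tau>" "\<psi> \<in> Fml L P Ys" "P \<subseteq> univ \<CC>"
  shows "along \<mu> p \<psi> = mval L \<CC> \<mu> (pmap \<tau> \<psi>)"
proof -
  have P: "params \<psi> \<subseteq> P" "\<psi> \<in> Fml L (params \<psi>) Ys" using assms(4) by (auto simp: Fml_def)
  then have PC: "params \<psi> \<subseteq> univ \<CC>" using assms(5) by blast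
  have "twist p (params \<psi>) (SOME \<tau>. twist p (params \<psi>) \<tau>)"
    using twist_exists[OF assms(2) finite_params PC] by (rule someI_ex)
  then show ?thesis unfolding along_def
    using twist_mval[OF assms(1) finite_params PC _ twist_mono[OF assms(3) P(1)] P(2)] by blast
qed

text \<open>The realization chosen inside \<open>Fmap\<close> is the image of \<open>b\<close> under
  a twist. Morley integrals against a push-forward thereby become integrals of \<open>along\<close>
  over \<open>S\<^sub>m\<close>.\<close>

lemma Fmap_h:
  assumes inv: "invariant L \<CC> (univ M) \<mu>" and p: "p \<in> S\<^sub>m" and b: "range b \<subseteq> univ \<CC>"
    and \<phi>: "\<phi> \<in> Fml L {} (Xs \<union> Ys)"
  shows "Fmap L \<CC> (univ M) Xs \<mu> \<phi> (h L \<CC> \<CC>' M m b p) = along \<mu> p (inst Xs (asg b) \<phi>)"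
proof -
  define c :: "'i var \<Rightarrow> 'a" where "c = (SOME c. range c \<subseteq> univ \<CC> \<and> tp L \<CC> (univ M) Xs c = hset b p)"
  have c: "range c \<subseteq> univ \<CC> \<and> tp L \<CC> (univ M) Xs c = hset b p"
    unfolding c_def using realize_Xs[OF hset_in_types[OF p b]] by (rule someI_ex)
  then obtain \<tau> where \<tau>: "twist p (range b) \<tau>" "\<And>i. \<tau> (b i) = c (Xv i)"
    using realization_twist[OF p b] by blast
  have "along \<mu> p (inst Xs (asg b) \<phi>) = mval L \<CC> \<mu> (pmap \<tau> (inst Xs (asg b) \<phi>))"
    by (rule along_eq[OF inv p \<tau>(1) inst_Xs_in_Fml[OF \<phi> order_refl] b])
  also have "pmap \<tau> (inst Xs (asg b) \<phi>) = inst Xs (\<tau> \<circ> asg b) \<phi>"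
    using pmap_idI[of \<phi> \<tau>] \<phi> by (simp add: pmap_inst Fml_def)
  also have "\<dots> = inst Xs c \<phi>" by (rule inst_cong) (auto simp: \<tau>(2))
  finally show ?thesis by (simp add: Fmap_def h_eq_hset[OF p b] c_def)
qed

text \<open>Convolutions are specified on formulas \<phi>(b; y) only. Substitution renames bound
  variables, so an arbitrary formula is reached up to equivalence, which is enough for its clopen
  set.\<close>

lemma ex_inst_equiv:
  fixes \<psi> :: "('f, 'r, 'i var, 'a) fml"
  assumes "\<psi> \<in> Fml L (univ \<CC>) Ys"
  shows "\<exists>\<phi>\<in>Fml L {} (Xs \<union> Ys). \<exists>b. range b \<subseteq> univ \<CC> \<and>
    (\<forall>s. sat \<CC> s (inst Xs (asg b) \<phi>) = sat \<CC> s \<psi>)"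
proof -
  have "params \<psi> \<subseteq> univ \<CC>" using assms by (simp add: Fml_def)
  then obtain b :: "'i \<Rightarrow> 'a" where b: "range b \<subseteq> univ \<CC>" "params \<psi> \<subseteq> range b"
    using finite_cover[OF finite_params] by blast
  define \<phi> :: "('f, 'r, 'i var, 'a) fml" where "\<phi> = subst_fml Var (\<lambda>a. Var (Xv (inv b a))) \<psi>"
  have \<phi>: "\<phi> \<in> Fml L {} (Xs \<union> Ys)" unfolding \<phi>_def
    by (rule subst_fml_in_Fml[OF assms]) auto
  have "sat \<CC> s (inst Xs (asg b) \<phi>) = sat \<CC> s \<psi>" for s
  proof -
    define u where "u v = (if v \<in> Xs then asg b v else s v)" for v
    have "sat \<CC> s (inst Xs (asg b) \<phi>) = sat \<CC> u (pmap (\<lambda>a. b (inv b a)) \<psi>)"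
      by (simp add: sat_inst \<phi>_def sat_subst_var u_def[abs_def])
    also have "pmap (\<lambda>a. b (inv b a)) \<psi> = \<psi>"
      by (rule pmap_idI) (use b(2) in \<open>auto simp: f_inv_into_f\<close>)
    also have "sat \<CC> u \<psi> = sat \<CC> s \<psi>"
      by (rule sat_cong) (use assms in \<open>auto simp: u_def Fml_def\<close>)
    finally show ?thesis .
  qed
  then show ?thesis using \<phi> b(1) by blast
qed

end

section \<open>Convolution\<close>

context monster_pair
begin

interpretation Y: clopen_base "type_top L \<CC> (univ \<CC>) (Ys :: 'i var set)" "clopen L \<CC> (univ \<CC>) Ys ` Fml L (univ \<CC>) Ys"
  by (rule clopen_base_types)

interpretation X: clopen_base "type_top L \<CC> (univ M) (Xs :: 'i var set)" "clopen L \<CC> (univ M) Xs ` Fml L (univ M) Xs"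
  by (rule clopen_base_types)

lemma tp_m_Fml: "\<psi> \<in> tp L \<CC> {} Ys (asg m) \<Longrightarrow> \<psi> \<in> Fml L (univ \<CC>) Ys"
  by (auto simp: tp_def intro: Fml_mono)

text \<open>The form required by \<open>closed_Inter_base\<close> and
  \<open>regular_prob_Inter\<close>: an intersection, possibly uncountable, of clopen sets.\<close>

lemma Sm_eq: "S\<^sub>m = topspace (type_top L \<CC> (univ \<CC>) Ys) \<inter> \<Inter>(clopen L \<CC> (univ \<CC>) Ys ` tp L \<CC> {} Ys (asg m))"
  by (auto simp: types_m_def clopen_def)

lemma Sm_closed: "closedin (type_top L \<CC> (univ \<CC>) Ys) S\<^sub>m"
  unfolding Sm_eq by (rule Y.closed_Inter_base) (auto simp: tp_m_Fml)

lemma Sm_sets: "sets \<nu> = sets (type_borel L \<CC> (univ \<CC>) Ys) \<Longrightarrow> S\<^sub>m \<in> sets \<nu>"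
proof -
  assume s: "sets \<nu> = sets (type_borel L \<CC> (univ \<CC>) Ys)"
  have sub: "S\<^sub>m \<subseteq> types L \<CC> (univ \<CC>) Ys" by (auto simp: types_m_def)
  have "openin (type_top L \<CC> (univ \<CC>) Ys) (types L \<CC> (univ \<CC>) Ys - S\<^sub>m)"
    using Sm_closed by (simp add: closedin_def)
  then have "types L \<CC> (univ \<CC>) Ys - S\<^sub>m \<in> sets \<nu>"
    using Y.open_in_borel by (simp add: s sets_type_borel)
  then have "space \<nu> - (types L \<CC> (univ \<CC>) Ys - S\<^sub>m) \<in> sets \<nu>" by (rule sets.compl_sets)
  moreover have "space \<nu> = types L \<CC> (univ \<CC>) Ys"
    using sets_eq_imp_space_eq[OF s] by (simp add: space_type_borel)
  ultimately show "S\<^sub>m \<in> sets \<nu>" using sub by (simp add: double_diff)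
qed

lemma keisler_m_D:
  assumes "keisler_m L \<CC> m \<nu>"
  shows "global_keisler L \<CC> \<nu>" "sets \<nu> = sets (type_borel L \<CC> (univ \<CC>) Ys)" "prob_space \<nu>"
    "S\<^sub>m \<in> sets \<nu>" "measure \<nu> S\<^sub>m = 1" "space \<nu> = types L \<CC> (univ \<CC>) Ys"
    "prob_space (restrict_space \<nu> S\<^sub>m)" "space (restrict_space \<nu> S\<^sub>m) = S\<^sub>m"
proof -
  show g: "global_keisler L \<CC> \<nu>" and one: "measure \<nu> S\<^sub>m = 1" using assms by (auto simp: keisler_m_def)
  show s: "sets \<nu> = sets (type_borel L \<CC> (univ \<CC>) Ys)" and pr: "prob_space \<nu>"
    using g by (auto simp: keisler_def)
  show Sm: "S\<^sub>m \<in> sets \<nu>" using s by (rule Sm_sets)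
  show sp: "space \<nu> = types L \<CC> (univ \<CC>) Ys"
    using sets_eq_imp_space_eq[OF s] by (simp add: space_type_borel)
  interpret prob_space \<nu> by (rule pr)
  show "prob_space (restrict_space \<nu> S\<^sub>m)"
    by (rule prob_space_restrict_space[OF Sm]) (simp add: emeasure_eq_measure one)
  show "space (restrict_space \<nu> S\<^sub>m) = S\<^sub>m"
    using Sm sets.sets_into_space by (auto simp: space_restrict_space)
qed

text \<open>By \<open>hset\<close>, the preimage of the clopen set of \<theta> is the trace on
  \<open>S\<^sub>m\<close> of the clopen set of the instantiated \<open>unname \<theta>\<close>.
  Borel sets are generated by open sets, so the argument runs over arbitrary unions of clopen
  sets.\<close>

lemma h_measurable:
  assumes s: "sets \<nu> = sets (type_borel L \<CC> (univ \<CC>) Ys)" and b: "range b \<subseteq> univ \<CC>"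
  shows "h L \<CC> \<CC>' M m b \<in> measurable (restrict_space \<nu> S\<^sub>m) (type_borel L \<CC> (univ M) Xs)"
  unfolding type_borel_def
proof (rule measurable_measure_of)
  have Sm: "S\<^sub>m \<in> sets \<nu>" using s by (rule Sm_sets)
  have sp: "space (restrict_space \<nu> S\<^sub>m) = S\<^sub>m"
    using Sm sets.sets_into_space by (auto simp: space_restrict_space)
  show "{U. openin (type_top L \<CC> (univ M) Xs) U} \<subseteq> Pow (types L \<CC> (univ M) Xs)"
    using openin_type_top by blast
  show "h L \<CC> \<CC>' M m b \<in> space (restrict_space \<nu> S\<^sub>m) \<rightarrow> types L \<CC> (univ M) Xs"
    using h_eq_hset[OF _ b] hset_in_types[OF _ b] by (auto simp: sp)
  fix U :: "('f, 'r, 'i var, 'a) fml set set" assume "U \<in> {U. openin (type_top L \<CC> (univ M) Xs) U}"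
  then have U: "openin (type_top L \<CC> (univ M) Xs) U" by simp
  define \<Theta> :: "('f, 'r, 'i var, 'a) fml set" where "\<Theta> = {\<theta> \<in> Fml L (univ M) Xs. clopen L \<CC> (univ M) Xs \<theta> \<subseteq> U}"
  define W where "W = (\<Union>\<theta>\<in>\<Theta>. clopen L \<CC> (univ \<CC>) Ys (inst Xs (asg b) (unname \<theta>)))"
  have "openin (type_top L \<CC> (univ \<CC>) Ys) W" unfolding W_def
    using Y.openin_base inst_Xs_in_Fml[OF unname_in_Fml b] by (intro openin_Union) (auto simp: \<Theta>_def)
  then have "W \<in> sets \<nu>" using Y.open_in_borel by (simp add: s sets_type_borel)
  moreover have "h L \<CC> \<CC>' M m b -` U \<inter> S\<^sub>m = W \<inter> S\<^sub>m"
  proof -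
    have "h L \<CC> \<CC>' M m b p \<in> U \<longleftrightarrow> p \<in> W" if p: "p \<in> S\<^sub>m" for p
    proof -
      have "hset b p \<in> U \<longleftrightarrow> (\<exists>\<theta>\<in>\<Theta>. hset b p \<in> clopen L \<CC> (univ M) Xs \<theta>)"
      proof
        assume "hset b p \<in> U"
        then obtain c where "c \<in> clopen L \<CC> (univ M) Xs ` Fml L (univ M) Xs" "hset b p \<in> c" "c \<subseteq> U"
          using U X.base[of U] by meson
        then show "\<exists>\<theta>\<in>\<Theta>. hset b p \<in> clopen L \<CC> (univ M) Xs \<theta>" by (auto simp: \<Theta>_def)
      qed (auto simp: \<Theta>_def)
      also have "\<dots> \<longleftrightarrow> p \<in> W"
        using hset_in_types[OF p b] Sm_types[OF p] by (auto simp: W_def clopen_def \<Theta>_def hset_def)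
      finally show ?thesis by (simp add: h_eq_hset[OF p b])
    qed
    then show ?thesis by blast
  qed
  ultimately show "h L \<CC> \<CC>' M m b -` U \<inter> space (restrict_space \<nu> S\<^sub>m) \<in> sets (restrict_space \<nu> S\<^sub>m)"
    using Sm by (auto simp: sp sets_restrict_space)
qed

lemma push_h_prob:
  assumes "keisler_m L \<CC> m \<nu>" "range b \<subseteq> univ \<CC>"
  shows "prob_space (push_h L \<CC> \<CC>' M m b \<nu>)"
    and "sets (push_h L \<CC> \<CC>' M m b \<nu>) = sets (type_borel L \<CC> (univ M) Xs)"
    and "space (push_h L \<CC> \<CC>' M m b \<nu>) = types L \<CC> (univ M) Xs"
  unfolding push_h_def
  using prob_space.prob_space_distr[OF keisler_m_D(7)[OF assms(1)] h_measurable[OF keisler_m_D(2)[OF assms(1)] assms(2)]]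
  by (auto simp: space_type_borel)

text \<open>The preimage under \<open>h\<close> is a clopen set cut down to
  \<open>S\<^sub>m\<close>, which has full \<nu>-measure.\<close>

lemma measure_push_h:
  assumes \<nu>: "keisler_m L \<CC> m \<nu>" and b: "range b \<subseteq> univ \<CC>" and \<theta>: "\<theta> \<in> Fml L (univ M) Xs"
  shows "measure (push_h L \<CC> \<CC>' M m b \<nu>) (clopen L \<CC> (univ M) Xs \<theta>) = mval L \<CC> \<nu> (inst Xs (asg b) (unname \<theta>))"
proof -
  note k = keisler_m_D[OF \<nu>]
  interpret prob_space \<nu> by (rule k(3))
  let ?D = "clopen L \<CC> (univ \<CC>) Ys (inst Xs (asg b) (unname \<theta>))"
  have D: "?D \<in> events"
    using clopen_in_type_borel[OF inst_Xs_in_Fml[OF unname_in_Fml[OF \<theta>] b], of \<CC>] k(2) by simp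
  have "measure (push_h L \<CC> \<CC>' M m b \<nu>) (clopen L \<CC> (univ M) Xs \<theta>) =
      measure (restrict_space \<nu> S\<^sub>m) (h L \<CC> \<CC>' M m b -` clopen L \<CC> (univ M) Xs \<theta> \<inter> S\<^sub>m)"
    unfolding push_h_def
    by (subst measure_distr[OF h_measurable[OF k(2) b] clopen_in_type_borel[OF \<theta>]]) (simp add: k(8))
  also have "h L \<CC> \<CC>' M m b -` clopen L \<CC> (univ M) Xs \<theta> \<inter> S\<^sub>m = ?D \<inter> S\<^sub>m"
    using h_eq_hset[OF _ b] hset_in_types[OF _ b] Sm_types \<theta> by (auto simp: clopen_def hset_def)
  also have "measure (restrict_space \<nu> S\<^sub>m) (?D \<inter> S\<^sub>m) = measure \<nu> (?D \<inter> S\<^sub>m)"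
    using k(4) by (intro measure_restrict_space) auto
  also have "\<dots> = measure \<nu> ?D"
    using AE_prob_1[OF k(5)] D k(4) by (intro measure_eq_AE) auto
  finally show ?thesis by (simp add: mval_def)
qed

lemma mval_bounds:
  assumes "global_keisler L \<CC> \<mu>"
  shows "0 \<le> mval L \<CC> \<mu> \<psi>" "mval L \<CC> \<mu> \<psi> \<le> 1"
  using prob_space.prob_le_1[of \<mu>] assms by (auto simp: mval_def keisler_def)

lemma along_bounds:
  assumes "global_keisler L \<CC> \<mu>"
  shows "0 \<le> along \<mu> p \<psi>" "along \<mu> p \<psi> \<le> 1"
  unfolding along_def by (rule mval_bounds[OF assms])+

text \<open>Inclusion says that \<psi> and the negation of \<psi>' are jointly unsatisfiable, and
  twisting preserves this.\<close>

lemma twist_clopen_mono: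
  fixes \<psi> \<psi>' :: "('f, 'r, 'i var, 'a) fml"
  assumes p: "p \<in> S\<^sub>m" and t: "twist p P \<tau>" and P: "P \<subseteq> univ \<CC>"
    and \<psi>: "\<psi> \<in> Fml L P Ys" "\<psi>' \<in> Fml L P Ys"
    and sub: "clopen L \<CC> (univ \<CC>) Ys \<psi> \<subseteq> clopen L \<CC> (univ \<CC>) Ys \<psi>'"
  shows "clopen L \<CC> (univ \<CC>) Ys (pmap \<tau> \<psi>) \<subseteq> clopen L \<CC> (univ \<CC>) Ys (pmap \<tau> \<psi>')"
proof -
  have F: "\<psi> \<in> Fml L (univ \<CC>) Ys" "\<psi>' \<in> Fml L (univ \<CC>) Ys" using \<psi> P by (auto intro: Fml_mono)
  have tF: "pmap \<tau> \<psi> \<in> Fml L (univ \<CC>) Ys" "pmap \<tau> \<psi>' \<in> Fml L (univ \<CC>) Ys"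
    using \<psi> t by (auto intro!: pmap_in_Fml simp: twist_def)
  have "clopen L \<CC> (univ \<CC>) Ys (And \<psi> (Neg \<psi>')) = {}"
    using sub F by (auto simp: clopen_And clopen_Neg)
  then have "\<not> satisfiable \<CC> (And \<psi> (Neg \<psi>'))" using F by (subst (asm) clopen_empty_iff) auto
  then have "\<not> satisfiable \<CC> (pmap \<tau> (And \<psi> (Neg \<psi>')))"
    using twist_satisfiable[OF p t, of "And \<psi> (Neg \<psi>')"] \<psi> by (auto simp del: fml.map)
  then have "clopen L \<CC> (univ \<CC>) Ys (And (pmap \<tau> \<psi>) (Neg (pmap \<tau> \<psi>'))) = {}"
    using tF by (subst clopen_empty_iff) auto
  then show ?thesis using tF clopen_subset[of L \<CC> "univ \<CC>" Ys "pmap \<tau> \<psi>"] by (auto simp: clopen_And clopen_Neg)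
qed

lemma along_cong:
  assumes inv: "invariant L \<CC> (univ M) \<mu>" and p: "p \<in> S\<^sub>m"
    and \<psi>: "\<psi> \<in> Fml L (univ \<CC>) Ys" "\<psi>' \<in> Fml L (univ \<CC>) Ys"
    and eq: "clopen L \<CC> (univ \<CC>) Ys \<psi> = clopen L \<CC> (univ \<CC>) Ys \<psi>'"
  shows "along \<mu> p \<psi> = along \<mu> p \<psi>'"
proof -
  define P where "P = params \<psi> \<union> params \<psi>'"
  have P: "finite P" "P \<subseteq> univ \<CC>" "\<psi> \<in> Fml L P Ys" "\<psi>' \<in> Fml L P Ys" using \<psi> by (auto simp: P_def Fml_def)
  obtain \<tau> where t: "twist p P \<tau>" using twist_exists[OF p P(1,2)] by blast
  have "clopen L \<CC> (univ \<CC>) Ys (pmap \<tau> \<psi>) = clopen L \<CC> (univ \<CC>) Ys (pmap \<tau> \<psi>')"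
    using twist_clopen_mono[OF p t P(2,3,4)] twist_clopen_mono[OF p t P(2,4,3)] eq by auto
  then show ?thesis using along_eq[OF inv p t _ P(2)] P(3,4) by (simp add: mval_def)
qed

text \<open>The formula on the left is the disjunction. A common twist sends disjoint clopen sets to
  disjoint ones, by monotonicity applied to \<psi> and the negation of \<psi>', so additivity of
  \<mu> applies.\<close>

lemma along_add:
  assumes \<mu>: "global_keisler L \<CC> \<mu>" and inv: "invariant L \<CC> (univ M) \<mu>" and p: "p \<in> S\<^sub>m"
    and \<psi>: "\<psi> \<in> Fml L (univ \<CC>) Ys" "\<psi>' \<in> Fml L (univ \<CC>) Ys"
    and disj: "clopen L \<CC> (univ \<CC>) Ys \<psi> \<inter> clopen L \<CC> (univ \<CC>) Ys \<psi>' = {}"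
  shows "along \<mu> p (Neg (And (Neg \<psi>) (Neg \<psi>'))) = along \<mu> p \<psi> + along \<mu> p \<psi>'"
proof -
  interpret prob_space \<mu> using \<mu> by (simp add: keisler_def)
  have s: "sets \<mu> = sets (type_borel L \<CC> (univ \<CC>) Ys)" using \<mu> by (simp add: keisler_def)
  define P where "P = params \<psi> \<union> params \<psi>'"
  have P: "finite P" "P \<subseteq> univ \<CC>" "\<psi> \<in> Fml L P Ys" "\<psi>' \<in> Fml L P Ys" using \<psi> by (auto simp: P_def Fml_def)
  obtain \<tau> where t: "twist p P \<tau>" using twist_exists[OF p P(1,2)] by blast
  have tF: "pmap \<tau> \<psi> \<in> Fml L (univ \<CC>) Ys" "pmap \<tau> \<psi>' \<in> Fml L (univ \<CC>) Ys"
    using P t by (auto intro!: pmap_in_Fml simp: twist_def)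
  have "clopen L \<CC> (univ \<CC>) Ys (pmap \<tau> \<psi>) \<subseteq> clopen L \<CC> (univ \<CC>) Ys (pmap \<tau> (Neg \<psi>'))"
    by (rule twist_clopen_mono[OF p t P(2,3)])
      (use P disj \<psi> clopen_subset[of L \<CC> "univ \<CC>" Ys \<psi>] in \<open>auto simp: clopen_Neg\<close>)
  then have d: "clopen L \<CC> (univ \<CC>) Ys (pmap \<tau> \<psi>) \<inter> clopen L \<CC> (univ \<CC>) Ys (pmap \<tau> \<psi>') = {}"
    using tF by (auto simp: clopen_Neg)
  have "clopen L \<CC> (univ \<CC>) Ys (pmap \<tau> (Neg (And (Neg \<psi>) (Neg \<psi>')))) =
      clopen L \<CC> (univ \<CC>) Ys (pmap \<tau> \<psi>) \<union> clopen L \<CC> (univ \<CC>) Ys (pmap \<tau> \<psi>')"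
    using tF clopen_subset[of L \<CC> "univ \<CC>" Ys] by (auto simp: clopen_And clopen_Neg)
  moreover have "clopen L \<CC> (univ \<CC>) Ys (pmap \<tau> \<psi>) \<in> events" "clopen L \<CC> (univ \<CC>) Ys (pmap \<tau> \<psi>') \<in> events"
    using clopen_in_type_borel tF s by blast+
  ultimately have "mval L \<CC> \<mu> (pmap \<tau> (Neg (And (Neg \<psi>) (Neg \<psi>')))) =
      mval L \<CC> \<mu> (pmap \<tau> \<psi>) + mval L \<CC> \<mu> (pmap \<tau> \<psi>')"
    using finite_measure_Union d unfolding mval_def by metis
  then show ?thesis using along_eq[OF inv p t _ P(2)] P(3,4) by simp
qed

lemma along_no_params: "params \<psi> = {} \<Longrightarrow> along \<mu> p \<psi> = mval L \<CC> \<mu> \<psi>"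
  unfolding along_def by (subst pmap_idI) auto

lemma along_truth:
  assumes "global_keisler L \<CC> \<mu>"
  shows "along \<mu> p truth = 1"
proof -
  interpret prob_space \<mu> using assms by (simp add: keisler_def)
  have "space \<mu> = types L \<CC> (univ \<CC>) Ys"
    using assms sets_eq_imp_space_eq by (metis keisler_def space_type_borel)
  then show ?thesis using prob_space
    by (subst along_no_params) (auto simp: truth_def mval_def clopen_truth[unfolded truth_def])
qed

section \<open>Convolution as an average over a type space\<close>

context
  fixes \<mu> \<nu> :: "('f, 'r, 'i var, 'a) fml set measure"
  assumes \<mu>: "global_keisler L \<CC> \<mu>" and bd: "borel_definable L \<CC> (univ M) \<mu>"
    and \<nu>: "keisler_m L \<CC> m \<nu>"
begin

lemma bd_invariant: "invariant L \<CC> (univ M) \<mu>"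
  using bd by (simp add: borel_definable_def)

lemma Fmap_measurable:
  assumes "\<phi> \<in> Fml L {} (Xs \<union> Ys)"
  shows "Fmap L \<CC> (univ M) Xs \<mu> \<phi> \<in> borel_measurable (type_borel L \<CC> (univ M) Xs)"
proof -
  have "Xs \<subseteq> - Ys" by auto
  then show ?thesis using bd assms unfolding borel_definable_def by (metis Un_commute)
qed

text \<open>Borel definability of \<mu> enters here: once \<psi> is written as \<phi>(b; y),
  \<open>along\<close> is the composite of the measurable \<open>h\<close> with the Borel function
  \<open>Fmap\<close>.\<close>

lemma along_measurable:
  assumes \<psi>: "\<psi> \<in> Fml L (univ \<CC>) Ys"
  shows "(\<lambda>p. along \<mu> p \<psi>) \<in> borel_measurable (restrict_space \<nu> S\<^sub>m)"
proof -
  obtain \<phi> b where \<phi>: "\<phi> \<in> Fml L {} (Xs \<union> Ys)" and b: "range b \<subseteq> univ \<CC>"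
    and eq: "\<And>s. sat \<CC> s (inst Xs (asg b) \<phi>) = sat \<CC> s \<psi>" using ex_inst_equiv[OF \<psi>] by blast
  note F = inst_Xs_in_Fml[OF \<phi> b]
  have "along \<mu> p \<psi> = Fmap L \<CC> (univ M) Xs \<mu> \<phi> (h L \<CC> \<CC>' M m b p)" if p: "p \<in> S\<^sub>m" for p
    unfolding Fmap_h[OF bd_invariant p b \<phi>]
    by (rule along_cong[OF bd_invariant p \<psi> F]) (rule clopen_eqI[OF \<psi> F], simp add: eq)
  moreover have "(\<lambda>p. Fmap L \<CC> (univ M) Xs \<mu> \<phi> (h L \<CC> \<CC>' M m b p)) \<in> borel_measurable (restrict_space \<nu> S\<^sub>m)"
    by (rule measurable_compose[OF h_measurable[OF keisler_m_D(2)[OF \<nu>] b] Fmap_measurable[OF \<phi>]])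
  ultimately show ?thesis using keisler_m_D(8)[OF \<nu>] by (subst measurable_cong) auto
qed

lemma along_integrable:
  assumes \<psi>: "\<psi> \<in> Fml L (univ \<CC>) Ys"
  shows "integrable (restrict_space \<nu> S\<^sub>m) (\<lambda>p. along \<mu> p \<psi>)"
proof -
  interpret prob_space "restrict_space \<nu> S\<^sub>m" by (rule keisler_m_D(7)[OF \<nu>])
  show ?thesis
    by (rule integrable_const_bound[of _ 1]) (use along_bounds[OF \<mu>] along_measurable[OF \<psi>] in auto)
qed

lemma morley_push_h:
  assumes \<phi>: "\<phi> \<in> Fml L {} (Xs \<union> Ys)" and b: "range b \<subseteq> univ \<CC>"
  shows "morley L \<CC> M \<mu> (push_h L \<CC> \<CC>' M m b \<nu>) \<phi> =
    (\<integral>p. along \<mu> p (inst Xs (asg b) \<phi>) \<partial>restrict_space \<nu> S\<^sub>m)"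
proof -
  have "morley L \<CC> M \<mu> (push_h L \<CC> \<CC>' M m b \<nu>) \<phi> =
      (\<integral>p. Fmap L \<CC> (univ M) Xs \<mu> \<phi> (h L \<CC> \<CC>' M m b p) \<partial>restrict_space \<nu> S\<^sub>m)"
    unfolding morley_def push_h_def
    by (rule integral_distr[OF h_measurable[OF keisler_m_D(2)[OF \<nu>] b] Fmap_measurable[OF \<phi>]])
  also have "\<dots> = (\<integral>p. along \<mu> p (inst Xs (asg b) \<phi>) \<partial>restrict_space \<nu> S\<^sub>m)"
    by (rule Bochner_Integration.integral_cong) (simp_all add: keisler_m_D(8)[OF \<nu>] Fmap_h[OF bd_invariant _ b \<phi>])
  finally show ?thesis .
qed

lemma averaged_measure_exists:
  "\<exists>\<rho>. global_keisler L \<CC> \<rho> \<and>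
     (\<forall>\<psi>\<in>Fml L (univ \<CC>) Ys. mval L \<CC> \<rho> \<psi> = (\<integral>p. along \<mu> p \<psi> \<partial>restrict_space \<nu> S\<^sub>m))"
proof -
  let ?N = "restrict_space \<nu> S\<^sub>m" and ?c = "clopen L \<CC> (univ \<CC>) Ys" and ?F = "Fml L (univ \<CC>) Ys"
  interpret N: prob_space ?N by (rule keisler_m_D(7)[OF \<nu>])
  note sp = keisler_m_D(8)[OF \<nu>]
  \<comment> \<open>A content is a function of sets, so a formula defining \<open>D\<close> has to
    be chosen. By \<open>along_cong\<close> the choice does not affect the value.\<close>
  define v where "v D = (\<integral>p. along \<mu> p (SOME \<psi>. \<psi> \<in> ?F \<and> ?c \<psi> = D) \<partial>?N)" for D
  have v: "v (?c \<psi>) = (\<integral>p. along \<mu> p \<psi> \<partial>?N)" if \<psi>: "\<psi> \<in> ?F" for \<psi>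
  proof -
    define \<psi>' where "\<psi>' = (SOME \<psi>'. \<psi>' \<in> ?F \<and> ?c \<psi>' = ?c \<psi>)"
    have "\<psi>' \<in> ?F \<and> ?c \<psi>' = ?c \<psi>" unfolding \<psi>'_def by (rule someI[of _ \<psi>]) (simp add: \<psi>)
    then have "along \<mu> p \<psi>' = along \<mu> p \<psi>" if "p \<in> S\<^sub>m" for p
      using along_cong[OF bd_invariant that _ \<psi>] by blast
    then show ?thesis unfolding v_def \<psi>'_def[symmetric]
      by (intro Bochner_Integration.integral_cong) (simp_all add: sp)
  qed
  have "\<exists>\<rho>. regular_prob (type_top L \<CC> (univ \<CC>) Ys) \<rho> \<and> (\<forall>D\<in>?c ` ?F. measure \<rho> D = v D)"
  proof (rule Y.regular_prob_extension)
    fix D :: "('f, 'r, 'i var, 'a) fml set set" assume "D \<in> ?c ` ?F"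
    then show "0 \<le> v D" using along_bounds(1)[OF \<mu>] by (auto simp: v)
  next
    fix D E :: "('f, 'r, 'i var, 'a) fml set set" assume "D \<in> ?c ` ?F" "E \<in> ?c ` ?F" and disj: "D \<inter> E = {}"
    then obtain \<psi> \<psi>' where \<psi>: "\<psi> \<in> ?F" "\<psi>' \<in> ?F" "D = ?c \<psi>" "E = ?c \<psi>'" by blast
    let ?o = "Neg (And (Neg \<psi>) (Neg \<psi>'))"
    have "D \<union> E = ?c ?o"
      using \<psi> clopen_subset[of L \<CC> "univ \<CC>" Ys] by (auto simp: clopen_And clopen_Neg)
    then have "v (D \<union> E) = (\<integral>p. along \<mu> p ?o \<partial>?N)" using v[of ?o] \<psi> by simp
    also have "\<dots> = (\<integral>p. along \<mu> p \<psi> + along \<mu> p \<psi>' \<partial>?N)"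
      using along_add[OF \<mu> bd_invariant] \<psi> disj by (intro Bochner_Integration.integral_cong) (simp_all add: sp)
    also have "\<dots> = v D + v E"
      using \<psi> v along_integrable by (simp add: Bochner_Integration.integral_add)
    finally show "v (D \<union> E) = v D + v E" .
  next
    have "v (topspace (type_top L \<CC> (univ \<CC>) Ys)) = v (?c truth)" by (simp add: clopen_truth)
    also have "\<dots> = 1" by (subst v) (simp_all add: along_truth[OF \<mu>] N.prob_space)
    finally show "v (topspace (type_top L \<CC> (univ \<CC>) Ys)) = 1" .
  qed
  then show ?thesis using v by (auto simp: keisler_iff mval_def)
qed

text \<open>\<open>conv\<close> is a definite description, so its defining property is available
  only after existence and uniqueness. The averaged measure gives existence. Uniqueness holds
  because the formulas \<phi>(b; y) reach all clopen sets and these determine a regular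
  measure.\<close>

lemma conv_spec:
  shows "global_keisler L \<CC> (conv L \<CC> \<CC>' M m \<mu> \<nu>)" (is ?A)
    and "\<phi> \<in> Fml L {} (Xs \<union> Ys) \<Longrightarrow> range b \<subseteq> univ \<CC> \<Longrightarrow>
      mval L \<CC> (conv L \<CC> \<CC>' M m \<mu> \<nu>) (inst Xs (asg b) \<phi>) =
      morley L \<CC> M \<mu> (push_h L \<CC> \<CC>' M m b \<nu>) \<phi>" (is "_ \<Longrightarrow> _ \<Longrightarrow> ?B")
proof -
  define Q where "Q \<rho> \<longleftrightarrow> global_keisler L \<CC> \<rho> \<and>
     (\<forall>\<phi> \<in> Fml L {} (Xs \<union> Ys). \<forall>b. range b \<subseteq> univ \<CC> \<longrightarrow>
        mval L \<CC> \<rho> (inst Xs (asg b) \<phi>) = morley L \<CC> M \<mu> (push_h L \<CC> \<CC>' M m b \<nu>) \<phi>)" for \<rho>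
  obtain \<rho> where \<rho>: "global_keisler L \<CC> \<rho>"
    "\<forall>\<psi>\<in>Fml L (univ \<CC>) Ys. mval L \<CC> \<rho> \<psi> = (\<integral>p. along \<mu> p \<psi> \<partial>restrict_space \<nu> S\<^sub>m)"
    using averaged_measure_exists by blast
  have "Q \<rho>" unfolding Q_def
  proof (intro conjI ballI allI impI)
    fix \<phi> :: "('f, 'r, 'i var, 'a) fml" and b :: "'i \<Rightarrow> 'a"
    assume \<phi>: "\<phi> \<in> Fml L {} (Xs \<union> Ys)" and b: "range b \<subseteq> univ \<CC>"
    show "mval L \<CC> \<rho> (inst Xs (asg b) \<phi>) = morley L \<CC> M \<mu> (push_h L \<CC> \<CC>' M m b \<nu>) \<phi>"
      using bspec[OF \<rho>(2) inst_Xs_in_Fml[OF \<phi> b]] morley_push_h[OF \<phi> b] by simp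
  qed (rule \<rho>(1))
  moreover have "\<rho>' = \<rho>" if "Q \<rho>'" for \<rho>'
  proof (rule Y.regular_prob_unique)
    show "regular_prob (type_top L \<CC> (univ \<CC>) Ys) \<rho>'" "regular_prob (type_top L \<CC> (univ \<CC>) Ys) \<rho>"
      using that \<rho>(1) by (simp_all add: Q_def keisler_iff)
    fix D :: "('f, 'r, 'i var, 'a) fml set set" assume "D \<in> clopen L \<CC> (univ \<CC>) Ys ` Fml L (univ \<CC>) Ys"
    then obtain \<psi> where \<psi>: "\<psi> \<in> Fml L (univ \<CC>) Ys" "D = clopen L \<CC> (univ \<CC>) Ys \<psi>" by blast
    obtain \<phi> b where \<phi>: "\<phi> \<in> Fml L {} (Xs \<union> Ys)" and b: "range b \<subseteq> univ \<CC>"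
      and eq: "\<And>s. sat \<CC> s (inst Xs (asg b) \<phi>) = sat \<CC> s \<psi>" using ex_inst_equiv[OF \<psi>(1)] by blast
    have "D = clopen L \<CC> (univ \<CC>) Ys (inst Xs (asg b) \<phi>)"
      unfolding \<psi>(2) by (rule clopen_eqI[OF \<psi>(1) inst_Xs_in_Fml[OF \<phi> b]]) (simp add: eq)
    moreover have "mval L \<CC> \<rho>' (inst Xs (asg b) \<phi>) = mval L \<CC> \<rho> (inst Xs (asg b) \<phi>)"
      using that \<open>Q \<rho>\<close> \<phi> b by (simp add: Q_def)
    ultimately show "measure \<rho>' D = measure \<rho> D" by (simp add: mval_def)
  qed
  ultimately have "Q (THE \<rho>. Q \<rho>)" by (rule theI)
  then have "Q (conv L \<CC> \<CC>' M m \<mu> \<nu>)" by (simp add: conv_def Q_def[abs_def])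
  then show ?A "\<phi> \<in> Fml L {} (Xs \<union> Ys) \<Longrightarrow> range b \<subseteq> univ \<CC> \<Longrightarrow> ?B" by (auto simp: Q_def)
qed

lemma mval_conv:
  assumes \<psi>: "\<psi> \<in> Fml L (univ \<CC>) Ys"
  shows "mval L \<CC> (conv L \<CC> \<CC>' M m \<mu> \<nu>) \<psi> = (\<integral>p. along \<mu> p \<psi> \<partial>restrict_space \<nu> S\<^sub>m)"
proof -
  obtain \<phi> b where \<phi>: "\<phi> \<in> Fml L {} (Xs \<union> Ys)" and b: "range b \<subseteq> univ \<CC>"
    and eq: "\<And>s. sat \<CC> s (inst Xs (asg b) \<phi>) = sat \<CC> s \<psi>" using ex_inst_equiv[OF \<psi>] by blast
  have c: "clopen L \<CC> (univ \<CC>) Ys \<psi> = clopen L \<CC> (univ \<CC>) Ys (inst Xs (asg b) \<phi>)"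
    by (rule clopen_eqI[OF \<psi> inst_Xs_in_Fml[OF \<phi> b]]) (simp add: eq)
  then have "mval L \<CC> (conv L \<CC> \<CC>' M m \<mu> \<nu>) \<psi> = (\<integral>p. along \<mu> p (inst Xs (asg b) \<phi>) \<partial>restrict_space \<nu> S\<^sub>m)"
    using conv_spec(2)[OF \<phi> b] morley_push_h[OF \<phi> b] by (simp add: mval_def)
  also have "\<dots> = (\<integral>p. along \<mu> p \<psi> \<partial>restrict_space \<nu> S\<^sub>m)"
    using along_cong[OF bd_invariant _ inst_Xs_in_Fml[OF \<phi> b] \<psi> c[symmetric]]
    by (intro Bochner_Integration.integral_cong) (simp_all add: keisler_m_D(8)[OF \<nu>])
  finally show ?thesis .
qed

text \<open>Needed to push \<nu> * \<eta> forward by \<open>h\<close>. Formulas in the type of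
  \<open>m\<close> have no parameters, so \<open>along\<close> is constantly 1 on them. Regularity
  passes from these single clopen sets to their intersection \<open>S\<^sub>m\<close>.\<close>

lemma conv_keisler_m:
  assumes \<mu>m: "keisler_m L \<CC> m \<mu>"
  shows "keisler_m L \<CC> m (conv L \<CC> \<CC>' M m \<mu> \<nu>)"
proof -
  interpret N: prob_space "restrict_space \<nu> S\<^sub>m" by (rule keisler_m_D(7)[OF \<nu>])
  note k = keisler_m_D[OF \<mu>m]
  interpret prob_space \<mu> by (rule k(3))
  have "measure (conv L \<CC> \<CC>' M m \<mu> \<nu>) S\<^sub>m = 1"
    unfolding Sm_eq
  proof (rule Y.regular_prob_Inter)
    show "regular_prob (type_top L \<CC> (univ \<CC>) Ys) (conv L \<CC> \<CC>' M m \<mu> \<nu>)"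
      using conv_spec(1) by (simp add: keisler_iff)
    show "clopen L \<CC> (univ \<CC>) Ys ` tp L \<CC> {} Ys (asg m) \<subseteq> clopen L \<CC> (univ \<CC>) Ys ` Fml L (univ \<CC>) Ys"
      using tp_m_Fml by blast
    fix D assume "D \<in> clopen L \<CC> (univ \<CC>) Ys ` tp L \<CC> {} Ys (asg m)"
    then obtain \<psi> where \<psi>: "\<psi> \<in> tp L \<CC> {} Ys (asg m)" "D = clopen L \<CC> (univ \<CC>) Ys \<psi>" by blast
    have D: "D \<in> events" using clopen_in_type_borel[OF tp_m_Fml[OF \<psi>(1)]] k(2) \<psi>(2) by simp
    have "S\<^sub>m \<subseteq> D" using \<psi> by (auto simp: types_m_def clopen_def)
    then have "1 \<le> measure \<mu> D" using finite_measure_mono[OF _ D] k(5) by metis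
    then have "mval L \<CC> \<mu> \<psi> = 1" using prob_le_1[of D] unfolding mval_def \<psi>(2) by linarith
    moreover have "params \<psi> = {}" using \<psi>(1) by (auto simp: tp_def Fml_def)
    ultimately have "mval L \<CC> (conv L \<CC> \<CC>' M m \<mu> \<nu>) \<psi> = 1"
      using mval_conv[OF tp_m_Fml[OF \<psi>(1)]] by (simp add: along_no_params N.prob_space)
    then show "measure (conv L \<CC> \<CC>' M m \<mu> \<nu>) D = 1" by (simp add: mval_def \<psi>(2))
  qed
  then show ?thesis using conv_spec(1) by (simp add: keisler_m_def)
qed

end

section \<open>Associativity\<close>

lemma definable_imp_borel_definable:
  fixes \<mu> :: "('f, 'r, 'i var, 'a) fml set measure"
  assumes "definable L \<CC> A \<mu>"
  shows "borel_definable L \<CC> A \<mu>"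
  unfolding borel_definable_def
proof (intro conjI allI impI ballI)
  fix V and \<phi> :: "('f, 'r, 'i var, 'a) fml" assume "V \<subseteq> - Ys" "\<phi> \<in> Fml L {} (Ys \<union> V)"
  then have "continuous_map (type_top L \<CC> A V) euclideanreal (Fmap L \<CC> A V \<mu> \<phi>)"
    using assms by (simp add: definable_def)
  then show "Fmap L \<CC> A V \<mu> \<phi> \<in> borel_measurable (type_borel L \<CC> A V)"
    by (rule clopen_base.continuous_borel_measurable[OF clopen_base_types])
      (simp_all add: sets_type_borel space_type_borel)
qed (use assms in \<open>simp add: definable_def\<close>)

text \<open>Repeats the choice made inside \<open>Fmap\<close>, so that for every measure, in
  particular for a convolution, \<open>Fmap\<close> at \<open>q\<close> is literally the value at
  the tuple \<open>rlz q\<close>.\<close>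

definition rlz :: "('f, 'r, 'i var, 'a) fml set \<Rightarrow> 'i \<Rightarrow> 'a" where
  "rlz q = (SOME c :: 'i var \<Rightarrow> 'a. range c \<subseteq> univ \<CC> \<and> tp L \<CC> (univ M) Xs c = q) \<circ> Xv"

lemma range_rlz:
  assumes "q \<in> types L \<CC> (univ M) Xs"
  shows "range (rlz q) \<subseteq> univ \<CC>"
  using someI_ex[OF realize_Xs[OF assms]] by (auto simp: rlz_def)

lemma Fmap_rlz: "Fmap L \<CC> (univ M) Xs \<mu> \<phi> q = mval L \<CC> \<mu> (inst Xs (asg (rlz q)) \<phi>)"
proof -
  have "inst Xs (SOME c. range c \<subseteq> univ \<CC> \<and> tp L \<CC> (univ M) Xs c = q) \<phi> = inst Xs (asg (rlz q)) \<phi>"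
    by (rule inst_cong) (auto simp: rlz_def)
  then show ?thesis by (simp add: Fmap_def)
qed

lemma morley_assoc:
  assumes \<mu>: "global_keisler L \<CC> \<mu>" "definable L \<CC> (univ M) \<mu>"
    and \<nu>: "keisler_m L \<CC> m \<nu>" "borel_definable L \<CC> (univ M) \<nu>" and \<eta>: "keisler_m L \<CC> m \<eta>"
    and \<phi>: "\<phi> \<in> Fml L {} (Xs \<union> Ys)" and b: "range b \<subseteq> univ \<CC>"
  shows "morley L \<CC> M (conv L \<CC> \<CC>' M m \<mu> \<nu>) (push_h L \<CC> \<CC>' M m b \<eta>) \<phi> =
    morley L \<CC> M \<mu> (push_h L \<CC> \<CC>' M m b (conv L \<CC> \<CC>' M m \<nu> \<eta>)) \<phi>"
proof -
  note \<nu>g = keisler_m_D(1)[OF \<nu>(1)]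
  note \<mu>b = definable_imp_borel_definable[OF \<mu>(2)]
  define \<omega> where "\<omega> = conv L \<CC> \<CC>' M m \<nu> \<eta>"
  define N where "N = push_h L \<CC> \<CC>' M m b \<eta>"
  \<comment> \<open>For \<open>c = rlz q\<close> this is the push-forward of \<nu> by h_c.
    Integrating \<open>Fmap\<close> of \<mu> and \<phi> against it gives, by the specification of
    \<mu> * \<nu>, the value of that convolution at \<phi>(c; y).\<close>
  define K where "K q = push_h L \<CC> \<CC>' M m (rlz q) \<nu>" for q
  have \<omega>: "keisler_m L \<CC> m \<omega>" unfolding \<omega>_def by (rule conv_keisler_m[OF \<nu>g \<nu>(2) \<eta> \<nu>(1)])
  have spN: "space N = types L \<CC> (univ M) Xs" "sets N = sets (type_borel L \<CC> (univ M) Xs)"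
    unfolding N_def by (rule push_h_prob[OF \<eta> b])+
  have KF: "measure (K q) (clopen L \<CC> (univ M) Xs \<theta>) = Fmap L \<CC> (univ M) Xs \<nu> (unname \<theta>) q"
    if "q \<in> space N" "\<theta> \<in> Fml L (univ M) Xs" for q \<theta>
    using that measure_push_h[OF \<nu>(1) range_rlz] by (simp add: K_def Fmap_rlz spN)
  have "(\<integral>q. Fmap L \<CC> (univ M) Xs \<mu> \<phi> q \<partial>push_h L \<CC> \<CC>' M m b \<omega>) =
      (\<integral>q. (\<integral>r. Fmap L \<CC> (univ M) Xs \<mu> \<phi> r \<partial>K q) \<partial>N)"
  proof (rule X.integral_kernel)
    \<comment> \<open>The integrand must be continuous for the kernel argument. This is where
      definability of \<mu>, rather than Borel definability, is used.\<close>
    have "Xs \<subseteq> - Ys" by auto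
    then show "continuous_map (type_top L \<CC> (univ M) Xs) euclideanreal (Fmap L \<CC> (univ M) Xs \<mu> \<phi>)"
      using \<mu>(2) \<phi> unfolding definable_def by (metis Un_commute)
    show "prob_space N" unfolding N_def by (rule push_h_prob[OF \<eta> b])
    show "prob_space (push_h L \<CC> \<CC>' M m b \<omega>)" by (rule push_h_prob[OF \<omega> b])
    show "sets (push_h L \<CC> \<CC>' M m b \<omega>) = X.borel_sets"
      by (simp only: push_h_prob[OF \<omega> b] sets_type_borel)
    fix q assume "q \<in> space N"
    then have r: "range (rlz q) \<subseteq> univ \<CC>" using range_rlz spN by simp
    show "prob_space (K q)" unfolding K_def by (rule push_h_prob[OF \<nu>(1) r])
    show "sets (K q) = X.borel_sets" unfolding K_def by (simp only: push_h_prob[OF \<nu>(1) r] sets_type_borel)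
  next
    fix D :: "('f, 'r, 'i var, 'a) fml set set" assume "D \<in> clopen L \<CC> (univ M) Xs ` Fml L (univ M) Xs"
    then obtain \<theta> where \<theta>: "\<theta> \<in> Fml L (univ M) Xs" and D: "D = clopen L \<CC> (univ M) Xs \<theta>" by blast
    note u = unname_in_Fml[OF \<theta>]
    have "Fmap L \<CC> (univ M) Xs \<nu> (unname \<theta>) \<in> borel_measurable N"
      using Fmap_measurable[OF \<nu>g \<nu>(2) \<nu>(1) u] spN measurable_cong_sets by blast
    then show "(\<lambda>q. measure (K q) D) \<in> borel_measurable N"
      unfolding D by (subst measurable_cong[OF KF[OF _ \<theta>]])
    \<comment> \<open>The mixture identity on a clopen set is the specification of \<nu> * \<eta>
      read at \<open>unname \<theta>\<close>: its Morley value is an integral over \<open>N\<close>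
      of the very function that \<open>KF\<close> identifies with the kernel.\<close>
    have "measure (push_h L \<CC> \<CC>' M m b \<omega>) D = mval L \<CC> \<omega> (inst Xs (asg b) (unname \<theta>))"
      unfolding D by (rule measure_push_h[OF \<omega> b \<theta>])
    also have "\<dots> = (\<integral>q. Fmap L \<CC> (univ M) Xs \<nu> (unname \<theta>) q \<partial>N)"
      unfolding \<omega>_def conv_spec(2)[OF \<nu>g \<nu>(2) \<eta> u b] by (simp add: morley_def N_def)
    also have "\<dots> = (\<integral>q. measure (K q) D \<partial>N)"
      by (rule Bochner_Integration.integral_cong) (simp_all add: D KF[OF _ \<theta>])
    finally show "measure (push_h L \<CC> \<CC>' M m b \<omega>) D = (\<integral>q. measure (K q) D \<partial>N)" .
  qed
  also have "\<dots> = (\<integral>q. Fmap L \<CC> (univ M) Xs (conv L \<CC> \<CC>' M m \<mu> \<nu>) \<phi> q \<partial>N)"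
  proof (rule Bochner_Integration.integral_cong)
    fix q assume "q \<in> space N"
    then have r: "range (rlz q) \<subseteq> univ \<CC>" using range_rlz spN by simp
    show "(\<integral>r. Fmap L \<CC> (univ M) Xs \<mu> \<phi> r \<partial>K q) = Fmap L \<CC> (univ M) Xs (conv L \<CC> \<CC>' M m \<mu> \<nu>) \<phi> q"
      unfolding Fmap_rlz[of "conv L \<CC> \<CC>' M m \<mu> \<nu>"] conv_spec(2)[OF \<mu>(1) \<mu>b \<nu>(1) \<phi> r]
      by (simp add: morley_def K_def)
  qed simp
  finally show ?thesis by (simp add: morley_def N_def \<omega>_def)
qed

end

theorem theorem4p35:
  fixes L :: "('f, 'r) language"
    and T :: "('f, 'r, nat, 'a) fml set"
    and \<CC> \<CC>' M :: "('f, 'r, 'a) struct"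
    and \<kappa> :: "'k rel" and \<kappa>' :: "'l rel"
    and m :: "'i \<Rightarrow> 'a"
    and \<mu> \<nu> \<eta> :: "('f, 'r, 'i var, 'a) fml set measure"
  assumes "complete_theory L T" and "model_of L \<CC> T"
    and "monster L \<kappa> \<CC>"
    and "monster L \<kappa>' \<CC>'" and "elem_sub L \<CC> \<CC>'" and "|univ \<CC>| <o \<kappa>'"
    and "elem_sub L M \<CC>" and "|univ M| <o \<kappa>"
    and "range m = univ M" and "|UNIV :: 'i set| <o \<kappa>"
    and "keisler_m L \<CC> m \<nu>" and "invariant L \<CC> (univ M) \<nu>" and "borel_definable L \<CC> (univ M) \<nu>"
    and "keisler_m L \<CC> m \<eta>" and "invariant L \<CC> (univ M) \<eta>"
    and "global_keisler L \<CC> \<mu>" and "invariant L \<CC> (univ M) \<mu>" and "definable L \<CC> (univ M) \<mu>"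
  shows "conv L \<CC> \<CC>' M m (conv L \<CC> \<CC>' M m \<mu> \<nu>) \<eta> = conv L \<CC> \<CC>' M m \<mu> (conv L \<CC> \<CC>' M m \<nu> \<eta>)"
proof -
  interpret monster_pair L \<CC> \<CC>' M \<kappa> \<kappa>' m
    using assms by unfold_locales
  have "morley L \<CC> M (conv L \<CC> \<CC>' M m \<mu> \<nu>) (push_h L \<CC> \<CC>' M m b \<eta>) \<phi> =
      morley L \<CC> M \<mu> (push_h L \<CC> \<CC>' M m b (conv L \<CC> \<CC>' M m \<nu> \<eta>)) \<phi>"
    if "\<phi> \<in> Fml L {} (Xs \<union> Ys)" "range b \<subseteq> univ \<CC>" for \<phi> b
    using assms that by (intro morley_assoc)
  then show ?thesis
    unfolding conv_def[of L \<CC> \<CC>' M m "conv L \<CC> \<CC>' M m \<mu> \<nu>" \<eta>]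
      conv_def[of L \<CC> \<CC>' M m \<mu> "conv L \<CC> \<CC>' M m \<nu> \<eta>"]
    by (simp cong: conj_cong)
qed

end
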